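(* Let $\mathbb{G}$ be a homogeneous group of homogeneous dimension $Q\ge3$, let $|\cdot|$ be a homogeneous quasi-norm on $\mathbb{G}$, and let $\mathcal{R}$ be the associated radial derivative operator. (a) Let $\alpha\in\mathbb{R}$ and $k\in\mathbb{N}$ be such that $\prod_{j=0}^{k-1}\left|\frac{Q-2}{2}-(\alpha+j)\right|\ne0$. Then for all complex-valued functions $f\in C_0^\infty(\mathbb{G}\setminus\{0\})$, $$\left\|\frac{f}{|x|^{k+\alpha}}\right\|_{L^2(\mathbb{G})}\le\left[\prod_{j=0}^{k-1}\left|\frac{Q-2}{2}-(\alpha+j)\right|\right]^{-1}\left\|\frac{1}{|x|^\alpha}\mathcal{R}^kf\right\|_{L^2(\mathbb{G})},$$ where the constant is sharp (it is the smallest constant for which the inequality holds for all such $f$), and it is attained (i.e. equality holds) if and only if $f=0$. (b) Moreover, for all $k\in\mathbb{N}$, $\alpha\in\mathbb{R}$ and all complex-valued $f\in C_0^\infty(\mathbb{G}\setminus\{0\})$, $$\left\|\frac{1}{|x|^\alpha}\mathcal{R}^kf\right\|_{L^2(\mathbb{G})}^2=\left[\prod_{j=0}^{k-1}\left(\frac{Q-2}{2}-(\alpha+j)\right)^2\right]\left\|\frac{f}{|x|^{k+\alpha}}\right\|_{L^2(\mathbb{G})}^2$$ $$+\sum_{l=1}^{k-1}\left[\prod_{j=0}^{l-1}\left(\frac{Q-2}{2}-(\alpha+j)\right)^2\right]\left\|\frac{1}{|x|^{l+\alpha}}\mathcal{R}^{k-l}f+\frac{Q-2(l+1+\alpha)}{2|x|^{l+1+\alpha}}\mathcal{R}^{k-l-1}f\right\|_{L^2(\mathbb{G})}^2$$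 $$+\left\|\frac{1}{|x|^\alpha}\mathcal{R}^kf+\frac{Q-2-2\alpha}{2|x|^{1+\alpha}}\mathcal{R}^{k-1}f\right\|_{L^2(\mathbb{G})}^2 .$$
   Context: A homogeneous group $\mathbb{G}$ is a connected, simply connected Lie group whose Lie algebra $\mathfrak{g}$ is equipped with a family of dilations $D_\lambda=\mathrm{Exp}(A\ln\lambda)=\sum_{k\ge0}\frac{1}{k!}(\ln(\lambda)A)^k$, $\lambda>0$, where $A$ is a diagonalisable linear operator on $\mathfrak{g}$ with positive eigenvalues and each $D_\lambda$ is a Lie algebra morphism. Such a group is nilpotent and the exponential map $\exp_{\mathbb{G}}:\mathfrak{g}\to\mathbb{G}$ is a global diffeomorphism; it transports the dilations to $\mathbb{G}$, where they are written $D_\lambda x$ or $\lambda x$, i.e. $D_\lambda(\exp_{\mathbb{G}}X)=\exp_{\mathbb{G}}(D_\lambda X)$. The homogeneous dimension is $Q=\mathrm{Tr}\,A$. The identity element of $\mathbb{G}$ is denoted $0$, $dx$ denotes Haar measure on $\mathbb{G}$, and $L^2(\mathbb{G})$ is taken with respect to $dx$. A homogeneous quasi-norm is a continuous function $|\cdot|:\mathbb{G}\to[0,\infty)$ with $|x^{-1}|=|x|$ for all $x\in\mathbb{G}$, $|\lambda x|=\lambda|x|$ for all $x\in\mathbb{G}$, $\lambda>0$, and $|x|=0$ if and only if $x=0$. The operator $\mathcal{R}=\frac{d}{d|x|}$ is the radial derivative: for $x\neq 0$, writing $x=D_{\rho}y$ with $\rho=|x|$ and $|y|=1$, $\mathcal{R}f(x)=\frac{d}{dr}f(D_r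 y)\big|_{r=\rho}$. $\mathcal{R}^k$ is its $k$-th iterate, with $\mathcal{R}^0f=f$. $C_0^\infty(\mathbb{G}\setminus\{0\})$ is the space of smooth functions with compact support in $\mathbb{G}\setminus\{0\}$. $\mathbb{N}=\{1,2,\ldots\}$; empty sums are $0$. *)

theory Defs
  imports "HOL-Analysis.Analysis"
begin

section \<open>Smooth maps between open subsets of Euclidean spaces\<close>

text \<open>Meant for open \<open>S\<close> only.\<close>

fun Ck_on :: "nat \<Rightarrow> 'a::euclidean_space set \<Rightarrow> ('a \<Rightarrow> 'b::real_normed_vector) \<Rightarrow> bool" where
  "Ck_on 0 S f \<longleftrightarrow> continuous_on S f"
| "Ck_on (Suc k) S f \<longleftrightarrow>
     (\<forall>x\<in>S. f differentiable (at x)) \<and>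
     (\<forall>v. Ck_on k S (\<lambda>x. frechet_derivative f (at x) v))"

definition smooth_on :: "'a::euclidean_space set \<Rightarrow> ('a \<Rightarrow> 'b::real_normed_vector) \<Rightarrow> bool" where
  "smooth_on S f \<longleftrightarrow> (\<forall>k. Ck_on k S f)"

section \<open>Lie groups\<close>

text \<open>
  The group is the whole type \<open>'g\<close>.  It is written additively, without commutativity (class
  \<open>group_add\<close>): \<open>x + y\<close> is the product, \<open>- x\<close> the inverse and \<open>0\<close> the identity.  The model
  space \<open>'a\<close> of the charts also serves as the vector space underlying the Lie algebra, which has
  the same dimension; its inner product plays no role beyond fixing the topology.
\<close>

type_synonym ('g, 'a) chart = "'g set \<times> ('g \<Rightarrow> 'a)"

definition smooth_atlas ::
    "('g::topological_space, 'a::euclidean_space) chart set \<Rightarrow> bool" where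
  "smooth_atlas charts \<longleftrightarrow>
     (\<Union>(U, \<phi>)\<in>charts. U) = UNIV \<and>
     (\<forall>(U, \<phi>)\<in>charts. open U \<and> open (\<phi> ` U) \<and> homeomorphism U (\<phi> ` U) \<phi> (inv_into U \<phi>)) \<and>
     (\<forall>(U, \<phi>)\<in>charts. \<forall>(V, \<psi>)\<in>charts. smooth_on (\<phi> ` (U \<inter> V)) (\<lambda>a. \<psi> (inv_into U \<phi> a)))"

definition smooth_fun ::
    "('g::topological_space, 'a::euclidean_space) chart set \<Rightarrow> ('g \<Rightarrow> 'b::real_normed_vector) \<Rightarrow> bool"
  where
  "smooth_fun charts f \<longleftrightarrow> (\<forall>(U, \<phi>)\<in>charts. smooth_on (\<phi> ` U) (\<lambda>a. f (inv_into U \<phi> a)))"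

definition lie_group ::
    "('g::{topological_group_add, t2_space, second_countable_topology}, 'a::euclidean_space) chart set
      \<Rightarrow> bool" where
  "lie_group charts \<longleftrightarrow>
     smooth_atlas charts \<and>
     (\<forall>(U, \<phi>)\<in>charts. \<forall>(V, \<psi>)\<in>charts. \<forall>(W, \<eta>)\<in>charts.
        smooth_on {(a, b). a \<in> \<phi> ` U \<and> b \<in> \<psi> ` V \<and> inv_into U \<phi> a + inv_into V \<psi> b \<in> W}
          (\<lambda>(a, b). \<eta> (inv_into U \<phi> a + inv_into V \<psi> b))) \<and>
     (\<forall>(U, \<phi>)\<in>charts. \<forall>(W, \<eta>)\<in>charts.
        smooth_on {a. a \<in> \<phi> ` U \<and> - inv_into U \<phi> a \<in> W} (\<lambda>a. \<eta> (- inv_into U \<phi> a)))"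

section \<open>The Lie algebra and the exponential map\<close>

text \<open>
  Vector fields are derivations of the algebra of smooth real functions.  As HOL functions are
  total, they are normalised to be zero on functions that are not smooth.
\<close>

definition left_invariant_fields ::
    "('g::topological_group_add, 'a::euclidean_space) chart set \<Rightarrow> (('g \<Rightarrow> real) \<Rightarrow> ('g \<Rightarrow> real)) set"
  where
  "left_invariant_fields charts = {Z.
     (\<forall>f. smooth_fun charts f \<longrightarrow> smooth_fun charts (Z f)) \<and>
     (\<forall>f. \<not> smooth_fun charts f \<longrightarrow> Z f = (\<lambda>x. 0)) \<and>
     (\<forall>f g a b. smooth_fun charts f \<longrightarrow> smooth_fun charts g \<longrightarrow>
        Z (\<lambda>x. a * f x + b * g x) = (\<lambda>x. a * Z f x + b * Z g x)) \<and>
     (\<forall>f g. smooth_fun charts f \<longrightarrow> smooth_fun charts g \<longrightarrow>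
        Z (\<lambda>x. f x * g x) = (\<lambda>x. Z f x * g x + f x * Z g x)) \<and>
     (\<forall>f y. smooth_fun charts f \<longrightarrow> Z (\<lambda>x. f (y + x)) = (\<lambda>x. Z f (y + x)))}"

text \<open>\<open>vf\<close> is a linear isomorphism from the vector space \<open>'a\<close> onto the left-invariant vector
  fields; it makes \<open>'a\<close> a copy of the Lie algebra, with the bracket carried over below.\<close>

definition lie_algebra_iso ::
    "('g::topological_group_add, 'a::euclidean_space) chart set
      \<Rightarrow> ('a \<Rightarrow> ('g \<Rightarrow> real) \<Rightarrow> ('g \<Rightarrow> real)) \<Rightarrow> bool" where
  "lie_algebra_iso charts vf \<longleftrightarrow>
     bij_betw vf UNIV (left_invariant_fields charts) \<and>
     (\<forall>a b X Y. vf (a *\<^sub>R X + b *\<^sub>R Y) = (\<lambda>f x. a * vf X f x + b * vf Y f x))"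

definition lie_bracket :: "('a \<Rightarrow> ('g \<Rightarrow> real) \<Rightarrow> ('g \<Rightarrow> real)) \<Rightarrow> 'a \<Rightarrow> 'a \<Rightarrow> 'a" where
  "lie_bracket vf X Y = inv vf (\<lambda>f x. vf X (vf Y f) x - vf Y (vf X f) x)"

text \<open>\<open>expG\<close> sends \<open>X\<close> to the time-one value of the one-parameter subgroup with velocity \<open>X\<close>.\<close>

definition is_exponential_map ::
    "('g::topological_group_add, 'a::euclidean_space) chart set
      \<Rightarrow> ('a \<Rightarrow> ('g \<Rightarrow> real) \<Rightarrow> ('g \<Rightarrow> real)) \<Rightarrow> ('a \<Rightarrow> 'g) \<Rightarrow> bool" where
  "is_exponential_map charts vf expG \<longleftrightarrow>
     (\<forall>X s t. expG ((s + t) *\<^sub>R X) = expG (s *\<^sub>R X) + expG (t *\<^sub>R X)) \<and>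
     (\<forall>X f x. smooth_fun charts f \<longrightarrow>
        ((\<lambda>t. f (x + expG (t *\<^sub>R X))) has_real_derivative vf X f x) (at 0))"

definition global_diffeomorphism ::
    "('g::topological_space, 'a::euclidean_space) chart set \<Rightarrow> ('a \<Rightarrow> 'g) \<Rightarrow> bool" where
  "global_diffeomorphism charts e \<longleftrightarrow>
     bij e \<and> continuous_on UNIV e \<and>
     (\<forall>(U, \<phi>)\<in>charts. smooth_on (e -` U) (\<lambda>X. \<phi> (e X))) \<and>
     smooth_fun charts (inv e)"

section \<open>Homogeneous groups\<close>

definition diagonalisable :: "('a::real_vector \<Rightarrow> 'a) \<Rightarrow> bool" where
  "diagonalisable A \<longleftrightarrow> linear A \<and>
     (\<exists>B. independent B \<and> span B = UNIV \<and> (\<forall>b\<in>B. \<exists>\<nu>. A b = \<nu> *\<^sub>R b))"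

definition positive_eigenvalues :: "('a::real_vector \<Rightarrow> 'a) \<Rightarrow> bool" where
  "positive_eigenvalues A \<longleftrightarrow> (\<forall>\<nu> v. v \<noteq> 0 \<longrightarrow> A v = \<nu> *\<^sub>R v \<longrightarrow> \<nu> > 0)"

definition trace_op :: "('a::euclidean_space \<Rightarrow> 'a) \<Rightarrow> real" where
  "trace_op A = (\<Sum>b\<in>Basis. A b \<bullet> b)"

text \<open>Dilations on the Lie algebra, and their transport to the group.\<close>

definition dil_alg :: "('a::euclidean_space \<Rightarrow> 'a) \<Rightarrow> real \<Rightarrow> 'a \<Rightarrow> 'a" where
  "dil_alg A s X = (\<Sum>k. (1 / fact k) *\<^sub>R ((\<lambda>Y. ln s *\<^sub>R A Y) ^^ k) X)"

definition dil :: "('a::euclidean_space \<Rightarrow> 'a) \<Rightarrow> ('a \<Rightarrow> 'g) \<Rightarrow> real \<Rightarrow> 'g \<Rightarrow> 'g" where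
  "dil A expG s x = expG (dil_alg A s (inv expG x))"

text \<open>
  The last assumption is a theorem about the groups described by the others (they are nilpotent);
  as usual in this setting it is taken as part of the description, since the dilations of the
  group are defined through it.
\<close>

locale homogeneous_group =
  fixes charts ::
      "('g::{topological_group_add, t2_space, second_countable_topology}, 'a::euclidean_space) chart set"
    and vf :: "'a \<Rightarrow> ('g \<Rightarrow> real) \<Rightarrow> ('g \<Rightarrow> real)"
    and expG :: "'a \<Rightarrow> 'g"
    and A :: "'a \<Rightarrow> 'a"
  assumes lie_group: "lie_group charts"
    and connected: "connected (UNIV :: 'g set)"
    and simply_connected: "simply_connected (UNIV :: 'g set)"
    and lie_algebra: "lie_algebra_iso charts vf"
    and exponential: "is_exponential_map charts vf expG"
    and diagonalisable: "diagonalisable A"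
    and positive_eigenvalues: "positive_eigenvalues A"
    and dil_morphism: "\<And>s. s > 0 \<Longrightarrow> linear (dil_alg A s) \<and>
          (\<forall>X Y. dil_alg A s (lie_bracket vf X Y) =
                   lie_bracket vf (dil_alg A s X) (dil_alg A s Y))"
    and exp_diffeomorphism: "global_diffeomorphism charts expG"

definition homogeneous_quasi_norm ::
    "('a::euclidean_space \<Rightarrow> 'a) \<Rightarrow> ('a \<Rightarrow> 'g) \<Rightarrow> ('g::topological_group_add \<Rightarrow> real) \<Rightarrow> bool" where
  "homogeneous_quasi_norm A expG N \<longleftrightarrow>
     continuous_on UNIV N \<and> (\<forall>x. N x \<ge> 0) \<and> (\<forall>x. N (- x) = N x) \<and>
     (\<forall>x s. s > 0 \<longrightarrow> N (dil A expG s x) = s * N x) \<and> (\<forall>x. N x = 0 \<longleftrightarrow> x = 0)"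

text \<open>For \<open>x \<noteq> 0\<close> the point \<open>y\<close> of quasi-norm one with \<open>x = D\<^sub>\<rho> y\<close>, where \<open>\<rho> = N x\<close>, is the dilate of
  \<open>x\<close> by \<open>1 / \<rho>\<close>.  The value at \<open>0\<close> is a dummy.\<close>

definition radial_deriv ::
    "('a::euclidean_space \<Rightarrow> 'a) \<Rightarrow> ('a \<Rightarrow> 'g) \<Rightarrow> ('g::topological_group_add \<Rightarrow> real)
      \<Rightarrow> ('g \<Rightarrow> complex) \<Rightarrow> ('g \<Rightarrow> complex)" where
  "radial_deriv A expG N f x =
     (if x = 0 then 0
      else let \<rho> = N x; y = dil A expG (1 / \<rho>) x
           in vector_derivative (\<lambda>r. f (dil A expG r y)) (at \<rho>))"

text \<open>On a second countable locally compact group such a measure is automatically regular.\<close>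

definition haar_measure :: "'g::topological_group_add measure \<Rightarrow> bool" where
  "haar_measure \<mu> \<longleftrightarrow>
     sets \<mu> = sets borel \<and>
     (\<forall>y. distr \<mu> \<mu> (\<lambda>x. y + x) = \<mu>) \<and>
     (\<forall>K. compact K \<longrightarrow> emeasure \<mu> K < \<infinity>) \<and>
     (\<forall>U. open U \<longrightarrow> U \<noteq> {} \<longrightarrow> emeasure \<mu> U > 0)"

definition L2_norm_wrt :: "'g measure \<Rightarrow> ('g \<Rightarrow> complex) \<Rightarrow> real" where
  "L2_norm_wrt \<mu> f = sqrt (LINT x|\<mu>. (cmod (f x))\<^sup>2)"

text \<open>Smooth functions with compact support in the complement of \<open>0\<close>, extended by zero to \<open>0\<close>.\<close>

definition test_functions ::
    "('g::topological_group_add, 'a::euclidean_space) chart set \<Rightarrow> ('g \<Rightarrow> complex) set" where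
  "test_functions charts =
     {f. smooth_fun charts f \<and> compact (closure {x. f x \<noteq> 0}) \<and> 0 \<notin> closure {x. f x \<noteq> 0}}"

end

theory Submission
  imports Defs
begin

text \<open>
  In exponential coordinates let \<open>M(p) X\<close> be the value at \<open>p\<close> of the left-invariant field \<open>X\<close>.
  Lines through the origin are one-parameter subgroups, so \<open>M(p) p = p\<close>; together with
  \<open>M [X, Y] = DM(M X) Y - DM(M Y) X\<close> this makes \<open>W(t) = t M(tY)\<^sup>-\<^sup>1 X\<close> the solution of
  \<open>W' = X - [Y, W]\<close>, which only sees the Lie algebra.  Hence \<open>M(\<delta>p) \<delta> = \<delta> M(p)\<close> for every
  automorphism \<open>\<delta>\<close> of the Lie algebra.  The density \<open>1 / |det M|\<close> is a left Haar density, and by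
  uniqueness of Haar measure \<open>\<mu>\<close> is scaled by \<open>s\<^sup>Q\<close> under the dilation by \<open>s\<close>.

  Let \<open>E\<close> be the generator of the dilations.  As the quasi-norm \<open>N\<close> is homogeneous of degree
  one, \<open>\<R>\<^sup>k = N\<^sup>-\<^sup>k E (E - 1) \<dots> (E - k + 1)\<close>, and the scaling of \<open>\<mu>\<close> gives
  \<open>\<integral> N\<^sup>s E v = - (Q + s) \<integral> N\<^sup>s v\<close>.  Applied to \<open>v = |g|\<^sup>2\<close>, this expands
  \<open>\<integral> N\<^sup>s |E g + b g|\<^sup>2\<close> for each constant \<open>b\<close>; telescoping over the factors \<open>E - j\<close> yields the
  identity and the inequality.  Equality forces \<open>E f = - c f\<close>, so \<open>f\<close> is homogeneous and, having
  compact support away from \<open>0\<close>, vanishes.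

  For sharpness, multiply a smooth function of degree \<open>\<beta> = k + \<alpha> - Q/2\<close> by a plateau of length
  \<open>n\<close> in the logarithm of the radius.  On it \<open>E (E - 1) \<dots> (E - k + 1)\<close> acts as multiplication by
  the optimal constant up to two transition layers whose norm does not depend on \<open>n\<close>, whereas the
  norm of the plateau is unbounded.
\<close>

section \<open>Calculus of finitely often differentiable maps\<close>

text \<open>The measure \<open>\<mu>\<close> is known only through left invariance, and the
  dilations are related to the Lie bracket, not to the group law. That dilations are group
  automorphisms is never derived; it is enough to know how the Jacobian of the frame of
  left-invariant fields transforms, which a linear ODE controls. The explicit density is a second
  Haar measure, to which \<open>\<mu>\<close> is then proportional. After that the group law is
  forgotten: only dilations, quasi-norm and the scaling of a measure remain. Polar coordinates are
  avoided; integration by parts is the derivative at \<open>t = 0\<close> of the scaling law of an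
  integral.

  The constant comes from the critical degree \<open>\<beta> = k + \<alpha> - Q/2\<close>: there the
  weighted square of a homogeneous function has degree \<open>- Q\<close>, so equal logarithmic
  shells carry equal mass, and \<open>E - j\<close> is multiplication by \<open>\<beta> - j\<close>.
  Up to sign and order these are the factors \<open>(Q - 2)/2 - (\<alpha> + j)\<close>. Since the
  quasi-norm is merely continuous, the near-extremal functions take their radius from one positive
  eigencoordinate.\<close>

lemma Ck_on_cong:
  assumes "open S" "\<And>x. x \<in> S \<Longrightarrow> f x = g x" "Ck_on k S f"
  shows "Ck_on k S g"
  using assms
proof (induction k arbitrary: f g)
  case 0
  then show ?case by (simp cong: continuous_on_cong)
next
  case (Suc k)
  have der: "(g has_derivative frechet_derivative f (at x)) (at x)" if "x \<in> S" for x
    using Suc.prems that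
    by (metis Ck_on.simps(2) frechet_derivative_works has_derivative_transform_within_open)
  then have "frechet_derivative g (at x) = frechet_derivative f (at x)" if "x \<in> S" for x
    using that by (metis frechet_derivative_at)
  then have "Ck_on k S (\<lambda>x. frechet_derivative g (at x) v)" for v
    using Suc.IH[of "\<lambda>x. frechet_derivative f (at x) v"] Suc.prems by simp
  then show ?case using der by (auto simp: differentiable_def)
qed

text \<open>\<open>Ck_on\<close> is phrased through \<open>frechet_derivative\<close>, a chosen
  operator; uniqueness of derivatives lets any explicit formula for the derivative take its
  place.\<close>

lemma Ck_on_SucI:
  assumes "open S" "\<And>x. x \<in> S \<Longrightarrow> (f has_derivative f' x) (at x)"
    "\<And>v. Ck_on k S (\<lambda>x. f' x v)"
  shows "Ck_on (Suc k) S f"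
proof -
  have "Ck_on k S (\<lambda>x. frechet_derivative f (at x) v)" for v
    by (rule Ck_on_cong[OF assms(1) _ assms(3)[of v]]) (metis assms(2) frechet_derivative_at)
  then show ?thesis using assms(2) by (auto simp: differentiable_def)
qed

lemma Ck_on_Suc_derivative:
  "Ck_on (Suc k) S f \<Longrightarrow> x \<in> S \<Longrightarrow> (f has_derivative frechet_derivative f (at x)) (at x)"
  by (simp flip: frechet_derivative_works)

lemma Ck_on_SucD: "Ck_on (Suc k) S f \<Longrightarrow> Ck_on k S f"
proof (induction k arbitrary: f)
  case 0
  then show ?case
    by (auto intro!: differentiable_imp_continuous_on differentiable_at_imp_differentiable_on)
next
  case (Suc k)
  have "Ck_on k S (\<lambda>x. frechet_derivative f (at x) v)" for v
    by (rule Suc.IH) (use Suc.prems in \<open>simp only: Ck_on.simps(2)[of "Suc k"]\<close>)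
  then show ?case using Suc.prems by simp
qed

lemma Ck_on_imp_continuous_on: "Ck_on k S f \<Longrightarrow> continuous_on S f"
proof (induction k)
  case (Suc k)
  then show ?case using Ck_on_SucD by blast
qed simp

lemma Ck_on_local:
  assumes "\<And>x. x \<in> S \<Longrightarrow> \<exists>U. open U \<and> x \<in> U \<and> Ck_on k U f"
  shows "Ck_on k S f"
  using assms
proof (induction k arbitrary: f)
  case 0
  then show ?case
    by (metis Ck_on.simps(1) continuous_at_imp_continuous_on continuous_on_eq_continuous_at)
next
  case (Suc k)
  have "f differentiable (at x)" if "x \<in> S" for x
    using Suc.prems[OF that] by auto
  moreover have "Ck_on k S (\<lambda>x. frechet_derivative f (at x) v)" for v
    by (rule Suc.IH) (use Suc.prems in fastforce)
  ultimately show ?case by simp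
qed

lemma Ck_on_const: "Ck_on k S (\<lambda>x. c)"
proof (cases k)
  case (Suc k)
  have "Ck_on k S (\<lambda>x. 0 :: 'b)" for k
    by (induction k) (auto simp: frechet_derivative_const)
  then show ?thesis by (simp add: Suc frechet_derivative_const)
qed simp

lemma Ck_on_bounded_linear:
  assumes "bounded_linear h" "Ck_on k S f" "open S"
  shows "Ck_on k S (\<lambda>x. h (f x))"
  using assms(2)
proof (induction k arbitrary: f)
  case 0
  then show ?case
    using assms(1) by (auto intro: bounded_linear.continuous_on)
next
  case (Suc k)
  show ?case
  proof (rule Ck_on_SucI[OF assms(3), where f' = "\<lambda>x v. h (frechet_derivative f (at x) v)"])
    show "((\<lambda>x. h (f x)) has_derivative (\<lambda>v. h (frechet_derivative f (at x) v))) (at x)" if "x \<in> S" for x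
      by (rule bounded_linear.has_derivative[OF assms(1) Ck_on_Suc_derivative[OF Suc.prems that]])
  qed (use Suc in auto)
qed

lemma Ck_on_ident: "open S \<Longrightarrow> Ck_on k S (\<lambda>x. x)"
proof (cases k)
  case (Suc k)
  assume "open S"
  then show ?thesis unfolding Suc
    by (intro Ck_on_SucI[where f' = "\<lambda>x v. v"]) (auto simp: Ck_on_const)
qed simp

lemma Ck_on_linear: "bounded_linear h \<Longrightarrow> open S \<Longrightarrow> Ck_on k S h"
  using Ck_on_bounded_linear[OF _ Ck_on_ident] by blast

lemma Ck_on_add:
  assumes "open S" "Ck_on k S f" "Ck_on k S g"
  shows "Ck_on k S (\<lambda>x. f x + g x)"
  using assms(2,3)
proof (induction k arbitrary: f g)
  case 0
  then show ?case by (auto intro: continuous_intros)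
next
  case (Suc k)
  show ?case
    by (rule Ck_on_SucI[OF assms(1), where
          f' = "\<lambda>x v. frechet_derivative f (at x) v + frechet_derivative g (at x) v"])
      (use Suc in \<open>auto intro!: has_derivative_add simp flip: frechet_derivative_works\<close>)
qed

lemma Ck_on_sum:
  assumes "open S" "\<And>i. i \<in> I \<Longrightarrow> Ck_on k S (f i)"
  shows "Ck_on k S (\<lambda>x. \<Sum>i\<in>I. f i x)"
  using assms(2)
proof (induction I rule: infinite_finite_induct)
  case (insert i I)
  have "Ck_on k S (\<lambda>x. f i x + (\<Sum>i\<in>I. f i x))"
    by (rule Ck_on_add[OF assms(1)]) (use insert in auto)
  then show ?case using insert by simp
qed (simp_all add: Ck_on_const)

text \<open>Each Leibniz term pairs a derivative of one factor with the other factor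
  undifferentiated, so the induction also uses that one order of differentiability may be
  dropped.\<close>

lemma Ck_on_bilinear:
  assumes "bounded_bilinear pr" "open S" "Ck_on k S f" "Ck_on k S g"
  shows "Ck_on k S (\<lambda>x. pr (f x) (g x))"
  using assms(3,4)
proof (induction k arbitrary: f g)
  case 0
  then show ?case using assms(1) by (auto intro: bounded_bilinear.continuous_on)
next
  case (Suc k)
  show ?case
  proof (rule Ck_on_SucI[OF assms(2), where
        f' = "\<lambda>x v. pr (f x) (frechet_derivative g (at x) v) + pr (frechet_derivative f (at x) v) (g x)"])
    fix v
    show "Ck_on k S (\<lambda>x. pr (f x) (frechet_derivative g (at x) v) + pr (frechet_derivative f (at x) v) (g x))"
      using Suc.prems Suc.prems[THEN Ck_on_SucD] by (intro Ck_on_add assms(2) Suc.IH) auto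
  qed (use Suc in \<open>auto intro!: bounded_bilinear.FDERIV[OF assms(1)] simp flip: frechet_derivative_works\<close>)
qed

lemma linear_euclidean_sum:
  fixes h :: "'a::euclidean_space \<Rightarrow> 'b::real_vector"
  assumes "linear h"
  shows "h x = (\<Sum>b\<in>Basis. (x \<bullet> b) *\<^sub>R h b)"
proof -
  have "h x = h (\<Sum>b\<in>Basis. (x \<bullet> b) *\<^sub>R b)" by (simp add: euclidean_representation)
  also have "\<dots> = (\<Sum>b\<in>Basis. (x \<bullet> b) *\<^sub>R h b)"
    using assms by (simp add: linear_sum linear_scale)
  finally show ?thesis .
qed

text \<open>In the chain rule the direction \<open>frechet_derivative f (at x) v\<close> varies with
  the point, whereas \<open>Ck_on\<close> controls derivatives of \<open>g\<close> in fixed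
  directions only. Expanding the direction in \<open>Basis\<close> separates the two; this is why
  the intermediate space is Euclidean.\<close>

lemma Ck_on_compose:
  fixes f :: "'a::euclidean_space \<Rightarrow> 'b::euclidean_space" and g :: "'b \<Rightarrow> 'c::real_normed_vector"
  assumes "open S" "open T" "Ck_on k T g" "Ck_on k S f" "f ` S \<subseteq> T"
  shows "Ck_on k S (\<lambda>x. g (f x))"
  using assms(3,4)
proof (induction k arbitrary: g)
  case 0
  then show ?case using assms(5) by (auto intro: continuous_on_compose2)
next
  case (Suc k)
  let ?h = "\<lambda>x v. \<Sum>b\<in>Basis. (frechet_derivative f (at x) v \<bullet> b) *\<^sub>R frechet_derivative g (at (f x)) b"
  show ?case
  proof (rule Ck_on_SucI[OF assms(1), where f' = ?h])
    fix x assume x: "x \<in> S"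
    have f: "(f has_derivative frechet_derivative f (at x)) (at x)"
      and g: "(g has_derivative frechet_derivative g (at (f x))) (at (f x))"
      using Suc.prems x assms(5) by (auto simp flip: frechet_derivative_works)
    have "linear (frechet_derivative g (at (f x)))"
      using g has_derivative_bounded_linear bounded_linear.linear by blast
    then have "(\<lambda>v. frechet_derivative g (at (f x)) (frechet_derivative f (at x) v)) = ?h x"
      by (intro ext linear_euclidean_sum)
    then show "((\<lambda>x. g (f x)) has_derivative ?h x) (at x)"
      using has_derivative_compose[OF f g] by simp
  next
    fix v
    have "Ck_on k S (\<lambda>x. frechet_derivative f (at x) v \<bullet> b)" for b
      using Suc.prems by (intro Ck_on_bounded_linear[OF bounded_linear_inner_left] assms(1)) auto
    moreover have "Ck_on k S (\<lambda>x. frechet_derivative g (at (f x)) b)" for b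
      using Suc.prems(1) Suc.prems(2)[THEN Ck_on_SucD] by (intro Suc.IH) auto
    ultimately show "Ck_on k S (\<lambda>x. ?h x v)"
      by (intro Ck_on_sum Ck_on_bilinear[OF bounded_bilinear_scaleR] assms(1))
  qed
qed

lemma smooth_on_cong:
  "open S \<Longrightarrow> (\<And>x. x \<in> S \<Longrightarrow> f x = g x) \<Longrightarrow> smooth_on S f \<Longrightarrow> smooth_on S g"
  unfolding smooth_on_def using Ck_on_cong by metis

lemma smooth_on_imp_continuous_on: "smooth_on S f \<Longrightarrow> continuous_on S f"
  unfolding smooth_on_def using Ck_on_imp_continuous_on by blast

lemma smooth_on_has_derivative:
  "smooth_on S f \<Longrightarrow> x \<in> S \<Longrightarrow> (f has_derivative frechet_derivative f (at x)) (at x)"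
  unfolding smooth_on_def using Ck_on_Suc_derivative by blast

lemma smooth_on_differentiable: "smooth_on S f \<Longrightarrow> x \<in> S \<Longrightarrow> f differentiable (at x)"
  using smooth_on_has_derivative differentiable_def by blast

lemma smooth_on_frechet_derivative:
  "smooth_on S f \<Longrightarrow> smooth_on S (\<lambda>x. frechet_derivative f (at x) v)"
  unfolding smooth_on_def using Ck_on.simps(2) by blast

lemma smooth_on_local:
  assumes "\<And>x. x \<in> S \<Longrightarrow> \<exists>U. open U \<and> x \<in> U \<and> smooth_on U f"
  shows "smooth_on S f"
  unfolding smooth_on_def
  by (intro allI Ck_on_local) (use assms in \<open>auto simp: smooth_on_def\<close>)

lemma smooth_on_const: "smooth_on S (\<lambda>x. c)"
  unfolding smooth_on_def by (simp add: Ck_on_const)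

lemma smooth_on_linear: "bounded_linear h \<Longrightarrow> open S \<Longrightarrow> smooth_on S h"
  unfolding smooth_on_def by (simp add: Ck_on_linear)

lemma smooth_on_bounded_linear:
  "bounded_linear h \<Longrightarrow> smooth_on S f \<Longrightarrow> open S \<Longrightarrow> smooth_on S (\<lambda>x. h (f x))"
  unfolding smooth_on_def by (simp add: Ck_on_bounded_linear)

lemma smooth_on_add:
  "open S \<Longrightarrow> smooth_on S f \<Longrightarrow> smooth_on S g \<Longrightarrow> smooth_on S (\<lambda>x. f x + g x)"
  unfolding smooth_on_def by (simp add: Ck_on_add)

lemma smooth_on_minus:
  assumes "open S" "smooth_on S f"
  shows "smooth_on S (\<lambda>x. - f x)"
  using smooth_on_bounded_linear[OF bounded_linear_minus[OF bounded_linear_ident] assms(2,1)] .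

lemma smooth_on_diff:
  "open S \<Longrightarrow> smooth_on S f \<Longrightarrow> smooth_on S g \<Longrightarrow> smooth_on S (\<lambda>x. f x - g x)"
  using smooth_on_add[OF _ _ smooth_on_minus, of S f g] by simp

lemma smooth_on_sum:
  "open S \<Longrightarrow> (\<And>i. i \<in> I \<Longrightarrow> smooth_on S (f i)) \<Longrightarrow> smooth_on S (\<lambda>x. \<Sum>i\<in>I. f i x)"
  unfolding smooth_on_def by (simp add: Ck_on_sum)

lemma smooth_on_bilinear:
  "bounded_bilinear pr \<Longrightarrow> open S \<Longrightarrow> smooth_on S f \<Longrightarrow> smooth_on S g \<Longrightarrow>
     smooth_on S (\<lambda>x. pr (f x) (g x))"
  unfolding smooth_on_def by (simp add: Ck_on_bilinear)

lemmas smooth_on_mult = smooth_on_bilinear[OF bounded_bilinear_mult]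
lemmas smooth_on_scaleR = smooth_on_bilinear[OF bounded_bilinear_scaleR]

lemma smooth_on_compose:
  fixes f :: "'a::euclidean_space \<Rightarrow> 'b::euclidean_space" and g :: "'b \<Rightarrow> 'c::real_normed_vector"
  assumes "open S" "open T" "smooth_on T g" "smooth_on S f" "f ` S \<subseteq> T"
  shows "smooth_on S (\<lambda>x. g (f x))"
  using assms Ck_on_compose unfolding smooth_on_def by blast

section \<open>A smooth step function\<close>

lemma Ck_on_real_SucI:
  fixes f :: "real \<Rightarrow> 'b::real_normed_vector"
  assumes "open S" "\<And>x. x \<in> S \<Longrightarrow> (f has_vector_derivative f' x) (at x)" "Ck_on k S f'"
  shows "Ck_on (Suc k) S f"
proof (rule Ck_on_SucI[OF assms(1), where f' = "\<lambda>x v. v *\<^sub>R f' x"])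
  show "Ck_on k S (\<lambda>x. v *\<^sub>R f' x)" for v
    using Ck_on_bounded_linear[OF bounded_linear_scaleR_right assms(3,1)] .
qed (use assms(2) in \<open>simp add: has_vector_derivative_def\<close>)

text \<open>For \<open>m = 0\<close> this is the classical flat function \<open>exp (-1/t)\<close>.
  The powers of \<open>1/t\<close> close the family under differentiation up to linear combinations,
  so that smoothness becomes a single induction.\<close>

definition flat_exp :: "nat \<Rightarrow> real \<Rightarrow> real" where
  "flat_exp m t = (if t > 0 then inverse t ^ m * exp (- inverse t) else 0)"

lemma flat_exp_tendsto_0: "((\<lambda>t. flat_exp m t) \<longlongrightarrow> 0) (at 0)"
proof (rule filterlim_split_at)
  have "eventually (\<lambda>t::real. 0 = flat_exp m t) (at_left 0)"
    by (auto simp: eventually_at_filter flat_exp_def)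
  then show "((\<lambda>t. flat_exp m t) \<longlongrightarrow> 0) (at_left 0)"
    by (rule Lim_transform_eventually[OF tendsto_const])
  have "((\<lambda>x::real. x ^ m / exp x) \<longlongrightarrow> 0) at_top"
    by (rule tendsto_power_div_exp_0)
  then have "((\<lambda>t::real. inverse t ^ m / exp (inverse t)) \<longlongrightarrow> 0) (at_right 0)"
    using filterlim_compose filterlim_inverse_at_top_right by blast
  moreover have "eventually (\<lambda>t::real. inverse t ^ m / exp (inverse t) = flat_exp m t) (at_right 0)"
    by (auto simp: eventually_at_filter flat_exp_def exp_minus field_simps)
  ultimately show "((\<lambda>t. flat_exp m t) \<longlongrightarrow> 0) (at_right 0)"
    by (rule Lim_transform_eventually)
qed

lemma flat_exp_has_derivative:
  "(flat_exp m has_real_derivative flat_exp (m + 2) t - real m * flat_exp (m + 1) t) (at t)"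
proof (cases "t = 0")
  case True
  have "((\<lambda>h. flat_exp (m + 1) h) \<longlongrightarrow> 0) (at 0)"
    by (rule flat_exp_tendsto_0)
  \<comment> \<open>At the origin the difference quotient is itself the next member of the family,
    which tends to 0.\<close>
  moreover have "flat_exp (m + 1) h = (flat_exp m h - flat_exp m 0) / (h - 0)" for h
    by (simp add: flat_exp_def field_simps)
  ultimately show ?thesis
    using True by (simp add: has_field_derivative_iff flat_exp_def)
next
  case False
  show ?thesis
  proof (cases "t > 0")
    case True
    have "((\<lambda>t. inverse t ^ m * exp (- inverse t)) has_real_derivative
        flat_exp (m + 2) t - real m * flat_exp (m + 1) t) (at t)"
      using True
      by (auto intro!: derivative_eq_intros simp: flat_exp_def power2_eq_square)
        (cases m; simp add: field_simps power2_eq_square)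
    then show ?thesis
      by (rule has_field_derivative_transform_within_open[of _ _ _ "{0<..}"])
        (use True in \<open>auto simp: flat_exp_def\<close>)
  next
    case neg: False
    have "((\<lambda>t. 0) has_real_derivative flat_exp (m + 2) t - real m * flat_exp (m + 1) t) (at t)"
      using neg by (simp add: flat_exp_def)
    then show ?thesis
      by (rule has_field_derivative_transform_within_open[of _ _ _ "{..<0}"])
        (use neg False in \<open>auto simp: flat_exp_def\<close>)
  qed
qed

lemma smooth_on_flat_exp: "smooth_on UNIV (flat_exp m)"
  unfolding smooth_on_def
proof
  fix k
  show "Ck_on k UNIV (flat_exp m)"
  proof (induction k arbitrary: m)
    case 0
    then show ?case
      by (metis Ck_on.simps(1) DERIV_continuous continuous_at_imp_continuous_on flat_exp_has_derivative)
  next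
    case (Suc k)
    show ?case
    proof (rule Ck_on_real_SucI)
      show "(flat_exp m has_vector_derivative flat_exp (m + 2) x + (- real m) *\<^sub>R flat_exp (m + 1) x) (at x)" for x
        using flat_exp_has_derivative by (simp add: has_real_derivative_iff_has_vector_derivative)
      show "Ck_on k UNIV (\<lambda>x. flat_exp (m + 2) x + (- real m) *\<^sub>R flat_exp (m + 1) x)"
        by (intro Ck_on_add Ck_on_bounded_linear[OF bounded_linear_scaleR_right] Suc) auto
    qed simp
  qed
qed

lemma smooth_on_real_field_deriv:
  fixes f f' :: "real \<Rightarrow> real"
  assumes "open S" "\<And>x. x \<in> S \<Longrightarrow> (f has_real_derivative f' x) (at x)" "smooth_on S f'"
  shows "smooth_on S f"
  unfolding smooth_on_def
proof
  fix k
  show "Ck_on k S f"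
    using Ck_on_SucD[OF Ck_on_real_SucI[OF assms(1), of f f' k]] assms(2,3)
    by (simp add: has_real_derivative_iff_has_vector_derivative smooth_on_def)
qed

lemma smooth_on_powr: "smooth_on {0<..} (\<lambda>x::real. x powr a)"
  unfolding smooth_on_def
proof
  fix k
  show "Ck_on k {0<..} (\<lambda>x::real. x powr a)"
  proof (induction k arbitrary: a)
    case 0
    then show ?case by (auto intro!: continuous_intros)
  next
    case (Suc k)
    show ?case
    proof (rule Ck_on_real_SucI)
      show "((\<lambda>x. x powr a) has_vector_derivative a *\<^sub>R x powr (a - 1)) (at x)" if "x \<in> {0<..}" for x :: real
        using that has_real_derivative_powr[of x a]
        by (simp add: has_real_derivative_iff_has_vector_derivative)
      show "Ck_on k {0<..} (\<lambda>x. a *\<^sub>R x powr (a - 1))"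
        by (rule Ck_on_bounded_linear[OF bounded_linear_scaleR_right Suc]) simp
    qed simp
  qed
qed

lemma smooth_on_ln: "smooth_on {0<..} (ln :: real \<Rightarrow> real)"
proof (rule smooth_on_real_field_deriv)
  show "smooth_on {0<..} (\<lambda>x::real. x powr (- 1))" by (rule smooth_on_powr)
qed (auto simp: powr_minus inverse_eq_divide intro!: derivative_eq_intros)

definition smooth_step :: "real \<Rightarrow> real" where
  "smooth_step t = flat_exp 0 t / (flat_exp 0 t + flat_exp 0 (1 - t))"

text \<open>The half lines \<open>t > 0\<close> and \<open>t < 1\<close> cover the line, so one
  summand is always positive.\<close>

lemma smooth_step_denominator_pos: "flat_exp 0 t + flat_exp 0 (1 - t) > 0"
  by (cases "t > 0"; cases "t < 1") (auto simp: flat_exp_def intro: add_pos_pos)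

lemma smooth_step_eq_0: "t \<le> 0 \<Longrightarrow> smooth_step t = 0"
  by (simp add: smooth_step_def flat_exp_def)

lemma smooth_step_eq_1: "t \<ge> 1 \<Longrightarrow> smooth_step t = 1"
  by (simp add: smooth_step_def flat_exp_def)

lemma smooth_step_pos: "t > 0 \<Longrightarrow> smooth_step t > 0"
  using smooth_step_denominator_pos[of t] by (simp add: smooth_step_def flat_exp_def)

lemma smooth_step_nonneg: "smooth_step t \<ge> 0"
  by (metis less_eq_real_def linorder_not_le smooth_step_eq_0 smooth_step_pos)

lemma smooth_step_lt_1: "t < 1 \<Longrightarrow> smooth_step t < 1"
  using smooth_step_denominator_pos[of t] by (simp add: smooth_step_def flat_exp_def)

lemma smooth_step_le_1: "smooth_step t \<le> 1"
  by (metis less_eq_real_def linorder_not_le smooth_step_eq_1 smooth_step_lt_1)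

lemma smooth_on_smooth_step: "smooth_on UNIV smooth_step"
proof -
  have c: "smooth_on UNIV (\<lambda>t. flat_exp 0 (1 - t))"
    by (rule smooth_on_compose[OF open_UNIV open_UNIV smooth_on_flat_exp])
      (auto intro!: smooth_on_diff smooth_on_const smooth_on_linear[OF bounded_linear_ident])
  have d: "smooth_on UNIV (\<lambda>t. flat_exp 0 t + flat_exp 0 (1 - t))"
    by (intro smooth_on_add smooth_on_flat_exp c) auto
  have "smooth_on UNIV (\<lambda>t. flat_exp 0 t * (flat_exp 0 t + flat_exp 0 (1 - t)) powr (-1))"
    by (intro smooth_on_mult smooth_on_flat_exp smooth_on_compose[OF _ _ smooth_on_powr d])
      (use smooth_step_denominator_pos in auto)
  then show ?thesis
    using smooth_step_denominator_pos
    by (simp add: smooth_step_def[abs_def] powr_minus divide_inverse less_imp_le)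
qed

section \<open>Uniqueness of Haar measure\<close>

lemma haar_measure_translate:
  assumes "haar_measure \<nu>" "f \<in> borel_measurable borel"
  shows "(\<integral>\<^sup>+x. f (y + x) \<partial>\<nu>) = (\<integral>\<^sup>+x. f x \<partial>\<nu>)"
proof -
  have s: "sets \<nu> = sets borel" and d: "distr \<nu> \<nu> (\<lambda>x. y + x) = \<nu>"
    using assms(1) by (auto simp: haar_measure_def)
  have m: "(\<lambda>x. y + x) \<in> measurable \<nu> \<nu>"
    unfolding measurable_cong_sets[OF s s]
    by (intro borel_measurable_continuous_onI continuous_intros)
  have "(\<integral>\<^sup>+x. f x \<partial>\<nu>) = (\<integral>\<^sup>+x. f x \<partial>distr \<nu> \<nu> (\<lambda>x. y + x))"
    by (simp add: d)
  also have "\<dots> = (\<integral>\<^sup>+x. f (y + x) \<partial>\<nu>)"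
    by (rule nn_integral_distr[OF m]) (simp add: measurable_cong_sets[OF s refl] assms(2))
  finally show ?thesis ..
qed

text \<open>Second countability identifies the Borel sets of the product with the product
  sigma-algebra; the joint measurability obtained this way is what Fubini requires.\<close>

lemma borel_measurable_group_add [measurable]:
  fixes f g :: "'b \<Rightarrow> 'g::{topological_group_add, second_countable_topology}"
  assumes [measurable]: "f \<in> borel_measurable M" "g \<in> borel_measurable M"
  shows "(\<lambda>x. f x + g x) \<in> borel_measurable M"
  using assms
  by (rule borel_measurable_continuous_Pair) (intro continuous_intros)

lemma borel_measurable_group_uminus [measurable]:
  fixes f :: "'b \<Rightarrow> 'g::{topological_group_add}"
  assumes "f \<in> borel_measurable M"
  shows "(\<lambda>x. - f x) \<in> borel_measurable M"
  using assms by (rule borel_measurable_continuous_on[rotated]) (intro continuous_intros)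

text \<open>Both iterated integrals are transformed by left translations only: the substitutions are
  \<open>y \<mapsto> - x + y\<close> in the inner and then \<open>x \<mapsto> y + x\<close> in the outer variable.\<close>

lemma haar_measure_product:
  fixes \<nu> \<eta> :: "'g::{topological_group_add, t2_space, second_countable_topology} measure"
  assumes \<nu>: "haar_measure \<nu>" and \<eta>: "haar_measure \<eta>"
    and sf: "sigma_finite_measure \<nu>" "sigma_finite_measure \<eta>"
    and [measurable]: "f \<in> borel_measurable borel" "g \<in> borel_measurable borel"
  shows "(\<integral>\<^sup>+x. f x \<partial>\<nu>) * (\<integral>\<^sup>+y. g y \<partial>\<eta>) =
    (\<integral>\<^sup>+x. g (- x) * (\<integral>\<^sup>+y. f (y + x) \<partial>\<eta>) \<partial>\<nu>)"
proof -
  have s [measurable_cong]: "sets \<nu> = sets borel" "sets \<eta> = sets borel"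
    using \<nu> \<eta> by (auto simp: haar_measure_def)
  interpret pair_sigma_finite \<nu> \<eta>
    using sf by (simp add: pair_sigma_finite_def)
  have "(\<integral>\<^sup>+x. f x \<partial>\<nu>) * (\<integral>\<^sup>+y. g y \<partial>\<eta>) = (\<integral>\<^sup>+x. f x * (\<integral>\<^sup>+y. g y \<partial>\<eta>) \<partial>\<nu>)"
    by (rule nn_integral_multc[symmetric]) measurable
  also have "\<dots> = (\<integral>\<^sup>+x. f x * (\<integral>\<^sup>+y. g (- x + y) \<partial>\<eta>) \<partial>\<nu>)"
    by (simp add: haar_measure_translate[OF \<eta>])
  also have "\<dots> = (\<integral>\<^sup>+x. (\<integral>\<^sup>+y. f x * g (- x + y) \<partial>\<eta>) \<partial>\<nu>)"
    by (intro nn_integral_cong nn_integral_cmult[symmetric]) measurable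
  also have "\<dots> = (\<integral>\<^sup>+y. (\<integral>\<^sup>+x. f x * g (- x + y) \<partial>\<nu>) \<partial>\<eta>)"
    by (rule Fubini'[symmetric]) measurable
  also have "\<dots> = (\<integral>\<^sup>+y. (\<integral>\<^sup>+x. f (y + x) * g (- (y + x) + y) \<partial>\<nu>) \<partial>\<eta>)"
    by (intro nn_integral_cong haar_measure_translate[OF \<nu>, symmetric]) measurable
  also have "\<dots> = (\<integral>\<^sup>+y. (\<integral>\<^sup>+x. f (y + x) * g (- x) \<partial>\<nu>) \<partial>\<eta>)"
    by (simp add: minus_add add.assoc)
  also have "\<dots> = (\<integral>\<^sup>+x. (\<integral>\<^sup>+y. f (y + x) * g (- x) \<partial>\<eta>) \<partial>\<nu>)"
    by (rule Fubini') measurable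
  also have "\<dots> = (\<integral>\<^sup>+x. (\<integral>\<^sup>+y. f (y + x) \<partial>\<eta>) * g (- x) \<partial>\<nu>)"
    by (intro nn_integral_cong nn_integral_multc) measurable
  finally show ?thesis by (simp add: mult.commute)
qed

text \<open>The product formula is used with one fixed \<open>f\<close> and with a \<open>g\<close>
  adapted to a Borel set \<open>A\<close>: under either measure, the measure of \<open>A\<close>
  becomes the measure of \<open>K\<close> times the same integral of \<open>g\<close>. Local
  compactness enters as the compact set \<open>K\<close> with nonempty interior.\<close>

lemma haar_measure_unique:
  fixes \<nu> \<eta> :: "'g::{topological_group_add, t2_space, second_countable_topology} measure"
  assumes \<nu>: "haar_measure \<nu>" and \<eta>: "haar_measure \<eta>"
    and sf: "sigma_finite_measure \<nu>" "sigma_finite_measure \<eta>"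
    and K: "compact K" "open U" "U \<noteq> {}" "U \<subseteq> (K :: 'g set)"
  shows "\<exists>c. c \<noteq> \<infinity> \<and> \<nu> = density \<eta> (\<lambda>_. c)"
proof -
  have s [measurable_cong]: "sets \<nu> = sets borel" "sets \<eta> = sets borel"
    using \<nu> \<eta> by (auto simp: haar_measure_def)
  interpret pair_sigma_finite \<nu> \<eta>
    using sf by (simp add: pair_sigma_finite_def)
  have Kb [measurable]: "K \<in> sets borel" using K(1) by (simp add: borel_compact)
  define f :: "'g \<Rightarrow> ennreal" where "f = indicator K"
  have f [measurable]: "f \<in> borel_measurable borel" by (simp add: f_def)
  define \<Phi> where "\<Phi> x = (\<integral>\<^sup>+y. f (y + x) \<partial>\<eta>)" for x
  have \<Phi>_meas [measurable]: "\<Phi> \<in> borel_measurable borel"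
    unfolding \<Phi>_def by measurable
  have int_f: "(\<integral>\<^sup>+x. f x \<partial>M) = emeasure M K" if "sets M = sets borel" for M
    by (simp add: f_def that)
  have emK: "emeasure M K \<noteq> \<infinity> \<and> emeasure M K \<noteq> 0" if "haar_measure M" for M
  proof -
    have "emeasure M U \<le> emeasure M K"
      using that K by (intro emeasure_mono) (auto simp: haar_measure_def)
    then show ?thesis using that K by (auto simp: haar_measure_def)
  qed
  \<comment> \<open>Right translates need not preserve the measure, but they keep \<open>K\<close>
    compact and \<open>U\<close> open, which already makes \<open>\<Phi> x\<close> finite and
    positive, so that one may divide by it.\<close>
  have \<Phi>: "\<Phi> x \<noteq> \<infinity> \<and> \<Phi> x \<noteq> 0" for x
  proof -
    let ?T = "\<lambda>A. (\<lambda>y. y + - x) ` A"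
    have "indicator K (y + x) = (indicator (?T K) y :: ennreal)" for y
      by (auto simp: indicator_def image_iff add.assoc intro!: bexI[of _ "y + x"])
    moreover have comp: "compact (?T K)"
      by (intro compact_continuous_image continuous_intros K)
    ultimately have eq: "\<Phi> x = emeasure \<eta> (?T K)"
      using s by (simp add: \<Phi>_def f_def borel_compact)
    have "?T U = (\<lambda>y. y + x) -` U"
      by (auto simp: image_iff add.assoc intro!: bexI[of _ "_ + x"])
    moreover have "open ((\<lambda>y. y + x) -` U)"
      by (intro open_vimage K continuous_intros)
    ultimately have "open (?T U)" "?T U \<noteq> {}"
      using K(3) by (auto simp del: diff_conv_add_uminus add_uminus_conv_diff)
    then have "emeasure \<eta> (?T U) > 0"
      using \<eta> unfolding haar_measure_def by blast
    moreover have "emeasure \<eta> (?T U) \<le> emeasure \<eta> (?T K)"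
      using K s comp by (intro emeasure_mono image_mono) (auto simp: borel_compact)
    ultimately show ?thesis
      using \<eta> comp eq by (auto simp: haar_measure_def)
  qed
  define c where "c = emeasure \<nu> K / emeasure \<eta> K"
  have c: "c \<noteq> \<infinity>" "c * emeasure \<eta> K = emeasure \<nu> K"
    using emK[OF \<nu>] emK[OF \<eta>]
    by (auto simp: c_def ennreal_divide_times ennreal_mult_divide_eq ennreal_divide_eq_top_iff less_top)
  have key: "emeasure \<nu> A = c * emeasure \<eta> A" if [measurable]: "A \<in> sets borel" for A
  proof -
    define g where "g x = indicator A (- x) * inverse (\<Phi> (- x))" for x :: 'g
    have g [measurable]: "g \<in> borel_measurable borel" unfolding g_def by measurable
    have "g (- x) * \<Phi> x = indicator A x" for x
      using ennreal_divide_self[of "\<Phi> x"] \<Phi>[of x]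
      by (simp add: g_def mult.assoc mult.commute[of "inverse _"] divide_ennreal_def less_top split: split_indicator)
    then have 1: "emeasure M A = (\<integral>\<^sup>+x. g (- x) * \<Phi> x \<partial>M)" if "sets M = sets borel" for M
      by (simp add: that)
    have "emeasure \<nu> A = emeasure \<nu> K * (\<integral>\<^sup>+y. g y \<partial>\<eta>)"
      using haar_measure_product[OF \<nu> \<eta> sf f g] 1[OF s(1)] by (simp add: int_f s \<Phi>_def)
    also have "\<dots> = c * (emeasure \<eta> K * (\<integral>\<^sup>+y. g y \<partial>\<eta>))"
      by (simp flip: c(2) add: mult.assoc)
    also have "emeasure \<eta> K * (\<integral>\<^sup>+y. g y \<partial>\<eta>) = emeasure \<eta> A"
      using haar_measure_product[OF \<eta> \<eta> sf(2) sf(2) f g] 1[OF s(2)] by (simp add: int_f s \<Phi>_def)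
    finally show ?thesis .
  qed
  have "\<nu> = density \<eta> (\<lambda>_. c)"
    by (rule measure_eqI) (auto simp: s key emeasure_density_const)
  then show ?thesis using c(1) by blast
qed

section \<open>Change of variables for densities\<close>

text \<open>Compact sets are closed under intersection, generate the Borel sets and include an
  exhausting sequence of balls. Testing on them reduces the change of variables to integrals of
  continuous functions over compact sets.\<close>

lemma measure_eqI_compact:
  fixes M N :: "'a::euclidean_space measure"
  assumes "sets M = sets borel" "sets N = sets borel"
    and eq: "\<And>K. compact K \<Longrightarrow> emeasure M K = emeasure N K"
    and fin: "\<And>K. compact K \<Longrightarrow> emeasure M K \<noteq> \<infinity>"
  shows "M = N"
proof (rule measure_eqI_generator_eq[where E = "Collect compact" and \<Omega> = UNIV and A = "\<lambda>n. cball 0 (real n)"])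
  show "Int_stable (Collect compact :: 'a set set)" by (auto simp: Int_stable_def)
  have cl: "S \<in> sigma_sets UNIV (Collect compact)" if "closed S" for S :: "'a set"
  proof -
    have "S = (\<Union>n. S \<inter> cball 0 (real n))"
      using real_arch_simple by auto
    moreover have "(\<Union>n. S \<inter> cball 0 (real n)) \<in> sigma_sets UNIV (Collect compact)"
      by (intro sigma_sets_UNION) (use that closed_Int_compact in \<open>auto intro!: sigma_sets.Basic\<close>)
    ultimately show ?thesis by simp
  qed
  have "sets (borel :: 'a measure) = sigma_sets UNIV (Collect closed)"
    by (simp add: borel_eq_closed sets_measure_of)
  also have "\<dots> = sigma_sets UNIV (Collect compact)"
    by (intro equalityI sigma_sets_mono) (auto simp: cl intro!: sigma_sets.Basic[of _ "Collect closed"] compact_imp_closed)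
  finally show "sets M = sigma_sets UNIV (Collect compact)" "sets N = sigma_sets UNIV (Collect compact)"
    using assms by auto
  show "(\<Union>i. cball 0 (real i)) = (UNIV :: 'a set)"
    using real_arch_simple by auto
qed (use eq fin in auto)

lemma emeasure_density_lborel_compact:
  fixes w :: "'a::euclidean_space \<Rightarrow> real"
  assumes w: "continuous_on UNIV w" "\<And>x. w x \<ge> 0" and K: "compact K"
  shows "emeasure (density lborel (\<lambda>x. ennreal (w x))) K = ennreal (integral K w)"
proof -
  have [measurable]: "w \<in> borel_measurable borel" "K \<in> sets borel"
    using w K by (auto intro: borel_measurable_continuous_onI borel_compact)
  have int: "integrable lborel (\<lambda>x. indicator K x *\<^sub>R w x)"
    using borel_integrable_compact[OF K continuous_on_subset[OF w(1)]] by simp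
  have "emeasure (density lborel (\<lambda>x. ennreal (w x))) K = (\<integral>\<^sup>+x. ennreal (indicator K x *\<^sub>R w x) \<partial>lborel)"
    by (subst emeasure_density) (auto intro!: nn_integral_cong split: split_indicator)
  also have "\<dots> = ennreal (LINT x:K|lborel. w x)"
    unfolding set_lebesgue_integral_def
    by (rule nn_integral_eq_integral[OF int]) (use w in auto)
  also have "(LINT x:K|lborel. w x) = integral K w"
    using int by (intro set_borel_integral_eq_integral) (simp add: set_integrable_def)
  finally show ?thesis .
qed

lemma absolutely_integrable_continuous_compact:
  fixes w :: "'a::euclidean_space \<Rightarrow> 'b::euclidean_space"
  assumes w: "continuous_on UNIV w" and K: "compact K"
  shows "w absolutely_integrable_on K"
proof -
  have "integrable lborel (\<lambda>x. indicator K x *\<^sub>R w x)"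
    using borel_integrable_compact[OF K continuous_on_subset[OF w(1)]] by simp
  then have "integrable lebesgue (\<lambda>x. indicator K x *\<^sub>R w x)"
    by (subst integrable_completion) (auto dest: borel_measurable_integrable)
  then show ?thesis by (simp add: set_integrable_def)
qed

text \<open>As \<open>g\<close> inverts \<open>h\<close>, the preimage of a compact \<open>K\<close>
  under \<open>h\<close> is the image of \<open>K\<close> under \<open>g\<close>, to which the
  Jacobian formula applies; by \<open>eq\<close> the transformed integrand is
  \<open>\<kappa>\<close> times the old one.\<close>

lemma distr_density_change_of_variables:
  fixes g h :: "real^'n::{finite,wellorder} \<Rightarrow> real^'n::_"
  assumes g: "\<And>p. (g has_derivative g' p) (at p)"
    and hg: "\<And>p. h (g p) = p" and gh: "\<And>p. g (h p) = p" and h: "continuous_on UNIV h"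
    and w: "continuous_on UNIV w" "\<And>p. w p > (0::real)"
    and eq: "\<And>p. \<bar>det (matrix (g' p))\<bar> * w (g p) = \<kappa> * w p" and \<kappa>: "\<kappa> \<ge> 0"
  shows "distr (density lborel (\<lambda>p. ennreal (w p))) borel h =
         density (density lborel (\<lambda>p. ennreal (w p))) (\<lambda>_. ennreal \<kappa>)"
proof (rule measure_eqI_compact)
  let ?D = "density lborel (\<lambda>p. ennreal (w p))"
  have w0: "w p \<ge> 0" for p using w(2) less_imp_le by blast
  have g_cont: "continuous_on UNIV g"
    by (intro continuous_at_imp_continuous_on ballI has_derivative_continuous[OF g])
  have hm: "h \<in> measurable ?D borel"
    using borel_measurable_continuous_onI[OF h] by simp
  fix K :: "(real^'n::_) set" assume K: "compact K"
  have "h -` K \<inter> space ?D = g ` K"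
    using hg gh by (auto simp: image_iff) (metis gh)
  then have 1: "emeasure (distr ?D borel h) K = emeasure ?D (g ` K)"
    using hm K by (simp add: emeasure_distr borel_compact)
  have gK: "compact (g ` K)"
    using K g_cont by (auto intro: compact_continuous_image continuous_on_subset)
  \<comment> \<open>The change of variables theorem speaks of integrands with values in a Cartesian
    power of the reals, so the scalar density rides on the unit vector of
    \<open>real^1\<close>.\<close>
  define b :: "real^1" where "b = axis 1 1"
  have bb: "x *\<^sub>R b = y *\<^sub>R b \<longleftrightarrow> x = y" for x y by (simp add: b_def)
  have int: "integral S (\<lambda>p. v p *\<^sub>R b) = integral S v *\<^sub>R b" if "compact S" "continuous_on UNIV v"
    for S :: "(real^'n::_) set" and v :: "real^'n::_ \<Rightarrow> real"
    using has_integral_scaleR_left integrable_integral set_lebesgue_integral_eq_integral(1)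
      absolutely_integrable_continuous_compact[OF that(2,1)] integral_unique by blast
  have "(\<lambda>p. w p *\<^sub>R b) absolutely_integrable_on g ` K \<and>
        integral (g ` K) (\<lambda>p. w p *\<^sub>R b) = integral (g ` K) w *\<^sub>R b"
    using w gK by (auto intro!: absolutely_integrable_continuous_compact continuous_intros int)
  then have "integral K (\<lambda>p. \<bar>det (matrix (g' p))\<bar> *\<^sub>R w (g p) *\<^sub>R b) = integral (g ` K) w *\<^sub>R b"
    using has_absolute_integral_change_of_variables[of K g g' "\<lambda>p. w p *\<^sub>R b"]
      has_derivative_at_withinI[OF g] inj_on_inverseI[of K h g] hg fmeasurableD[OF lmeasurable_compact[OF K]]
    by blast
  then have "integral K (\<lambda>p. (\<kappa> * w p) *\<^sub>R b) = integral (g ` K) w *\<^sub>R b"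
    by (simp add: eq)
  then have "integral (g ` K) w = \<kappa> * integral K w"
    using int[OF K, of "\<lambda>p. \<kappa> * w p"] w(1) bb by (simp add: continuous_on_mult_left)
  then have "emeasure ?D (g ` K) = ennreal \<kappa> * emeasure ?D K"
    using w(1) w0 K gK \<kappa> by (simp add: emeasure_density_lborel_compact ennreal_mult')
  then show "emeasure (distr ?D borel h) K = emeasure (density ?D (\<lambda>_. ennreal \<kappa>)) K"
    using 1 K by (simp add: emeasure_density_const borel_compact)
  show "emeasure (distr ?D borel h) K \<noteq> \<infinity>"
    using 1 w(1) w0 gK by (simp add: emeasure_density_lborel_compact)
qed auto

section \<open>Left-invariant fields in exponential coordinates\<close>

text \<open>Gronwall argument: with \<open>K\<close> a bound for \<open>L\<close>, the function
  \<open>exp (- 2 K t) |U t|^2\<close> is nonincreasing, and it starts at 0.\<close>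

lemma linear_ode_zero:
  fixes U :: "real \<Rightarrow> 'a::euclidean_space"
  assumes L: "bounded_linear L" and U: "\<And>t. (U has_vector_derivative L (U t)) (at t)"
    and "U 0 = 0" "t \<ge> 0"
  shows "U t = 0"
proof -
  obtain K where K: "\<And>x. norm (L x) \<le> norm x * K"
    using bounded_linear.bounded[OF L] by blast
  let ?g = "\<lambda>t. exp (- 2 * K * t) * (U t \<bullet> U t)"
  have "?g t \<le> ?g 0"
  proof (rule DERIV_nonpos_imp_nonincreasing[OF \<open>t \<ge> 0\<close>])
    fix x
    have d: "((\<lambda>t. U t \<bullet> U t) has_real_derivative 2 * (U x \<bullet> L (U x))) (at x)"
      using bounded_bilinear.has_vector_derivative[OF bounded_bilinear_inner U U, of x]
      by (simp add: has_real_derivative_iff_has_vector_derivative inner_commute)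
    have "(?g has_real_derivative exp (- 2 * K * x) * (2 * (U x \<bullet> L (U x)) - 2 * K * (U x \<bullet> U x))) (at x)"
      by (rule derivative_eq_intros d refl | simp add: algebra_simps)+
    moreover have "U x \<bullet> L (U x) \<le> K * (U x \<bullet> U x)"
    proof -
      have "U x \<bullet> L (U x) \<le> norm (U x) * norm (L (U x))" by (rule norm_cauchy_schwarz)
      also have "\<dots> \<le> norm (U x) * (norm (U x) * K)"
        by (intro mult_left_mono K) simp
      finally show ?thesis by (simp add: dot_square_norm power2_eq_square mult_ac)
    qed
    ultimately show "\<exists>y. (?g has_real_derivative y) (at x) \<and> y \<le> 0"
      by (intro exI conjI) (auto simp: mult_le_0_iff)
  qed
  then have "U t \<bullet> U t \<le> 0" using \<open>U 0 = 0\<close> by (simp add: mult_le_0_iff)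
  then show ?thesis using inner_ge_zero[of "U t"] by (metis antisym inner_eq_zero_iff)
qed

lemma norm_linear_le_Basis:
  fixes h :: "'a::euclidean_space \<Rightarrow> 'b::real_normed_vector"
  assumes "linear h"
  shows "norm (h x) \<le> norm x * (\<Sum>b\<in>Basis. norm (h b))"
proof -
  have "norm (h x) \<le> (\<Sum>b\<in>Basis. norm ((x \<bullet> b) *\<^sub>R h b))"
    by (subst linear_euclidean_sum[OF assms]) (rule norm_sum)
  also have "\<dots> \<le> (\<Sum>b\<in>Basis. norm x * norm (h b))"
    by (intro sum_mono) (simp add: Basis_le_norm mult_right_mono)
  finally show ?thesis by (simp add: sum_distrib_left)
qed

text \<open>\<open>b\<close> is not assumed bounded. Pointwise convergence on a finite basis is
  convergence in norm, so \<open>P\<close> composed with \<open>M s\<close> is close to the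
  identity; once the error is below 1/2, the norm of \<open>b s\<close> is absorbed into twice that
  of \<open>P (M s (b s))\<close>.\<close>

lemma tendsto_inverse_linear:
  fixes M :: "'s \<Rightarrow> 'a::euclidean_space \<Rightarrow> 'a" and M0 P :: "'a \<Rightarrow> 'a"
  assumes lin: "\<And>s. linear (M s)" "linear M0" "linear P" and PM: "\<And>x. P (M0 x) = x"
    and M: "\<And>x. ((\<lambda>s. M s x) \<longlongrightarrow> M0 x) F"
    and Mb: "((\<lambda>s. M s (b s)) \<longlongrightarrow> r) F"
  shows "(b \<longlongrightarrow> P r) F"
proof -
  obtain C where C: "C > 0" "\<And>x. norm (P x) \<le> norm x * C"
    using bounded_linear.pos_bounded lin(3) linear_conv_bounded_linear by blast
  define \<epsilon> where "\<epsilon> s = (\<Sum>e\<in>Basis. norm (M0 e - M s e))" for s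
  have \<epsilon>0: "\<epsilon> s \<ge> 0" for s by (simp add: \<epsilon>_def sum_nonneg)
  have "(\<epsilon> \<longlongrightarrow> (\<Sum>e\<in>Basis. norm (M0 e - M0 e))) F"
    unfolding \<epsilon>_def by (intro tendsto_intros M)
  then have \<epsilon>: "(\<epsilon> \<longlongrightarrow> 0) F" by simp
  have est: "norm (b s - P (M s (b s))) \<le> C * \<epsilon> s * norm (b s)" for s
  proof -
    have "b s - P (M s (b s)) = P (M0 (b s) - M s (b s))"
      using lin(3) PM by (simp add: linear_diff)
    moreover have "norm (M0 (b s) - M s (b s)) \<le> norm (b s) * \<epsilon> s"
      unfolding \<epsilon>_def by (rule norm_linear_le_Basis) (intro linear_compose_sub lin)
    ultimately show ?thesis
      using C(2)[of "M0 (b s) - M s (b s)"] C(1)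
      by (smt (verit) mult.assoc mult.commute mult_left_mono)
  qed
  have ev: "\<forall>\<^sub>F s in F. norm (b s - P (M s (b s))) \<le> C * \<epsilon> s * (2 * norm (P (M s (b s))))"
  proof -
    have "((\<lambda>s. C * \<epsilon> s) \<longlongrightarrow> C * 0) F" by (intro tendsto_intros \<epsilon>)
    then have "\<forall>\<^sub>F s in F. C * \<epsilon> s < 1/2" by (intro order_tendstoD) auto
    then show ?thesis
    proof eventually_elim
      case (elim s)
      have "C * \<epsilon> s * norm (b s) \<le> 1/2 * norm (b s)"
        using elim by (intro mult_right_mono) auto
      moreover have "norm (b s) \<le> norm (b s - P (M s (b s))) + norm (P (M s (b s)))"
        using norm_triangle_sub[of "b s" "P (M s (b s))"] by linarith
      ultimately have "norm (b s) \<le> 2 * norm (P (M s (b s)))"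
        using est[of s] by linarith
      then have "C * \<epsilon> s * norm (b s) \<le> C * \<epsilon> s * (2 * norm (P (M s (b s))))"
        using C(1) \<epsilon>0[of s] by (intro mult_left_mono) auto
      then show ?case using est[of s] by linarith
    qed
  qed
  have PM': "((\<lambda>s. P (M s (b s))) \<longlongrightarrow> P r) F"
    using bounded_linear.tendsto[OF _ Mb] lin(3) linear_conv_bounded_linear by blast
  have "((\<lambda>s. C * \<epsilon> s * (2 * norm (P (M s (b s))))) \<longlongrightarrow> C * 0 * (2 * norm (P r))) F"
    by (intro tendsto_intros \<epsilon> PM')
  then have "((\<lambda>s. b s - P (M s (b s))) \<longlongrightarrow> 0) F"
    using ev by (intro Lim_null_comparison[OF ev]) simp
  from tendsto_add[OF this PM'] show ?thesis by simp
qed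

lemma has_vector_derivative_iff_slope:
  "(f has_vector_derivative D) (at t) \<longleftrightarrow> ((\<lambda>s. (f s - f t) /\<^sub>R (s - t)) \<longlongrightarrow> D) (at t)"
proof -
  have "norm (f s - f t - (s - t) *\<^sub>R D) / norm (s - t) = norm ((f s - f t) /\<^sub>R (s - t) - D)" if "s \<noteq> t" for s
  proof -
    have "(f s - f t) /\<^sub>R (s - t) - D = (f s - f t - (s - t) *\<^sub>R D) /\<^sub>R (s - t)"
      using that by (simp add: scaleR_right_diff_distrib)
    then show ?thesis by (simp add: divide_inverse)
  qed
  then have "((\<lambda>s. norm (f s - f t - (s - t) *\<^sub>R D) / norm (s - t)) \<longlongrightarrow> 0) (at t) \<longleftrightarrow>
      ((\<lambda>s. norm ((f s - f t) /\<^sub>R (s - t) - D)) \<longlongrightarrow> 0) (at t)"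
    by (intro filterlim_cong refl) (auto simp: eventually_at_filter)
  then show ?thesis
    unfolding has_vector_derivative_def has_derivative_iff_norm
    by (simp add: bounded_linear_scaleR_left tendsto_norm_zero_iff Lim_null[symmetric])
qed

lemma has_vector_derivative_inverse_linear:
  fixes M :: "real \<Rightarrow> 'a::euclidean_space \<Rightarrow> 'a"
  assumes lin: "\<And>s. linear (M s)" and inj: "\<And>s. inj (M s)"
    and M': "\<And>x. ((\<lambda>s. M s x) has_vector_derivative M' x) (at t)"
  shows "((\<lambda>s. inv (M s) x) has_vector_derivative - inv (M t) (M' (inv (M t) x))) (at t)"
proof -
  have surj: "surj (M s)" for s using linear_inj_imp_surj[OF lin inj] .
  define a where "a s = inv (M s) x" for s
  have Ma: "M s (a s) = x" for s by (simp add: a_def surj surj_f_inv_f)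
  define b where "b s = (a s - a t) /\<^sub>R (s - t)" for s
  have slope: "((\<lambda>s. (M s y - M t y) /\<^sub>R (s - t)) \<longlongrightarrow> M' y) (at t)" for y
    using M' by (simp add: has_vector_derivative_iff_slope)
  \<comment> \<open>Since \<open>M s (a s)\<close> and \<open>M t (a t)\<close> both equal
    \<open>x\<close>, the difference quotient of the inverse, pushed through \<open>M s\<close>,
    becomes that of \<open>M\<close> at the fixed vector \<open>a t\<close>.\<close>
  have "M s (b s) = - ((M s (a t) - M t (a t)) /\<^sub>R (s - t))" for s
    by (simp add: b_def linear_scale[OF lin] linear_diff[OF lin] Ma flip: scaleR_minus_right)
  then have "((\<lambda>s. M s (b s)) \<longlongrightarrow> - M' (a t)) (at t)"
    using tendsto_minus[OF slope[of "a t"]] by simp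
  moreover have "((\<lambda>s. M s y) \<longlongrightarrow> M t y) (at t)" for y
    using has_vector_derivative_continuous[OF M'] isCont_def by blast
  moreover have "linear (inv (M t))"
    using lin inj linear_injective_left_inverse surj by (metis inj_linear_imp_inv_linear)
  ultimately have "(b \<longlongrightarrow> inv (M t) (- M' (a t))) (at t)"
    using tendsto_inverse_linear[of M "M t" "inv (M t)" "at t" b "- M' (a t)"] lin inj
    by (simp add: inv_f_f)
  then show ?thesis
    using lin inj
    by (simp add: has_vector_derivative_iff_slope b_def[abs_def] a_def linear_neg[OF inj_linear_imp_inv_linear])
qed

section \<open>The exponential map as a global chart\<close>

context homogeneous_group
begin

abbreviation logG :: "'g \<Rightarrow> 'a" where "logG \<equiv> inv expG"

lemma bij_expG: "bij expG" and continuous_expG: "continuous_on UNIV expG"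
  and smooth_chart_expG: "(U, \<phi>) \<in> charts \<Longrightarrow> smooth_on (expG -` U) (\<lambda>X. \<phi> (expG X))"
  and smooth_fun_logG: "smooth_fun charts logG"
  using exp_diffeomorphism by (auto simp: global_diffeomorphism_def)

lemma expG_logG [simp]: "expG (logG x) = x" and logG_expG [simp]: "logG (expG X) = X"
  using bij_expG by (auto simp: bij_is_surj surj_f_inv_f bij_is_inj inv_f_f)

lemma chart_at: obtains U \<phi> where "(U, \<phi>) \<in> charts" "x \<in> U" "open U" "open (\<phi> ` U)"
    "\<And>y. y \<in> U \<Longrightarrow> inv_into U \<phi> (\<phi> y) = y" "continuous_on U \<phi>"
proof -
  have at: "smooth_atlas charts" using lie_group by (simp add: lie_group_def)
  then have "x \<in> (\<Union>(U, \<phi>)\<in>charts. U)" by (simp add: smooth_atlas_def)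
  then obtain U \<phi> where c: "(U, \<phi>) \<in> charts" "x \<in> U" by auto
  with at have "open U" "open (\<phi> ` U)" "homeomorphism U (\<phi> ` U) \<phi> (inv_into U \<phi>)"
    by (auto simp: smooth_atlas_def)
  with c that show ?thesis by (auto simp: homeomorphism_def)
qed

text \<open>A global diffeomorphism replaces the atlas by one coordinate system; from here on
  smoothness on the group is smoothness of a function on a vector space.\<close>

lemma smooth_fun_iff:
  fixes f :: "'g \<Rightarrow> 'b::real_normed_vector"
  shows "smooth_fun charts f \<longleftrightarrow> smooth_on UNIV (\<lambda>X. f (expG X))"
proof
  assume f: "smooth_fun charts f"
  show "smooth_on UNIV (\<lambda>X. f (expG X))"
  proof (rule smooth_on_local)
    fix X :: 'a
    obtain U \<phi> where c: "(U, \<phi>) \<in> charts" "expG X \<in> U" "open U" "open (\<phi> ` U)"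
      "\<And>y. y \<in> U \<Longrightarrow> inv_into U \<phi> (\<phi> y) = y" "continuous_on U \<phi>"
      using chart_at[of "expG X"] by blast
    have o: "open (expG -` U)" using open_vimage[OF c(3)] continuous_expG by blast
    have "smooth_on (expG -` U) (\<lambda>Y. f (inv_into U \<phi> (\<phi> (expG Y))))"
      by (rule smooth_on_compose[OF o c(4) _ smooth_chart_expG[OF c(1)]])
        (use f c(1) in \<open>auto simp: smooth_fun_def\<close>)
    then have "smooth_on (expG -` U) (\<lambda>Y. f (expG Y))"
      by (rule smooth_on_cong[rotated 2]) (use o c(5) in auto)
    then show "\<exists>V. open V \<and> X \<in> V \<and> smooth_on V (\<lambda>X. f (expG X))"
      using o c(2) by blast
  qed
next
  assume f: "smooth_on UNIV (\<lambda>X. f (expG X))"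
  show "smooth_fun charts f"
    unfolding smooth_fun_def
  proof clarify
    fix U \<phi> assume c: "(U, \<phi>) \<in> charts"
    then have o: "open (\<phi> ` U)" using lie_group by (auto simp: lie_group_def smooth_atlas_def)
    have "smooth_on (\<phi> ` U) (\<lambda>a. f (expG (logG (inv_into U \<phi> a))))"
      by (rule smooth_on_compose[OF o open_UNIV f])
        (use smooth_fun_logG c in \<open>auto simp: smooth_fun_def\<close>)
    then show "smooth_on (\<phi> ` U) (\<lambda>a. f (inv_into U \<phi> a))" by simp
  qed
qed

lemma continuous_logG: "continuous_on UNIV logG"
proof (rule continuous_at_imp_continuous_on, clarify)
  fix x
  obtain U \<phi> where c: "(U, \<phi>) \<in> charts" "x \<in> U" "open U" "open (\<phi> ` U)"
    "\<And>y. y \<in> U \<Longrightarrow> inv_into U \<phi> (\<phi> y) = y" "continuous_on U \<phi>"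
    using chart_at[of x] by blast
  have "continuous_on (\<phi> ` U) (\<lambda>a. logG (inv_into U \<phi> a))"
    by (rule smooth_on_imp_continuous_on) (use smooth_fun_logG c(1) in \<open>auto simp: smooth_fun_def\<close>)
  then have "continuous_on U (\<lambda>y. logG (inv_into U \<phi> (\<phi> y)))"
    by (rule continuous_on_compose2[OF _ c(6)]) auto
  then have "continuous_on U logG"
    by (rule continuous_on_eq) (simp add: c(5))
  then show "isCont logG x" using c(2,3) by (simp add: continuous_on_eq_continuous_at)
qed

text \<open>Multiplication is smooth in charts around \<open>q\<close>, \<open>expG X\<close> and
  \<open>q + expG X\<close>; freezing the first argument and passing through these three charts
  gives the derivative. First order is enough, because only the Jacobian of a left translation is
  used.\<close>

lemma left_translation_differentiable: "(\<lambda>X. logG (q + expG X)) differentiable (at X)"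
proof -
  obtain U \<phi> where U: "(U, \<phi>) \<in> charts" "q \<in> U" "open U" "open (\<phi> ` U)"
    "\<And>y. y \<in> U \<Longrightarrow> inv_into U \<phi> (\<phi> y) = y" "continuous_on U \<phi>"
    using chart_at[of q] by blast
  obtain V \<psi> where V: "(V, \<psi>) \<in> charts" "expG X \<in> V" "open V" "open (\<psi> ` V)"
    "\<And>y. y \<in> V \<Longrightarrow> inv_into V \<psi> (\<psi> y) = y" "continuous_on V \<psi>"
    using chart_at[of "expG X"] by blast
  obtain W \<zeta> where W: "(W, \<zeta>) \<in> charts" "q + expG X \<in> W" "open W" "open (\<zeta> ` W)"
    "\<And>y. y \<in> W \<Longrightarrow> inv_into W \<zeta> (\<zeta> y) = y" "continuous_on W \<zeta>"
    using chart_at[of "q + expG X"] by blast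
  let ?F = "\<lambda>(a, b). \<zeta> (inv_into U \<phi> a + inv_into V \<psi> b)"
  have "smooth_on {(a, b). a \<in> \<phi> ` U \<and> b \<in> \<psi> ` V \<and> inv_into U \<phi> a + inv_into V \<psi> b \<in> W} ?F"
    using lie_group U(1) V(1) W(1) unfolding lie_group_def by blast
  then have F: "?F differentiable (at (\<phi> q, \<psi> (expG X)))"
    by (rule smooth_on_differentiable) (use U V W in auto)
  have p: "(\<lambda>Y. (\<phi> q, \<psi> (expG Y))) differentiable (at X)"
    unfolding differentiable_def
    using has_derivative_Pair[OF has_derivative_const
        smooth_on_has_derivative[OF smooth_chart_expG[OF V(1)], of X]] V(2) by auto
  have l: "(\<lambda>a. logG (inv_into W \<zeta> a)) differentiable (at (?F (\<phi> q, \<psi> (expG X))))"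
    by (rule smooth_on_differentiable[of "\<zeta> ` W"])
      (use smooth_fun_logG W U V in \<open>auto simp: smooth_fun_def\<close>)
  have l': "(\<lambda>a. logG (inv_into W \<zeta> a)) differentiable (at ((?F \<circ> (\<lambda>Y. (\<phi> q, \<psi> (expG Y)))) X))"
    using l by simp
  have "(\<lambda>Y. logG (inv_into W \<zeta> (?F (\<phi> q, \<psi> (expG Y))))) differentiable (at X)"
    using differentiable_chain_at[OF differentiable_chain_at[OF p F] l']
    by (simp add: o_def)
  then obtain D where D: "((\<lambda>Y. logG (inv_into W \<zeta> (?F (\<phi> q, \<psi> (expG Y))))) has_derivative D) (at X)"
    by (auto simp: differentiable_def)
  let ?O = "expG -` V \<inter> (\<lambda>Y. q + expG Y) -` W"
  have "open ?O"
    by (intro open_Int open_vimage V W continuous_intros continuous_expG)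
  with D have "((\<lambda>Y. logG (q + expG Y)) has_derivative D) (at X)"
    by (rule has_derivative_transform_within_open) (use U V W in auto)
  then show ?thesis by (auto simp: differentiable_def)
qed

lemma smooth_fun_coord: "smooth_fun charts (\<lambda>x. logG x \<bullet> b)"
  by (simp add: smooth_fun_iff smooth_on_linear bounded_linear_inner_left)

section \<open>Vector fields as derivations and their bracket\<close>

lemma vf_mem: "vf X \<in> left_invariant_fields charts"
  using lie_algebra by (auto simp: lie_algebra_iso_def bij_betw_def)

lemma inj_vf: "inj vf"
  using lie_algebra by (auto simp: lie_algebra_iso_def bij_betw_def)

lemma vf_linear: "vf (a *\<^sub>R X + b *\<^sub>R Y) f x = a * vf X f x + b * vf Y f x"
  using lie_algebra by (simp add: lie_algebra_iso_def)

lemma vf_smooth: "smooth_fun charts f \<Longrightarrow> smooth_fun charts (vf X f)"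
  and vf_nonsmooth: "\<not> smooth_fun charts f \<Longrightarrow> vf X f = (\<lambda>x. 0)"
  and vf_lincomb: "smooth_fun charts f \<Longrightarrow> smooth_fun charts g \<Longrightarrow>
      vf X (\<lambda>x. a * f x + b * g x) = (\<lambda>x. a * vf X f x + b * vf X g x)"
  and vf_product: "smooth_fun charts f \<Longrightarrow> smooth_fun charts g \<Longrightarrow>
      vf X (\<lambda>x. f x * g x) = (\<lambda>x. vf X f x * g x + f x * vf X g x)"
  and vf_left_invariant: "smooth_fun charts f \<Longrightarrow> vf X (\<lambda>x. f (y + x)) = (\<lambda>x. vf X f (y + x))"
  using vf_mem[of X] by (simp_all add: left_invariant_fields_def)

text \<open>\<open>lie_bracket\<close> inverts \<open>vf\<close>, which is informative only once the
  commutator is known to be a left-invariant field in the normalised sense, including the value zero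
  on functions that are not smooth.\<close>

lemma vf_lie_bracket:
  "vf (lie_bracket vf X Y) = (\<lambda>f x. vf X (vf Y f) x - vf Y (vf X f) x)" (is "_ = ?Z")
proof -
  have z: "vf X (\<lambda>x. 0) = (\<lambda>x. 0)" for X
    using vf_lincomb[OF smooth_fun_coord smooth_fun_coord, of X 0 _ 0] by simp
  have add: "vf X (\<lambda>x. f x + g x) = (\<lambda>x. vf X f x + vf X g x)"
    if "smooth_fun charts f" "smooth_fun charts g" for X f g
    using vf_lincomb[OF that, of X 1 1] by simp
  have prod: "smooth_fun charts (\<lambda>x. f x * g x)"
    if "smooth_fun charts f" "smooth_fun charts g" for f g :: "'g \<Rightarrow> real"
    using that by (simp add: smooth_fun_iff smooth_on_mult)
  have "?Z \<in> left_invariant_fields charts"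
    unfolding left_invariant_fields_def mem_Collect_eq
  proof (intro conjI allI impI)
    show "smooth_fun charts (?Z f)" if "smooth_fun charts f" for f
      using that vf_smooth[OF vf_smooth[OF that]] by (simp add: smooth_fun_iff smooth_on_diff)
    show "?Z f = (\<lambda>x. 0)" if "\<not> smooth_fun charts f" for f
      using that by (simp add: vf_nonsmooth z)
    show "?Z (\<lambda>x. a * f x + b * g x) = (\<lambda>x. a * ?Z f x + b * ?Z g x)"
      if "smooth_fun charts f" "smooth_fun charts g" for f g a b
      using that by (simp add: vf_lincomb vf_smooth algebra_simps)
    show "?Z (\<lambda>x. f x * g x) = (\<lambda>x. ?Z f x * g x + f x * ?Z g x)"
      if "smooth_fun charts f" "smooth_fun charts g" for f g
      using that by (simp add: vf_product vf_smooth add prod algebra_simps)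
    show "?Z (\<lambda>x. f (y + x)) = (\<lambda>x. ?Z f (y + x))" if "smooth_fun charts f" for f y
      using that by (simp add: vf_left_invariant vf_smooth)
  qed
  then have "?Z \<in> range vf"
    using lie_algebra by (simp add: lie_algebra_iso_def bij_betw_def)
  then show ?thesis by (simp add: lie_bracket_def f_inv_into_f)
qed

section \<open>One-parameter subgroups and the frame of left-invariant fields\<close>

lemma expG_0 [simp]: "expG 0 = 0"
proof -
  have "expG ((0 + 0) *\<^sub>R 0) = expG (0 *\<^sub>R 0) + expG (0 *\<^sub>R 0)"
    using exponential unfolding is_exponential_map_def by blast
  then show ?thesis by (metis add.right_neutral add_left_cancel scaleR_zero_left)
qed

lemma expG_add_scale: "expG (s *\<^sub>R X) + expG (t *\<^sub>R X) = expG ((s + t) *\<^sub>R X)"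
  using exponential by (simp add: is_exponential_map_def)

lemma vf_derivative:
  "smooth_fun charts f \<Longrightarrow> ((\<lambda>t. f (x + expG (t *\<^sub>R X))) has_real_derivative vf X f x) (at 0)"
  using exponential by (simp add: is_exponential_map_def)

text \<open>This is \<open>M(p)\<close> of the overview: the components of a field in exponential
  coordinates are its values on the coordinate functions.\<close>

definition frame :: "'a \<Rightarrow> 'a \<Rightarrow> 'a" where
  "frame p X = (\<Sum>b\<in>Basis. vf X (\<lambda>x. logG x \<bullet> b) (expG p) *\<^sub>R b)"

lemma frame_inner: "b \<in> Basis \<Longrightarrow> frame p X \<bullet> b = vf X (\<lambda>x. logG x \<bullet> b) (expG p)"
  by (simp add: frame_def inner_sum_left inner_Basis if_distrib cong: if_cong)

lemma linear_frame: "linear (frame p)"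
proof (rule linearI)
  show "frame p (X + Y) = frame p X + frame p Y" for X Y
    using vf_linear[of 1 X 1 Y] by (simp add: frame_def scaleR_left_distrib sum.distrib)
  show "frame p (a *\<^sub>R X) = a *\<^sub>R frame p X" for a X
    using vf_linear[of a X 0 X] by (simp add: frame_def scaleR_sum_right)
qed

lemma smooth_on_frame: "smooth_on UNIV (\<lambda>p. frame p X)"
  unfolding frame_def
  by (intro smooth_on_sum smooth_on_bounded_linear[OF bounded_linear_scaleR_left])
    (use vf_smooth[OF smooth_fun_coord] in \<open>auto simp: smooth_fun_iff\<close>)

lemma frame_derivative:
  "((\<lambda>t. logG (expG p + expG (t *\<^sub>R X))) has_vector_derivative frame p X) (at 0)"
proof -
  let ?c = "\<lambda>t. logG (expG p + expG (t *\<^sub>R X))"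
  have "((\<lambda>t. \<Sum>b\<in>Basis. (?c t \<bullet> b) *\<^sub>R b) has_vector_derivative frame p X) (at 0)"
    unfolding frame_def
  proof (rule has_vector_derivative_sum)
    fix b :: 'a
    have "((\<lambda>t. ?c t \<bullet> b) has_real_derivative vf X (\<lambda>x. logG x \<bullet> b) (expG p)) (at 0)"
      using vf_derivative[OF smooth_fun_coord] .
    then show "((\<lambda>t. (?c t \<bullet> b) *\<^sub>R b) has_vector_derivative vf X (\<lambda>x. logG x \<bullet> b) (expG p) *\<^sub>R b) (at 0)"
      using has_vector_derivative_scaleR[OF _ has_vector_derivative_const, of "\<lambda>t. ?c t \<bullet> b" _ 0 UNIV b] by simp
  qed
  then show ?thesis by (simp add: euclidean_representation)
qed

text \<open>The flow \<open>x + expG (t X)\<close> represents \<open>vf X\<close> as a derivative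
  along a curve; the velocity of this curve in coordinates is \<open>frame p X\<close>, so the
  derivation becomes a directional derivative.\<close>

lemma vf_eq_frechet:
  assumes "smooth_fun charts f"
  shows "vf X f (expG p) = frechet_derivative (\<lambda>q. f (expG q)) (at p) (frame p X)"
proof -
  let ?c = "\<lambda>t. logG (expG p + expG (t *\<^sub>R X))" and ?D = "frechet_derivative (\<lambda>q. f (expG q)) (at p)"
  have D: "((\<lambda>q. f (expG q)) has_derivative ?D) (at (?c 0))"
    using assms smooth_on_has_derivative[of UNIV "\<lambda>q. f (expG q)" p] by (simp add: smooth_fun_iff)
  have "((\<lambda>t. f (expG (?c t))) has_derivative (\<lambda>t. ?D (t *\<^sub>R frame p X))) (at 0)"
    using has_derivative_compose[OF frame_derivative[unfolded has_vector_derivative_def] D] .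
  moreover have "?D (t *\<^sub>R frame p X) = t * ?D (frame p X)" for t
    using D has_derivative_linear linear_scale by fastforce
  ultimately have "((\<lambda>t. f (expG p + expG (t *\<^sub>R X))) has_real_derivative ?D (frame p X)) (at 0)"
    by (simp add: has_field_derivative_def mult.commute[of _ "?D (frame p X)"] has_derivative_eq_rhs)
  then show ?thesis using vf_derivative[OF assms] DERIV_unique by blast
qed

text \<open>A left-invariant field that vanishes at one point vanishes everywhere, because
  translation by \<open>x - expG p\<close> carries \<open>expG p\<close> to \<open>x\<close>.
  Injectivity of \<open>vf\<close> then gives \<open>X = 0\<close>.\<close>

lemma inj_frame: "inj (frame p)"
proof (rule linear_injective_0[OF linear_frame, THEN iffD2], intro allI impI)
  fix X assume X: "frame p X = 0"
  have 0: "vf X f (expG p) = 0" for f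
  proof (cases "smooth_fun charts f")
    case True
    then show ?thesis
      using vf_eq_frechet[OF True, of X p] X smooth_on_has_derivative[of UNIV "\<lambda>q. f (expG q)" p]
        has_derivative_linear linear_0 by (fastforce simp: smooth_fun_iff)
  qed (simp add: vf_nonsmooth)
  have "vf X f x = 0" for f x
  proof (cases "smooth_fun charts f")
    case True
    have "vf X f x = vf X (\<lambda>y. f ((x - expG p) + y)) (expG p)"
      using vf_left_invariant[OF True, of X "x - expG p"] by simp
    then show ?thesis by (simp add: 0)
  qed (simp add: vf_nonsmooth)
  moreover have "vf 0 f x = 0" for f x
    using vf_linear[of 0 0 0 0 f x] by simp
  ultimately have "vf X = vf 0" by (intro ext) simp
  then show "X = 0" using inj_vf by (simp add: inj_eq)
qed

definition dframe :: "'a \<Rightarrow> 'a \<Rightarrow> 'a \<Rightarrow> 'a" where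
  "dframe p v X = frechet_derivative (\<lambda>p. frame p X) (at p) v"

lemma frame_has_derivative: "((\<lambda>p. frame p X) has_derivative (\<lambda>v. dframe p v X)) (at p)"
  unfolding dframe_def using smooth_on_has_derivative[OF smooth_on_frame] by simp

text \<open>Tested on a coordinate function, the inner field yields a component of the frame, a
  smooth function which the outer field differentiates in the direction of the frame.\<close>

lemma frame_bracket:
  "frame p (lie_bracket vf X Y) = dframe p (frame p X) Y - dframe p (frame p Y) X"
proof (rule euclidean_eqI)
  fix b :: 'a assume b: "b \<in> Basis"
  have *: "vf X (vf Y (\<lambda>x. logG x \<bullet> b)) (expG p) = dframe p (frame p X) Y \<bullet> b" for X Y
  proof -
    have "((\<lambda>q. frame q Y \<bullet> b) has_derivative (\<lambda>v. dframe p v Y \<bullet> b)) (at p)"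
      by (intro has_derivative_inner_left frame_has_derivative)
    then have "frechet_derivative (\<lambda>q. vf Y (\<lambda>x. logG x \<bullet> b) (expG q)) (at p) = (\<lambda>v. dframe p v Y \<bullet> b)"
      unfolding frame_inner[OF b] by (rule frechet_derivative_at[symmetric])
    then show ?thesis
      using vf_eq_frechet[OF vf_smooth[OF smooth_fun_coord]] by simp
  qed
  show "frame p (lie_bracket vf X Y) \<bullet> b = (dframe p (frame p X) Y - dframe p (frame p Y) X) \<bullet> b"
    using b by (simp add: frame_inner vf_lie_bracket * inner_diff_left)
qed

lemma frame_radial: "frame (t *\<^sub>R X) X = X"
proof -
  have "((\<lambda>s. logG (expG (t *\<^sub>R X) + expG (s *\<^sub>R X))) has_vector_derivative X) (at 0)"
    unfolding expG_add_scale logG_expG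
    by (auto intro!: derivative_eq_intros)
  then show ?thesis using frame_derivative vector_derivative_unique_at by blast
qed

lemma dframe_linear_point: "linear (\<lambda>v. dframe p v X)"
  using frame_has_derivative has_derivative_linear by blast

lemma dframe_linear_arg: "linear (dframe p v)"
proof (rule linearI)
  show "dframe p v (X + Y) = dframe p v X + dframe p v Y" for X Y
  proof -
    have "((\<lambda>p. frame p (X + Y)) has_derivative (\<lambda>v. dframe p v X + dframe p v Y)) (at p)"
      unfolding linear_add[OF linear_frame] by (intro has_derivative_add frame_has_derivative)
    then show ?thesis using has_derivative_unique[OF frame_has_derivative] by metis
  qed
  show "dframe p v (a *\<^sub>R X) = a *\<^sub>R dframe p v X" for a X
  proof -
    have "((\<lambda>p. frame p (a *\<^sub>R X)) has_derivative (\<lambda>v. a *\<^sub>R dframe p v X)) (at p)"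
      unfolding linear_scale[OF linear_frame] by (intro has_derivative_scaleR_right frame_has_derivative)
    then show ?thesis using has_derivative_unique[OF frame_has_derivative] by metis
  qed
qed

text \<open>Derivative of the identity \<open>frame p p = p\<close>, with the point and the field
  argument varying together; the expansion over \<open>Basis\<close> separates the two
  dependences.\<close>

lemma dframe_radial: "dframe p v p + frame p v = v"
proof -
  have "((\<lambda>p. \<Sum>b\<in>Basis. (p \<bullet> b) *\<^sub>R frame p b) has_derivative
      (\<lambda>v. \<Sum>b\<in>Basis. (p \<bullet> b) *\<^sub>R dframe p v b + (v \<bullet> b) *\<^sub>R frame p b)) (at p)"
    by (intro has_derivative_sum has_derivative_scaleR has_derivative_inner_left has_derivative_ident frame_has_derivative)
  then have "((\<lambda>p. frame p p) has_derivative (\<lambda>v. dframe p v p + frame p v)) (at p)"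
    unfolding sum.distrib linear_euclidean_sum[OF dframe_linear_arg, symmetric]
      linear_euclidean_sum[OF linear_frame, symmetric] .
  moreover have "(\<lambda>p. frame p p) = (\<lambda>p. p)" using frame_radial[of 1] by simp
  ultimately show ?thesis using has_derivative_unique[OF has_derivative_ident] by metis
qed

text \<open>Read through the injective map \<open>frame 0\<close>, the bracket is visibly linear in
  its second argument. This is what makes the equation for \<open>log_deriv\<close> a linear
  one.\<close>

lemma linear_lie_bracket: "linear (lie_bracket vf X)"
proof -
  have br: "frame 0 (lie_bracket vf X Y) = dframe 0 (frame 0 X) Y - dframe 0 (frame 0 Y) X" for Y
    by (rule frame_bracket)
  have inj: "Y = Z" if "frame 0 Y = frame 0 Z" for Y Z using inj_frame that by (rule injD)
  show ?thesis
  proof (rule linearI; rule inj)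
    show "frame 0 (lie_bracket vf X (Y + Z)) = frame 0 (lie_bracket vf X Y + lie_bracket vf X Z)" for Y Z
      by (simp add: br linear_add[OF linear_frame] linear_add[OF dframe_linear_arg]
          linear_add[OF dframe_linear_point])
    show "frame 0 (lie_bracket vf X (c *\<^sub>R Y)) = frame 0 (c *\<^sub>R lie_bracket vf X Y)" for c Y
      by (simp add: br linear_scale[OF linear_frame] linear_scale[OF dframe_linear_arg]
          linear_scale[OF dframe_linear_point] scaleR_right_diff_distrib)
  qed
qed

text \<open>The left logarithmic derivative \<open>W\<close> of \<open>\<epsilon> \<mapsto> exp (t (Y + \<epsilon> X))\<close> at \<open>\<epsilon> = 0\<close>
  solves a linear equation which involves the Lie algebra structure only.\<close>

definition log_deriv :: "'a \<Rightarrow> 'a \<Rightarrow> real \<Rightarrow> 'a" where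
  "log_deriv Y X t = t *\<^sub>R inv (frame (t *\<^sub>R Y)) X"

lemma frame_inv: "frame p (inv (frame p) X) = X"
  using linear_inj_imp_surj[OF linear_frame inj_frame] by (simp add: surj_f_inv_f)

text \<open>The two sides are compared after applying the frame at \<open>t Y\<close>. They match by
  \<open>frame_bracket\<close>, the identity \<open>frame (t Y) Y = Y\<close> and its differentiated
  form \<open>dframe_radial\<close>; in the resulting equation the frame has disappeared.\<close>

lemma log_deriv_ode:
  "(log_deriv Y X has_vector_derivative X - lie_bracket vf Y (log_deriv Y X t)) (at t)"
proof -
  let ?p = "t *\<^sub>R Y" and ?P = "inv (frame (t *\<^sub>R Y))"
  have d: "((\<lambda>s. frame (s *\<^sub>R Y) Z) has_vector_derivative dframe ?p Y Z) (at t)" for Z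
  proof -
    have "((\<lambda>s. s *\<^sub>R Y) has_vector_derivative Y) (at t)"
      by (auto intro!: derivative_eq_intros)
    from has_derivative_compose[OF this[unfolded has_vector_derivative_def] frame_has_derivative]
    show ?thesis by (simp add: has_vector_derivative_def linear_scale[OF dframe_linear_point])
  qed
  have "((\<lambda>s. inv (frame (s *\<^sub>R Y)) X) has_vector_derivative - ?P (dframe ?p Y (?P X))) (at t)"
    by (rule has_vector_derivative_inverse_linear[OF linear_frame inj_frame d])
  then have W: "(log_deriv Y X has_vector_derivative t *\<^sub>R (- ?P (dframe ?p Y (?P X))) + 1 *\<^sub>R ?P X) (at t)"
    unfolding log_deriv_def by (intro has_vector_derivative_scaleR) (auto intro!: derivative_eq_intros)
  let ?W = "log_deriv Y X t"
  have FW: "frame ?p ?W = t *\<^sub>R X" by (simp add: log_deriv_def linear_scale[OF linear_frame] frame_inv)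
  have "frame ?p (t *\<^sub>R (- ?P (dframe ?p Y (?P X))) + 1 *\<^sub>R ?P X) = X - dframe ?p Y ?W"
    by (simp add: linear_add[OF linear_frame] linear_scale[OF linear_frame] linear_neg[OF linear_frame]
        linear_diff[OF linear_frame] frame_inv log_deriv_def linear_scale[OF dframe_linear_arg])
  also have "\<dots> = frame ?p (X - lie_bracket vf Y ?W)"
  proof -
    have "t *\<^sub>R dframe ?p X Y + frame ?p X = X"
      using dframe_radial[of ?p X] by (simp add: linear_scale[OF dframe_linear_arg])
    then show ?thesis
      by (simp add: linear_diff[OF linear_frame] frame_bracket FW frame_radial
          linear_scale[OF dframe_linear_point] algebra_simps)
  qed
  finally show ?thesis using W injD[OF inj_frame] by metis
qed

lemma frame_morphism:
  assumes lin: "linear \<delta>" "inj \<delta>"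
    and mor: "\<And>X Y. \<delta> (lie_bracket vf X Y) = lie_bracket vf (\<delta> X) (\<delta> Y)"
  shows "frame (\<delta> p) (\<delta> X) = \<delta> (frame p X)"
proof -
  let ?X = "frame p X"
  \<comment> \<open>Taking \<open>frame p X\<close> as the constant vector cancels the inverse at
    time 1, where the second term is \<open>\<delta> X\<close>. Both terms start at 0 and solve the
    same equation, driven by \<open>\<delta> (frame p X)\<close>.\<close>
  let ?U = "\<lambda>t. log_deriv (\<delta> p) (\<delta> ?X) t - \<delta> (log_deriv p ?X t)"
  have bl: "bounded_linear \<delta>" using lin by (simp add: linear_conv_bounded_linear)
  have "?U 1 = 0"
  proof (rule linear_ode_zero)
    show "bounded_linear (\<lambda>Z. - lie_bracket vf (\<delta> p) Z)"
      using linear_lie_bracket by (auto intro!: bounded_linear_minus simp: linear_conv_bounded_linear)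
    fix t
    have "(?U has_vector_derivative (\<delta> ?X - lie_bracket vf (\<delta> p) (log_deriv (\<delta> p) (\<delta> ?X) t)) -
        \<delta> (?X - lie_bracket vf p (log_deriv p ?X t))) (at t)"
      by (intro has_vector_derivative_diff log_deriv_ode bounded_linear.has_vector_derivative[OF bl])
    then show "(?U has_vector_derivative - lie_bracket vf (\<delta> p) (?U t)) (at t)"
      by (simp add: linear_diff[OF lin(1)] mor linear_diff[OF linear_lie_bracket])
  qed (simp_all add: log_deriv_def linear_0[OF lin(1)])
  then have "inv (frame (\<delta> p)) (\<delta> ?X) = \<delta> X"
    by (simp add: log_deriv_def inv_f_f[OF inj_frame])
  then show ?thesis by (metis frame_inv)
qed

text \<open>Left invariance in coordinates: by associativity, the curve
  \<open>q + expG p + expG (t X)\<close> is a flow curve through \<open>q + expG p\<close> and at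
  the same time the translate of one through \<open>expG p\<close>.\<close>

lemma frame_left_translation:
  assumes "((\<lambda>X. logG (q + expG X)) has_derivative D) (at p)"
  shows "frame (logG (q + expG p)) X = D (frame p X)"
proof -
  have "((\<lambda>t. logG (q + expG (logG (expG p + expG (t *\<^sub>R X))))) has_vector_derivative D (frame p X)) (at 0)"
  proof -
    have D: "((\<lambda>X. logG (q + expG X)) has_derivative D) (at (logG (expG p + expG (0 *\<^sub>R X))))"
      using assms by simp
    show ?thesis
      using has_derivative_compose[OF frame_derivative[unfolded has_vector_derivative_def] D]
      by (simp add: has_vector_derivative_def linear_scale[OF has_derivative_linear[OF assms]])
  qed
  moreover have "((\<lambda>t. logG (expG (logG (q + expG p)) + expG (t *\<^sub>R X))) has_vector_derivative
      frame (logG (q + expG p)) X) (at 0)"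
    by (rule frame_derivative)
  ultimately show ?thesis
    using vector_derivative_unique_at by (fastforce simp: add.assoc)
qed

end

section \<open>Haar measure in eigenbasis coordinates\<close>

text \<open>The change of variables theorem of the library is about \<open>real ^ 'n\<close> with a well-ordered
  \<open>'n\<close>; this type provides such an index type of the right cardinality for every Euclidean space.\<close>

typedef (overloaded) 'a basis_index = "Basis :: 'a::euclidean_space set"
  using nonempty_Basis by blast

instantiation basis_index :: (euclidean_space) "{finite, wellorder}"
begin

definition basis_index_rank :: "'a basis_index \<Rightarrow> nat" where
  "basis_index_rank i = to_nat_on (Basis :: 'a set) (Rep_basis_index i)"

lemma inj_basis_index_rank: "inj (basis_index_rank :: 'a basis_index \<Rightarrow> nat)"
proof (rule injI)
  fix i j :: "'a basis_index"
  assume "basis_index_rank i = basis_index_rank j"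
  then have "Rep_basis_index i = Rep_basis_index j"
    using inj_on_to_nat_on[of "Basis :: 'a set"] Rep_basis_index[of i] Rep_basis_index[of j]
    by (auto simp: basis_index_rank_def inj_on_def countable_finite)
  then show "i = j" by (simp add: Rep_basis_index_inject)
qed

definition less_eq_basis_index :: "'a basis_index \<Rightarrow> 'a basis_index \<Rightarrow> bool" where
  "less_eq_basis_index i j \<longleftrightarrow> basis_index_rank i \<le> basis_index_rank j"

definition less_basis_index :: "'a basis_index \<Rightarrow> 'a basis_index \<Rightarrow> bool" where
  "less_basis_index i j \<longleftrightarrow> basis_index_rank i < basis_index_rank j"

instance
proof
  show "finite (UNIV :: 'a basis_index set)"
    using finite_imageI[OF finite_Basis, of Abs_basis_index] type_definition.Abs_image[OF type_definition_basis_index]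
    by metis
  fix P :: "'a basis_index \<Rightarrow> bool" and a
  assume *: "\<And>x. (\<And>y. y < x \<Longrightarrow> P y) \<Longrightarrow> P x"
  show "P a"
    by (induction a rule: measure_induct_rule[of basis_index_rank]) (use * in \<open>simp add: less_basis_index_def\<close>)
qed (auto simp: less_eq_basis_index_def less_basis_index_def inj_eq[OF inj_basis_index_rank])

end

lemma card_basis_index: "CARD('a::euclidean_space basis_index) = DIM('a)"
  using type_definition.card[OF type_definition_basis_index] .

definition weighted_dilation :: "('n \<Rightarrow> real) \<Rightarrow> real \<Rightarrow> real^'n \<Rightarrow> real^'n" where
  "weighted_dilation \<nu> s p = (\<chi> i. s powr \<nu> i * p $ i)"

lemma linear_weighted_dilation: "linear (weighted_dilation \<nu> s)"
  by (rule linearI) (simp_all add: weighted_dilation_def vec_eq_iff algebra_simps)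

lemma weighted_dilation_mult:
  "s > 0 \<Longrightarrow> t > 0 \<Longrightarrow> weighted_dilation \<nu> s (weighted_dilation \<nu> t p) = weighted_dilation \<nu> (s * t) p"
  by (simp add: weighted_dilation_def powr_mult mult_ac)

lemma weighted_dilation_1 [simp]: "weighted_dilation \<nu> 1 p = p"
  by (simp add: weighted_dilation_def)

lemma det_weighted_dilation:
  assumes "s > 0"
  shows "det (matrix (weighted_dilation \<nu> s :: real^'n \<Rightarrow> real^'n)) = s powr (\<Sum>i\<in>UNIV. \<nu> i)"
proof -
  have "det (matrix (weighted_dilation \<nu> s :: real^'n \<Rightarrow> real^'n)) = (\<Prod>i\<in>UNIV. s powr \<nu> i)"
    by (subst det_diagonal) (auto simp: matrix_def weighted_dilation_def axis_def)
  then show ?thesis using assms by (simp add: powr_sum)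
qed

text \<open>Indexing the eigenbasis by a type turns the Lie algebra into \<open>real ^ 'n\<close>,
  where the dilations are diagonal matrices.\<close>

locale homogeneous_group_basis = homogeneous_group charts vf expG A
  for charts :: "('g::{topological_group_add, t2_space, second_countable_topology}, 'a::euclidean_space) chart set"
    and vf expG A +
  fixes \<beta> :: "'n::{finite,wellorder} \<Rightarrow> 'a" and \<nu> :: "'n \<Rightarrow> real"
  assumes eigen: "\<And>i. A (\<beta> i) = \<nu> i *\<^sub>R \<beta> i" and inj_\<beta>: "inj \<beta>"
    and independent_\<beta>: "independent (range \<beta>)" and span_\<beta>: "span (range \<beta>) = UNIV"
begin

definition comb :: "real^'n::_ \<Rightarrow> 'a" where
  "comb p = (\<Sum>i\<in>UNIV. p $ i *\<^sub>R \<beta> i)"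

definition coords :: "'a \<Rightarrow> real^'n::_" where
  "coords = inv comb"

lemma linear_comb: "linear comb"
  by (rule linearI) (simp_all add: comb_def scaleR_left_distrib sum.distrib scaleR_sum_right)

lemma inj_comb: "inj comb"
proof (rule linear_injective_0[OF linear_comb, THEN iffD2], intro allI impI)
  fix p assume p: "comb p = 0"
  have "(\<Sum>b\<in>range \<beta>. (p $ inv \<beta> b) *\<^sub>R b) = 0"
    using p by (simp add: comb_def sum.reindex[OF inj_\<beta>] inv_f_f[OF inj_\<beta>])
  then have "p $ inv \<beta> b = 0" if "b \<in> range \<beta>" for b
    using independentD[OF independent_\<beta> _ order_refl, of "\<lambda>b. p $ inv \<beta> b" b] that by simp
  then have "p $ i = 0" for i by (metis inv_f_f[OF inj_\<beta>] rangeI)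
  then show "p = 0" by (simp add: vec_eq_iff)
qed

lemma surj_comb: "surj comb"
proof -
  have "x \<in> range comb" for x
  proof -
    have "x \<in> span (range \<beta>)" by (simp add: span_\<beta>)
    then obtain u where u: "x = (\<Sum>b\<in>range \<beta>. u b *\<^sub>R b)"
      by (auto simp: span_finite)
    have "x = comb (\<chi> i. u (\<beta> i))"
      by (simp add: u comb_def sum.reindex[OF inj_\<beta>])
    then show ?thesis by blast
  qed
  then show ?thesis by blast
qed

lemma comb_coords [simp]: "comb (coords X) = X"
  by (simp add: coords_def surj_comb surj_f_inv_f)

lemma coords_comb [simp]: "coords (comb p) = p"
  by (simp add: coords_def inj_comb inv_f_f)

lemma linear_coords: "linear coords"
  by (rule linearI; rule injD[OF inj_comb])
    (simp_all add: linear_add[OF linear_comb] linear_scale[OF linear_comb])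

lemma bounded_linear_comb: "bounded_linear comb" and bounded_linear_coords: "bounded_linear coords"
  using linear_comb linear_coords by (simp_all add: linear_conv_bounded_linear)

lemma comb_axis: "comb (axis i 1) = \<beta> i"
proof -
  have "comb (axis i 1) = (\<Sum>j\<in>UNIV. if j = i then \<beta> j else 0)"
    unfolding comb_def by (intro sum.cong) (auto simp: axis_def)
  then show ?thesis by simp
qed

lemma eigenvalue_pos: "\<nu> i > 0"
proof -
  have "\<beta> i \<noteq> 0" using independent_\<beta> dependent_zero[of "range \<beta>"] rangeI[of \<beta> i] by auto
  then show ?thesis
    using positive_eigenvalues eigen[of i] unfolding positive_eigenvalues_def by blast
qed

text \<open>The eigenbasis need not be orthonormal, so this is invariance of the trace under a
  change of basis: exchanging the sums pairs each eigenvector with its own coordinate functional,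
  which takes the value 1 on it.\<close>

lemma trace_op_eq_sum: "trace_op A = (\<Sum>i\<in>UNIV. \<nu> i)"
proof -
  have linA: "linear A" using diagonalisable by (simp add: diagonalisable_def)
  have A: "A X = (\<Sum>i\<in>UNIV. (\<nu> i * coords X $ i) *\<^sub>R \<beta> i)" for X
  proof -
    have "A X = A (\<Sum>i\<in>UNIV. coords X $ i *\<^sub>R \<beta> i)" by (simp flip: comb_def)
    then show ?thesis by (simp add: linear_sum[OF linA] linear_scale[OF linA] eigen mult.commute)
  qed
  have lin: "linear (\<lambda>X. coords X $ i)" for i
    using linear_coords by (simp add: linear_iff)
  have "trace_op A = (\<Sum>b\<in>Basis. \<Sum>i\<in>UNIV. \<nu> i * (coords b $ i * (\<beta> i \<bullet> b)))"
    unfolding trace_op_def A by (simp add: inner_sum_left mult.assoc)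
  also have "\<dots> = (\<Sum>i\<in>UNIV. \<nu> i * (\<Sum>b\<in>Basis. (\<beta> i \<bullet> b) * coords b $ i))"
    by (subst sum.swap) (simp add: sum_distrib_left mult_ac)
  also have "\<dots> = (\<Sum>i\<in>UNIV. \<nu> i * coords (\<beta> i) $ i)"
    by (simp only: linear_euclidean_sum[OF lin, symmetric] real_scaleR_def[symmetric])
  also have "\<dots> = (\<Sum>i\<in>UNIV. \<nu> i)"
  proof (intro sum.cong refl)
    show "\<nu> i * coords (\<beta> i) $ i = \<nu> i" for i
      using coords_comb[of "axis i 1"] by (simp add: comb_axis)
  qed
  finally show ?thesis .
qed

text \<open>On an eigenvector the operator series collapses to the scalar exponential of
  \<open>ln s * \<nu> i\<close>.\<close>

lemma dil_alg_eigenvector: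
  assumes "s > 0"
  shows "dil_alg A s (\<beta> i) = (s powr \<nu> i) *\<^sub>R \<beta> i"
proof -
  have linA: "linear A" using diagonalisable by (simp add: diagonalisable_def)
  let ?x = "ln s * \<nu> i"
  have "((\<lambda>Y. ln s *\<^sub>R A Y) ^^ k) (\<beta> i) = (?x ^ k) *\<^sub>R \<beta> i" for k
    by (induction k) (simp_all add: linear_scale[OF linA] eigen mult_ac)
  then have "dil_alg A s (\<beta> i) = (\<Sum>k. (?x ^ k /\<^sub>R fact k) *\<^sub>R \<beta> i)"
    by (simp add: dil_alg_def divide_inverse mult.commute)
  also have "\<dots> = exp ?x *\<^sub>R \<beta> i"
    unfolding exp_def by (rule suminf_scaleR_left[symmetric]) (rule summable_exp_generic)
  finally show ?thesis using assms by (simp add: powr_def mult.commute)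
qed

lemma dil_alg_comb:
  assumes "s > 0"
  shows "dil_alg A s (comb p) = comb (weighted_dilation \<nu> s p)"
proof -
  have "linear (dil_alg A s)" using dil_morphism[OF assms] by blast
  then show ?thesis
    by (simp add: comb_def weighted_dilation_def linear_sum linear_scale dil_alg_eigenvector[OF assms] mult_ac)
qed

section \<open>Coordinates on the group and the explicit Haar measure\<close>

definition ex :: "real^'n::_ \<Rightarrow> 'g" where
  "ex p = expG (comb p)"

definition lg :: "'g \<Rightarrow> real^'n::_" where
  "lg x = coords (logG x)"

lemma ex_lg [simp]: "ex (lg x) = x" and lg_ex [simp]: "lg (ex p) = p"
  by (simp_all add: ex_def lg_def)

lemma continuous_ex: "continuous_on S ex" and continuous_lg: "continuous_on T lg"
  unfolding ex_def lg_def
  using continuous_on_compose2[OF continuous_expG linear_continuous_on[OF bounded_linear_comb]]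
    continuous_on_compose2[OF linear_continuous_on[OF bounded_linear_coords] continuous_on_subset[OF continuous_logG]]
  by auto

lemma ex_0 [simp]: "ex 0 = 0"
  by (simp add: ex_def linear_0[OF linear_comb])

lemma dil_ex: "s > 0 \<Longrightarrow> dil A expG s (ex p) = ex (weighted_dilation \<nu> s p)"
  by (simp add: dil_def ex_def dil_alg_comb)

definition frame_matrix :: "real^'n::_ \<Rightarrow> real^'n::_^'n::_" where
  "frame_matrix p = matrix (\<lambda>X. coords (frame (comb p) (comb X)))"

lemma linear_frame_coords: "linear (\<lambda>X. coords (frame (comb p) (comb X)))"
  using linear_compose[OF linear_compose[OF linear_comb linear_frame] linear_coords] by (simp add: o_def)

lemma det_frame_matrix_nz: "det (frame_matrix p) \<noteq> 0"
proof -
  have "inj (\<lambda>X. coords (frame (comb p) (comb X)))"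
    by (rule injI) (metis comb_coords coords_comb inj_frame injD)
  then show ?thesis
    unfolding frame_matrix_def
    by (subst det_nz_iff_inj) (simp_all add: matrix_vector_mul linear_frame_coords fun_eq_iff matrix_works)
qed

definition haar_density :: "real^'n::_ \<Rightarrow> real" where
  "haar_density p = 1 / \<bar>det (frame_matrix p)\<bar>"

lemma haar_density_pos: "haar_density p > 0"
  by (simp add: haar_density_def det_frame_matrix_nz)

lemma continuous_haar_density: "continuous_on UNIV haar_density"
proof -
  have "continuous_on UNIV (\<lambda>p. frame (comb p) X)" for X
    using continuous_on_compose2[OF smooth_on_imp_continuous_on[OF smooth_on_frame]
        linear_continuous_on[OF bounded_linear_comb]] by auto
  then have "continuous_on UNIV (\<lambda>p. coords (frame (comb p) X))" for X
    using continuous_on_compose2[OF linear_continuous_on[OF bounded_linear_coords]] by auto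
  then show ?thesis
    unfolding haar_density_def
    using det_frame_matrix_nz
    by (auto simp: det_def frame_matrix_def matrix_def intro!: continuous_intros)
qed

definition haar_coords :: "(real^'n::_) measure" where
  "haar_coords = density lborel (\<lambda>p. ennreal (haar_density p))"

lemma sets_haar_coords [simp, measurable_cong]: "sets haar_coords = sets borel"
  by (simp add: haar_coords_def)

text \<open>By \<open>frame_morphism\<close> the frame matrices at \<open>p\<close> and at its
  dilate are conjugate by the dilation, so their determinants agree and the density is invariant;
  the whole factor is the determinant of the dilation by \<open>1/s\<close>.\<close>

lemma haar_coords_dilation:
  assumes s: "s > 0"
  shows "distr haar_coords borel (weighted_dilation \<nu> s) = density haar_coords (\<lambda>_. ennreal (s powr - trace_op A))"
  unfolding haar_coords_def
proof (rule distr_density_change_of_variables[where g = "weighted_dilation \<nu> (1/s)" and g' = "\<lambda>_. weighted_dilation \<nu> (1/s)"])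
  have bl: "bounded_linear (weighted_dilation \<nu> s)" for s
    using linear_weighted_dilation by (simp add: linear_conv_bounded_linear)
  show "(weighted_dilation \<nu> (1/s) has_derivative weighted_dilation \<nu> (1/s)) (at p)" for p
    using bounded_linear_imp_has_derivative[OF bl] .
  show "continuous_on UNIV (weighted_dilation \<nu> s)"
    using linear_continuous_on[OF bl] .
  fix p :: "real^'n::_"
  let ?d = "weighted_dilation \<nu> (1/s)" and ?D = "dil_alg A (1/s)"
  have s': "1/s > 0" using s by simp
  have det: "det (matrix ?d) = s powr - trace_op A"
    using s unfolding det_weighted_dilation[OF s'] trace_op_eq_sum
    by (simp add: powr_divide powr_minus_divide)
  have inj: "inj ?D"
  proof (rule injI)
    fix X Y assume "?D X = ?D Y"
    then have "comb (?d (coords X)) = comb (?d (coords Y))"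
      using dil_alg_comb[OF s', of "coords X"] dil_alg_comb[OF s', of "coords Y"] by simp
    then have "weighted_dilation \<nu> s (?d (coords X)) = weighted_dilation \<nu> s (?d (coords Y))"
      using injD[OF inj_comb] by metis
    then have "coords X = coords Y" using s by (simp add: weighted_dilation_mult)
    then show "X = Y" by (metis comb_coords)
  qed
  have "(\<lambda>X. coords (frame (comb (?d p)) (comb X))) \<circ> ?d = ?d \<circ> (\<lambda>X. coords (frame (comb p) (comb X)))"
  proof
    fix X
    have "frame (comb (?d p)) (comb (?d X)) = ?D (frame (comb p) (comb X))"
      using frame_morphism[of ?D "comb p" "comb X"] dil_morphism[OF s'] inj
      by (simp add: dil_alg_comb[OF s'])
    also have "\<dots> = comb (?d (coords (frame (comb p) (comb X))))"
      using dil_alg_comb[OF s', of "coords (frame (comb p) (comb X))"] by simp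
    finally show "((\<lambda>X. coords (frame (comb (?d p)) (comb X))) \<circ> ?d) X =
        (?d \<circ> (\<lambda>X. coords (frame (comb p) (comb X)))) X" by simp
  qed
  then have "frame_matrix (?d p) ** matrix ?d = matrix ?d ** frame_matrix p"
    unfolding frame_matrix_def
    using matrix_compose[OF linear_weighted_dilation linear_frame_coords]
      matrix_compose[OF linear_frame_coords linear_weighted_dilation] by metis
  then have "det (frame_matrix (?d p)) * det (matrix ?d) = det (matrix ?d) * det (frame_matrix p)"
    by (metis det_mul)
  then have "det (frame_matrix (?d p)) = det (frame_matrix p)"
    using det s by simp
  then show "\<bar>det (matrix ?d)\<bar> * haar_density (?d p) = s powr - trace_op A * haar_density p"
    by (simp add: haar_density_def det)
qed (use s haar_density_pos continuous_haar_density in \<open>simp_all add: weighted_dilation_mult\<close>)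

text \<open>By \<open>frame_left_translation\<close> the frame matrix at the translate is the
  Jacobian of the translation times the frame matrix at the point, and the reciprocal determinant in
  \<open>haar_density\<close> cancels exactly that Jacobian.\<close>

lemma haar_coords_translation:
  "distr haar_coords borel (\<lambda>p. lg (q + ex p)) = haar_coords"
proof -
  define T where "T q p = lg (q + ex p)" for q p
  define D where "D q p = frechet_derivative (\<lambda>X. logG (q + expG X)) (at (comb p))" for q p
  have D: "((\<lambda>X. logG (q + expG X)) has_derivative D q p) (at (comb p))" for q p
    unfolding D_def using left_translation_differentiable frechet_derivative_works by blast
  have T': "(T q has_derivative (\<lambda>v. coords (D q p (comb v)))) (at p)" for q p
    unfolding T_def lg_def ex_def
    by (rule bounded_linear.has_derivative[OF bounded_linear_coords]
        has_derivative_compose[OF bounded_linear_imp_has_derivative[OF bounded_linear_comb] D])+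
  have lin: "linear (\<lambda>v. coords (D q p (comb v)))" for q p
    using has_derivative_linear[OF T'] .
  have T_inv: "T q (T (- q) p) = p" "T (- q) (T q p) = p" for q p
    by (simp_all add: T_def flip: add.assoc)
  have "\<bar>det (matrix (\<lambda>v. coords (D (- q) p (comb v))))\<bar> * haar_density (T (- q) p) = 1 * haar_density p" for p
  proof -
    have "(\<lambda>X. coords (frame (comb (T (- q) p)) (comb X))) =
        (\<lambda>v. coords (D (- q) p (comb v))) \<circ> (\<lambda>X. coords (frame (comb p) (comb X)))"
      using frame_left_translation[OF D[of "- q" p]] by (simp add: fun_eq_iff T_def lg_def ex_def)
    then have "frame_matrix (T (- q) p) = matrix (\<lambda>v. coords (D (- q) p (comb v))) ** frame_matrix p"
      unfolding frame_matrix_def using matrix_compose[OF linear_frame_coords lin] by simp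
    then have d: "det (frame_matrix (T (- q) p)) = det (matrix (\<lambda>v. coords (D (- q) p (comb v)))) * det (frame_matrix p)"
      by (simp add: det_mul)
    moreover have "det (matrix (\<lambda>v. coords (D (- q) p (comb v)))) \<noteq> 0"
      using d det_frame_matrix_nz[of "T (- q) p"] by auto
    ultimately show ?thesis by (simp add: haar_density_def abs_mult)
  qed
  moreover have "continuous_on UNIV (T q)"
    by (intro continuous_at_imp_continuous_on ballI has_derivative_continuous[OF T'])
  ultimately have "distr haar_coords borel (T q) = density haar_coords (\<lambda>_. ennreal 1)"
    unfolding haar_coords_def
    by (intro distr_density_change_of_variables[where g = "T (- q)", OF T'])
      (auto simp: T_inv haar_density_pos continuous_haar_density)
  then show ?thesis by (simp add: T_def[abs_def] density_1)
qed

lemma emeasure_haar_coords_open: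
  assumes "open U" "U \<noteq> {}"
  shows "emeasure haar_coords U > 0"
proof (rule ccontr)
  have [measurable]: "haar_density \<in> borel_measurable borel" "U \<in> sets borel"
    using assms by (simp_all add: borel_measurable_continuous_onI continuous_haar_density)
  assume "\<not> ?thesis"
  then have "(\<integral>\<^sup>+p. ennreal (haar_density p) * indicator U p \<partial>lborel) = 0"
    by (simp add: haar_coords_def emeasure_density)
  then have "AE p in lborel. ennreal (haar_density p) * indicator U p = 0"
    by (subst (asm) nn_integral_0_iff_AE) auto
  then have "AE p in lborel. p \<notin> U"
    by eventually_elim (use haar_density_pos in \<open>auto simp: indicator_def ennreal_eq_0_iff not_le[symmetric] split: if_splits\<close>)
  then have "U \<in> null_sets lborel"
    by (subst (asm) AE_iff_null_sets[symmetric]) auto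
  then have "negligible U"
    by (simp add: negligible_iff_null_sets null_sets_completionI)
  then show False using open_not_negligible assms by blast
qed

lemma emeasure_haar_coords_compact: "compact K \<Longrightarrow> emeasure haar_coords K < \<infinity>"
  unfolding haar_coords_def
  using haar_density_pos less_imp_le
  by (subst emeasure_density_lborel_compact) (auto intro: continuous_haar_density less_imp_le)

lemma haar_measure_ex: "haar_measure (distr haar_coords borel ex)"
  unfolding haar_measure_def
proof (intro conjI allI impI)
  have exm [measurable]: "ex \<in> borel_measurable borel" and lgm [measurable]: "lg \<in> borel_measurable borel"
    by (auto intro!: borel_measurable_continuous_onI continuous_ex continuous_lg)
  have em: "emeasure (distr haar_coords borel ex) S = emeasure haar_coords (lg ` S)" if "S \<in> sets borel" for S
  proof -
    have "ex -` S = lg ` S" by (auto simp: image_iff intro!: bexI[of _ "ex _"])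
    then show ?thesis using that by (simp add: emeasure_distr space_borel sets_eq_imp_space_eq[OF sets_haar_coords])
  qed
  show "emeasure (distr haar_coords borel ex) K < \<infinity>" if "compact K" for K
    using that compact_continuous_image[OF continuous_lg that] emeasure_haar_coords_compact
    by (simp add: em borel_compact)
  show "emeasure (distr haar_coords borel ex) U > 0" if "open U" "U \<noteq> {}" for U
  proof -
    have "lg ` U = ex -` U" by (auto simp: image_iff intro!: bexI[of _ "ex _"])
    then have "open (lg ` U)" using open_vimage[OF that(1) continuous_ex] by simp
    then show ?thesis using that emeasure_haar_coords_open by (simp add: em)
  qed
  fix y
  have "distr (distr haar_coords borel ex) (distr haar_coords borel ex) (\<lambda>x. y + x) =
      distr (distr haar_coords borel ex) borel (\<lambda>x. y + x)"
    by (intro distr_cong) simp_all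
  also have "\<dots> = distr haar_coords borel (\<lambda>p. y + ex p)"
    by (subst distr_distr) (auto simp: o_def)
  also have "\<dots> = distr (distr haar_coords borel (\<lambda>p. lg (y + ex p))) borel ex"
    by (subst distr_distr) (auto simp: o_def)
  also have "\<dots> = distr haar_coords borel ex"
    by (simp add: haar_coords_translation)
  finally show "distr (distr haar_coords borel ex) (distr haar_coords borel ex) (\<lambda>x. y + x) =
      distr haar_coords borel ex" .
qed simp

lemma sigma_finite_haar:
  assumes "haar_measure \<mu>"
  shows "sigma_finite_measure (\<mu> :: 'g measure)"
proof (rule sigma_finite_measure.intro, rule exI, intro conjI)
  let ?S = "range (\<lambda>n. ex ` cball 0 (real n))"
  have comp: "compact (ex ` cball 0 r)" for r
    by (intro compact_continuous_image continuous_ex) simp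
  show "countable ?S" by simp
  show "?S \<subseteq> sets \<mu>" using assms comp by (auto simp: haar_measure_def borel_compact)
  have "x \<in> \<Union>?S" for x
  proof -
    obtain n where "norm (lg x) \<le> real n" using real_arch_simple by blast
    then have "x \<in> ex ` cball 0 (real n)" by (intro image_eqI[of _ _ "lg x"]) simp_all
    then show ?thesis by blast
  qed
  moreover have "space \<mu> = UNIV"
    using assms sets_eq_imp_space_eq[of \<mu> borel] by (simp add: haar_measure_def)
  ultimately show "\<Union>?S = space \<mu>" by blast
  show "\<forall>a\<in>?S. emeasure \<mu> a \<noteq> \<infinity>"
    using assms comp unfolding haar_measure_def by (auto simp: less_top)
qed

text \<open>The image of the closed unit ball is the compact neighbourhood required for uniqueness.
  The constant is moved to the coordinate side, so that \<open>\<mu>\<close> is a plain image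
  measure.\<close>

lemma haar_measure_eq_coords:
  assumes "haar_measure \<mu>"
  obtains c where "\<mu> = distr (density haar_coords (\<lambda>_. c)) borel ex"
proof -
  have "compact (ex ` cball 0 1)" by (intro compact_continuous_image continuous_ex) simp
  moreover have "ex ` ball 0 1 = lg -` ball 0 1" by (auto simp: image_iff intro!: bexI[of _ "lg _"])
  then have "open (ex ` ball 0 1)" using open_vimage[OF open_ball continuous_lg] by metis
  moreover have "ex ` ball 0 1 \<subseteq> ex ` cball 0 1" by (intro image_mono) auto
  ultimately obtain c where "\<mu> = density (distr haar_coords borel ex) (\<lambda>_. c)"
    using haar_measure_unique[OF assms haar_measure_ex sigma_finite_haar[OF assms] sigma_finite_haar[OF haar_measure_ex]]
    by (metis image_is_empty ball_eq_empty zero_less_one not_le)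
  moreover have "ex \<in> borel_measurable borel"
    by (auto intro!: borel_measurable_continuous_onI continuous_ex)
  ultimately have "\<mu> = distr (density haar_coords (\<lambda>_. c)) borel ex"
    by (simp add: density_distr)
  then show ?thesis by (rule that)
qed

end

section \<open>The Euler operator of a family of dilations\<close>

text \<open>All that the analysis retains of the group. The number \<open>Q\<close> enters through
  the scaling of the measure alone, and \<open>m_open\<close> is what turns a vanishing integral
  into a vanishing continuous function.\<close>

locale dilation_space =
  fixes \<nu> :: "'n::finite \<Rightarrow> real" and N :: "real^'n \<Rightarrow> real" and m :: "(real^'n) measure" and Q :: real
  assumes \<nu>_pos: "\<nu> i > 0"
    and N_cont: "continuous_on UNIV N" and N_nonneg: "N p \<ge> 0"
    and N_dil: "s > 0 \<Longrightarrow> N (weighted_dilation \<nu> s p) = s * N p" and N_eq_0: "N p = 0 \<longleftrightarrow> p = 0"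
    and sets_m [measurable_cong, simp]: "sets m = sets borel"
    and m_dil: "s > 0 \<Longrightarrow> distr m borel (weighted_dilation \<nu> s) = density m (\<lambda>_. ennreal (s powr - Q))"
    and m_compact: "compact K \<Longrightarrow> emeasure m K < \<infinity>"
    and m_open: "open U \<Longrightarrow> U \<noteq> {} \<Longrightarrow> emeasure m U > 0"
begin

text \<open>Additive parametrisation: \<open>t\<close> is the logarithm of the dilation factor, so
  that \<open>D\<close> is a one-parameter group and the Euler operator is its derivative at
  \<open>t = 0\<close>.\<close>

definition D :: "real \<Rightarrow> real^'n \<Rightarrow> real^'n" where
  "D t p = weighted_dilation \<nu> (exp t) p"

lemma D_nth [simp]: "D t p $ i = exp (\<nu> i * t) * p $ i"
  by (simp add: D_def weighted_dilation_def powr_def)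

lemma D_0 [simp]: "D 0 p = p" by (simp add: vec_eq_iff)

lemma D_D [simp]: "D s (D t p) = D (s + t) p"
  by (simp add: vec_eq_iff distrib_left exp_add)

lemma D_zero [simp]: "D t 0 = 0" by (simp add: vec_eq_iff)

lemma N_D [simp]: "N (D t p) = exp t * N p"
  by (simp add: D_def N_dil)

lemma N_pos: "p \<noteq> 0 \<Longrightarrow> N p > 0"
  using N_nonneg[of p] N_eq_0[of p] by linarith

lemma continuous_D: "continuous_on S (\<lambda>x. D (f x) (g x))" if "continuous_on S f" "continuous_on S g"
proof -
  have "D (f x) (g x) = (\<chi> i. exp (\<nu> i * f x) * g x $ i)" for x
    by (simp add: vec_eq_iff)
  then show ?thesis using that by (simp add: continuous_intros)
qed

lemma space_m [simp]: "space m = UNIV"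
  using sets_eq_imp_space_eq[OF sets_m] by simp

lemma N_measurable [measurable]: "N \<in> borel_measurable borel"
  by (intro borel_measurable_continuous_onI N_cont)

definition gen :: "real^'n \<Rightarrow> real^'n" where
  "gen p = (\<chi> i. \<nu> i * p $ i)"

definition euler :: "(real^'n \<Rightarrow> complex) \<Rightarrow> (real^'n \<Rightarrow> complex)" where
  "euler g p = frechet_derivative g (at p) (gen p)"

definition test :: "(real^'n \<Rightarrow> complex) set" where
  "test = {g. smooth_on UNIV g \<and> (\<exists>K. compact K \<and> 0 \<notin> K \<and> (\<forall>p. p \<notin> K \<longrightarrow> g p = 0))}"

lemma testE:
  assumes "g \<in> test"
  obtains K where "smooth_on UNIV g" "compact K" "0 \<notin> K" "\<And>p. p \<notin> K \<Longrightarrow> g p = 0"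
  using assms unfolding test_def by blast

lemma test_continuous: "g \<in> test \<Longrightarrow> continuous_on UNIV g"
  by (auto simp: test_def intro: smooth_on_imp_continuous_on)

lemma test_0: "g \<in> test \<Longrightarrow> g 0 = 0"
  by (auto simp: test_def)

lemma D_has_vector_derivative: "((\<lambda>t. D t p) has_vector_derivative gen (D t p)) (at t)"
proof -
  have "((\<lambda>t. \<Sum>i\<in>UNIV. D t p $ i *\<^sub>R axis i (1::real)) has_vector_derivative
      (\<Sum>i\<in>UNIV. gen (D t p) $ i *\<^sub>R axis i 1)) (at t)"
    unfolding gen_def D_nth vec_lambda_beta
    by (intro has_vector_derivative_sum has_vector_derivative_scaleR[THEN has_vector_derivative_eq_rhs]
        has_vector_derivative_const derivative_eq_intros refl | simp)+
  moreover have "(\<Sum>i\<in>UNIV. q $ i *\<^sub>R axis i (1::real)) = q" for q :: "real^'n"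
    using basis_expansion[of q] by (simp add: scalar_mult_eq_scaleR)
  ultimately show ?thesis by (simp only:)
qed

lemma euler_derivative:
  assumes "smooth_on UNIV g"
  shows "((\<lambda>t. g (D t p)) has_vector_derivative euler g (D t p)) (at t)"
proof -
  have g: "(g has_derivative frechet_derivative g (at (D t p))) (at (D t p))"
    using smooth_on_has_derivative[OF assms] by simp
  show ?thesis
    using has_derivative_compose[OF D_has_vector_derivative[unfolded has_vector_derivative_def] g]
    by (simp add: has_vector_derivative_def euler_def linear_scale[OF has_derivative_linear[OF g]])
qed

lemma euler_eqI:
  assumes "smooth_on UNIV g" "((\<lambda>t. g (D t p)) has_vector_derivative d) (at 0)"
  shows "euler g p = d"
  using euler_derivative[OF assms(1), of p 0] assms(2) vector_derivative_unique_at by fastforce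

lemma euler_test: assumes "g \<in> test" shows "euler g \<in> test"
proof -
  obtain K where K: "smooth_on UNIV g" "compact K" "0 \<notin> K" "\<And>p. p \<notin> K \<Longrightarrow> g p = 0"
    using testE[OF assms] by blast
  have lin: "linear (frechet_derivative g (at p))" for p
    using has_derivative_linear smooth_on_has_derivative[OF K(1)] by blast
  have eq: "euler g = (\<lambda>p. \<Sum>b\<in>Basis. (gen p \<bullet> b) *\<^sub>R frechet_derivative g (at p) b)"
    unfolding euler_def using linear_euclidean_sum[OF lin] by blast
  have "linear gen"
    by (rule linearI) (simp_all add: gen_def vec_eq_iff algebra_simps)
  then have bl: "bounded_linear (\<lambda>p. gen p \<bullet> b)" for b
    using bounded_linear_compose[OF bounded_linear_inner_left] by (simp add: linear_conv_bounded_linear)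
  have "smooth_on UNIV (euler g)"
    unfolding eq
    by (intro smooth_on_sum smooth_on_scaleR smooth_on_linear[OF bl] smooth_on_frechet_derivative K(1) open_UNIV)
  moreover have "euler g p = 0" if "p \<notin> K" for p
  proof -
    have "(g has_derivative (\<lambda>v. 0)) (at p)"
      by (rule has_derivative_transform_within_open[OF has_derivative_const, of "- K"])
        (use that K compact_imp_closed in auto)
    then show ?thesis by (simp add: euler_def flip: frechet_derivative_at)
  qed
  ultimately show ?thesis using K unfolding test_def by blast
qed

lemma test_lincomb:
  assumes "g \<in> test" "h \<in> test"
  shows "(\<lambda>p. a * g p + b * h p) \<in> test"
proof -
  obtain K where K: "smooth_on UNIV g" "compact K" "0 \<notin> K" "\<And>p. p \<notin> K \<Longrightarrow> g p = 0"
    using testE[OF assms(1)] by blast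
  obtain K' where K': "smooth_on UNIV h" "compact K'" "0 \<notin> K'" "\<And>p. p \<notin> K' \<Longrightarrow> h p = 0"
    using testE[OF assms(2)] by blast
  have "smooth_on UNIV (\<lambda>p. a * g p + b * h p)"
    by (intro smooth_on_add smooth_on_bounded_linear[OF bounded_linear_mult_right] K K') auto
  moreover have "compact (K \<union> K')" "0 \<notin> K \<union> K'" using K K' by auto
  moreover have "a * g p + b * h p = 0" if "p \<notin> K \<union> K'" for p using that K K' by simp
  ultimately show ?thesis unfolding test_def by blast
qed

lemma euler_lincomb:
  assumes "g \<in> test" "h \<in> test"
  shows "euler (\<lambda>p. a * g p + b * h p) p = a * euler g p + b * euler h p"
proof (rule euler_eqI)
  show "smooth_on UNIV (\<lambda>p. a * g p + b * h p)"
    using test_lincomb[OF assms] by (simp add: test_def)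
  have "((\<lambda>t. g (D t p)) has_vector_derivative euler g p) (at 0)"
    "((\<lambda>t. h (D t p)) has_vector_derivative euler h p) (at 0)"
    using euler_derivative[of g p 0] euler_derivative[of h p 0] assms by (auto simp: test_def)
  then show "((\<lambda>t. a * g (D t p) + b * h (D t p)) has_vector_derivative a * euler g p + b * euler h p) (at 0)"
    by (intro has_vector_derivative_add has_vector_derivative_mult_right)
qed

primrec falling :: "nat \<Rightarrow> (real^'n \<Rightarrow> complex) \<Rightarrow> (real^'n \<Rightarrow> complex)" where
  "falling 0 g = g"
| "falling (Suc k) g = (\<lambda>p. euler (falling k g) p - of_nat k * falling k g p)"

lemma falling_test: "g \<in> test \<Longrightarrow> falling k g \<in> test"
proof (induction k)
  case (Suc k)
  then show ?case using test_lincomb[OF euler_test, of "falling k g" "falling k g" 1 "- of_nat k"] by simp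
qed simp

definition radial :: "(real^'n \<Rightarrow> complex) \<Rightarrow> (real^'n \<Rightarrow> complex)" where
  "radial g p = (if p = 0 then 0
     else vector_derivative (\<lambda>r. g (weighted_dilation \<nu> r (weighted_dilation \<nu> (1 / N p) p))) (at (N p)))"

text \<open>As \<open>N\<close> is homogeneous of degree one, \<open>\<R> = N\<^sup>-\<^sup>1 E\<close> for the Euler operator \<open>E\<close>, and
  therefore \<open>\<R>\<^sup>k = N\<^sup>-\<^sup>k E (E - 1) \<dots> (E - k + 1)\<close>.\<close>

lemma radial_power:
  assumes "g \<in> test"
  shows "(radial ^^ k) g = (\<lambda>p. complex_of_real (N p powr - real k) * falling k g p)"
proof (induction k)
  case 0
  \<comment> \<open>\<open>0 powr 0\<close> is 0, so at the origin the formula holds because test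
    functions vanish there.\<close>
  show ?case using test_0[OF assms] N_pos by (force simp: fun_eq_iff N_eq_0 powr_def)
next
  case (Suc k)
  show ?case
  proof
    fix p
    let ?h = "falling k g"
    have h: "smooth_on UNIV ?h" using falling_test[OF assms] by (simp add: test_def)
    show "(radial ^^ Suc k) g p = complex_of_real (N p powr - real (Suc k)) * falling (Suc k) g p"
    proof (cases "p = 0")
      case True
      then show ?thesis by (simp add: radial_def N_eq_0)
    next
      case False
      define \<rho> where "\<rho> = N p"
      define y where "y = weighted_dilation \<nu> (1 / \<rho>) p"
      have \<rho>: "\<rho> > 0" using False N_pos by (simp add: \<rho>_def)
      \<comment> \<open>In the logarithm of the radius the ray through \<open>p\<close> is an orbit
        of \<open>D\<close>, so the chain rule puts the factor \<open>1 / \<rho>\<close> in front of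
        the Euler operator; along the ray the quasi-norm is \<open>r\<close> itself.\<close>
      have wd: "weighted_dilation \<nu> r y = D (ln r - ln \<rho>) p" if "r > 0" for r
        using that \<rho> by (simp add: y_def weighted_dilation_mult D_def exp_diff)
      have "((\<lambda>r. ?h (D (ln r - ln \<rho>) p)) has_vector_derivative (1 / \<rho>) *\<^sub>R euler ?h p) (at \<rho>)"
      proof -
        have "((\<lambda>r. ln r - ln \<rho>) has_vector_derivative 1 / \<rho>) (at \<rho>)"
          using \<rho> by (auto intro!: derivative_eq_intros simp flip: has_real_derivative_iff_has_vector_derivative)
        from vector_diff_chain_at[OF this euler_derivative[OF h]] show ?thesis by (simp add: o_def)
      qed
      moreover have "((\<lambda>r. complex_of_real (r powr - real k)) has_vector_derivative
          complex_of_real (- real k * \<rho> powr (- real k - 1))) (at \<rho>)"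
        using has_real_derivative_powr[OF \<rho>, of "- real k"]
        by (intro has_vector_derivative_of_real) (simp add: has_real_derivative_iff_has_vector_derivative)
      ultimately have "((\<lambda>r. complex_of_real (r powr - real k) * ?h (D (ln r - ln \<rho>) p)) has_vector_derivative
          complex_of_real (\<rho> powr - real k) * ((1 / \<rho>) *\<^sub>R euler ?h p) +
          complex_of_real (- real k * \<rho> powr (- real k - 1)) * ?h (D (ln \<rho> - ln \<rho>) p)) (at \<rho>)"
        by (intro has_vector_derivative_mult)
      moreover have "complex_of_real (\<rho> powr - real k) * ((1 / \<rho>) *\<^sub>R euler ?h p) +
          complex_of_real (- real k * \<rho> powr (- real k - 1)) * ?h (D (ln \<rho> - ln \<rho>) p) =
          complex_of_real (\<rho> powr - real (Suc k)) * falling (Suc k) g p"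
      proof -
        have *: "\<rho> powr - real k * (1 / \<rho>) = \<rho> powr (- real k - 1)"
          using \<rho> by (simp add: powr_diff)
        have "complex_of_real (\<rho> powr - real k) * ((1 / \<rho>) *\<^sub>R euler ?h p) =
            complex_of_real (\<rho> powr (- real k - 1)) * euler ?h p"
          by (simp only: scaleR_conv_of_real mult.assoc[symmetric] of_real_mult[symmetric] *)
        moreover have "- real (Suc k) = - real k - 1" by simp
        ultimately show ?thesis
          unfolding falling.simps by (simp only:) (simp add: right_diff_distrib)
      qed
      ultimately have "((\<lambda>r. complex_of_real (r powr - real k) * ?h (D (ln r - ln \<rho>) p)) has_vector_derivative
          complex_of_real (\<rho> powr - real (Suc k)) * falling (Suc k) g p) (at \<rho>)"
        by simp
      then have "((\<lambda>r. (radial ^^ k) g (weighted_dilation \<nu> r y)) has_vector_derivative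
          complex_of_real (\<rho> powr - real (Suc k)) * falling (Suc k) g p) (at \<rho>)"
        by (rule has_vector_derivative_transform_within_open[of _ _ _ "{0<..}"])
          (use \<rho> in \<open>auto simp: Suc.IH wd exp_diff \<rho>_def[symmetric]\<close>)
      then show ?thesis
        using False by (simp add: radial_def vector_derivative_at \<rho>_def[symmetric] y_def)
    qed
  qed
qed

section \<open>Integration by parts\<close>

lemma N_powr_continuous: "0 \<notin> K \<Longrightarrow> continuous_on K (\<lambda>p. N p powr s)"
  by (intro continuous_intros continuous_on_subset[OF N_cont]) (auto simp: N_eq_0)

lemma integrable_weighted:
  fixes v :: "real^'n \<Rightarrow> real"
  assumes v: "v \<in> borel_measurable borel" "\<And>p. \<bar>v p\<bar> \<le> B" and K: "compact K" "0 \<notin> K" "\<And>p. p \<notin> K \<Longrightarrow> v p = 0"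
  shows "integrable m (\<lambda>p. N p powr s * v p)"
proof -
  obtain C where C: "C \<ge> 0" "\<And>p. p \<in> K \<Longrightarrow> norm (N p powr s) \<le> C"
    using continuous_on_compact_bound[OF K(1) N_powr_continuous[OF K(2)]] by blast
  show ?thesis
  proof (rule integrableI_bounded_set)
    show "K \<in> sets m" using K by (simp add: borel_compact)
    show "emeasure m K < \<infinity>" by (rule m_compact[OF K(1)])
    show "(\<lambda>p. N p powr s * v p) \<in> borel_measurable m"
      using v(1) by measurable
    show "AE p in m. p \<in> K \<longrightarrow> norm (N p powr s * v p) \<le> C * B"
    proof (intro AE_I2 impI)
      fix p assume "p \<in> K"
      then have "norm (N p powr s) * norm (v p) \<le> C * B"
        using C(1) C(2)[of p] v(2)[of p] by (intro mult_mono) auto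
      then show "norm (N p powr s * v p) \<le> C * B" by (simp add: abs_mult)
    qed
  qed (use K in auto)
qed

lemma integral_dilation:
  fixes F :: "real^'n \<Rightarrow> real"
  assumes [measurable]: "F \<in> borel_measurable borel"
  shows "(LINT p|m. F (D t p)) = exp (- Q * t) * (LINT p|m. F p)"
proof -
  have [measurable]: "D t \<in> borel_measurable borel"
    by (intro borel_measurable_continuous_onI continuous_D continuous_intros)
  have "(LINT p|m. F (D t p)) = (LINT p|distr m borel (D t). F p)"
    by (rule integral_distr[symmetric]) measurable
  also have "distr m borel (D t) = density m (\<lambda>_. ennreal (exp (- Q * t)))"
    using m_dil[of "exp t"] by (simp add: D_def[abs_def] powr_def)
  also have "(LINT p|density m (\<lambda>_. ennreal (exp (- Q * t))). F p) = (LINT p|m. exp (- Q * t) *\<^sub>R F p)"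
    by (rule integral_density) auto
  finally show ?thesis by simp
qed

lemma weighted_integral_dilation:
  fixes v :: "real^'n \<Rightarrow> real"
  assumes [measurable]: "v \<in> borel_measurable borel"
  shows "(LINT p|m. N p powr s * v (D t p)) = exp (- (Q + s) * t) * (LINT p|m. N p powr s * v p)"
proof -
  have "N p powr s = exp (- s * t) * (exp t * N p) powr s" for p
    by (simp add: powr_mult N_nonneg) (simp add: powr_def exp_add[symmetric])
  then have "(LINT p|m. N p powr s * v (D t p)) = (LINT p|m. exp (- s * t) * (N (D t p) powr s * v (D t p)))"
    by (metis (no_types, lifting) N_D mult.assoc)
  also have "\<dots> = exp (- s * t) * (LINT p|m. N (D t p) powr s * v (D t p))"
    by simp
  also have "(LINT p|m. N (D t p) powr s * v (D t p)) = exp (- Q * t) * (LINT p|m. N p powr s * v p)"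
    by (rule integral_dilation) measurable
  finally show ?thesis by (simp add: exp_add[symmetric] algebra_simps)
qed

text \<open>The integral of \<open>N^s\<close> times \<open>v (D t p)\<close> is an exact
  exponential in \<open>t\<close>; computing its derivative at \<open>t = 0\<close> inside and
  outside the integral gives the formula.\<close>

lemma integration_by_parts:
  fixes v v' :: "real^'n \<Rightarrow> real"
  assumes v: "continuous_on UNIV v" and v': "continuous_on UNIV v'"
    and der: "\<And>t p. ((\<lambda>t. v (D t p)) has_real_derivative v' (D t p)) (at t)"
    and K: "compact K" "0 \<notin> K" "\<And>p. p \<notin> K \<Longrightarrow> v p = 0" "\<And>p. p \<notin> K \<Longrightarrow> v' p = 0"
  shows "(LINT p|m. N p powr s * v' p) = - (Q + s) * (LINT p|m. N p powr s * v p)"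
proof -
  have [measurable]: "v \<in> borel_measurable borel" "v' \<in> borel_measurable borel"
    using v v' by (auto intro: borel_measurable_continuous_onI)
  have [measurable]: "D t \<in> borel_measurable borel" for t
    by (intro borel_measurable_continuous_onI continuous_D continuous_intros)
  have bound: "\<exists>C. \<forall>p. \<bar>w p\<bar> \<le> C" if w: "continuous_on UNIV w" "\<And>p. p \<notin> K \<Longrightarrow> w p = 0" for w :: "real^'n \<Rightarrow> real"
  proof -
    obtain C where C: "\<And>p. p \<in> K \<Longrightarrow> norm (w p) \<le> C"
      using continuous_on_compact_bound[OF K(1) continuous_on_subset[OF w(1)]] by blast
    then have "\<bar>w p\<bar> \<le> max C 0" for p
      using w(2)[of p] by (cases "p \<in> K") (auto simp: le_max_iff_disj)
    then show ?thesis by blast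
  qed
  obtain B where B: "\<And>p. \<bar>v p\<bar> \<le> B" using bound[OF v K(3)] by blast
  obtain C where C: "\<And>p. \<bar>v' p\<bar> \<le> C" using bound[OF v' K(4)] by blast
  \<comment> \<open>All points carried into \<open>K\<close> by some \<open>D t\<close> with
    \<open>0 \<le> t \<le> 1\<close>. Outside this one compact set every difference quotient
    vanishes, and it avoids 0, near which the weight may blow up.\<close>
  define K' where "K' = (\<lambda>(t, p). D (- t) p) ` ({0..1} \<times> K)"
  have K': "compact K'"
    unfolding K'_def case_prod_unfold
    by (intro compact_continuous_image compact_Times K compact_Icc continuous_D continuous_intros)
  have K'0: "0 \<notin> K'"
  proof
    assume "0 \<in> K'"
    then obtain t p where "p \<in> K" "D (- t) p = 0" by (auto simp: K'_def)
    then show False using D_D[of t "- t" p] K(2) by simp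
  qed
  have inK': "p \<in> K'" if "D t p \<in> K" "0 \<le> t" "t \<le> 1" for t p
    using that by (auto simp: K'_def intro!: image_eqI[of _ _ "(t, D t p)"])
  let ?J = "LINT p|m. N p powr s * v p"
  \<comment> \<open>Dominated convergence runs along a sequence, so \<open>t\<close> tends to 0
    through \<open>1 / (n + 1)\<close>, which stays within the time span 1 built into
    \<open>K'\<close>.\<close>
  define \<tau> where "\<tau> n = inverse (real (Suc n))" for n
  have \<tau>: "0 < \<tau> n" "\<tau> n \<le> 1" for n by (simp_all add: \<tau>_def field_simps)
  have \<tau>_lim: "\<tau> \<longlonglongrightarrow> 0" unfolding \<tau>_def by (rule LIMSEQ_inverse_real_of_nat)
  have \<tau>_at: "filterlim \<tau> (at 0) sequentially"
    using \<tau>_lim \<tau>(1) by (simp add: filterlim_at less_imp_neq[symmetric])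
  define q where "q n p = N p powr s * ((v (D (\<tau> n) p) - v p) / \<tau> n)" for n p
  have lim1: "(\<lambda>n. LINT p|m. q n p) \<longlonglongrightarrow> (LINT p|m. N p powr s * v' p)"
  proof (rule integral_dominated_convergence)
    show "integrable m (\<lambda>p. N p powr s * (C * indicator K' p))"
    proof (rule integrable_weighted[OF _ _ K' K'0])
      show "(\<lambda>p. C * indicator K' p) \<in> borel_measurable borel"
        using K' by (intro borel_measurable_times borel_measurable_indicator borel_measurable_const) (simp add: borel_compact)
      show "\<bar>C * indicator K' p\<bar> \<le> \<bar>C\<bar>" for p by (simp add: indicator_def)
    qed simp
    show "AE p in m. (\<lambda>n. q n p) \<longlonglongrightarrow> N p powr s * v' p"
    proof (intro AE_I2)
      fix p
      have "((\<lambda>h. (v (D h p) - v (D 0 p)) / h) \<longlongrightarrow> v' (D 0 p)) (at 0)"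
        using der[of p 0] by (simp add: has_field_derivative_iff)
      then have "(\<lambda>n. (v (D (\<tau> n) p) - v p) / \<tau> n) \<longlonglongrightarrow> v' p"
        using filterlim_compose[OF _ \<tau>_at] by fastforce
      then show "(\<lambda>n. q n p) \<longlonglongrightarrow> N p powr s * v' p"
        unfolding q_def by (intro tendsto_intros)
    qed
    fix n
    show "AE p in m. norm (q n p) \<le> N p powr s * (C * indicator K' p)"
    proof (intro AE_I2)
      fix p
      have "\<bar>(v (D (\<tau> n) p) - v p) / \<tau> n\<bar> \<le> C * indicator K' p"
      proof (cases "p \<in> K'")
        case True
        obtain z where "v (D (\<tau> n) p) - v (D 0 p) = (\<tau> n - 0) * v' (D z p)"
          using MVT2[OF \<tau>(1)[of n], of "\<lambda>t. v (D t p)" "\<lambda>t. v' (D t p)"] der by blast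
        then have "(v (D (\<tau> n) p) - v p) / \<tau> n = v' (D z p)" using \<tau>(1)[of n] by simp
        then show ?thesis using True C by simp
      next
        case False
        then have "v (D (\<tau> n) p) = 0" "v p = 0"
          using inK'[of "\<tau> n" p] inK'[of 0 p] \<tau>[of n] K(3) by auto
        then show ?thesis using False by simp
      qed
      then show "norm (q n p) \<le> N p powr s * (C * indicator K' p)"
        using mult_left_mono[of _ _ "N p powr s"] by (fastforce simp: q_def abs_mult)
    qed
    show "q n \<in> borel_measurable m" unfolding q_def by measurable
  qed measurable
  have "(LINT p|m. q n p) = (exp (- (Q + s) * \<tau> n) - 1) / \<tau> n * ?J" for n
  proof -
    have i1: "integrable m (\<lambda>p. N p powr s * v p)"
      by (rule integrable_weighted[OF _ B K(1-3)]) measurable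
    have i2: "integrable m (\<lambda>p. N p powr s * v (D (\<tau> n) p))"
    proof (rule integrable_weighted[OF _ B K' K'0])
      show "v (D (\<tau> n) p) = 0" if "p \<notin> K'" for p
        using inK'[of "\<tau> n" p] \<tau>[of n] K(3) that by auto
    qed measurable
    have "(LINT p|m. q n p) = (LINT p|m. (N p powr s * v (D (\<tau> n) p) - N p powr s * v p) / \<tau> n)"
      by (simp add: q_def right_diff_distrib)
    also have "\<dots> = ((LINT p|m. N p powr s * v (D (\<tau> n) p)) - ?J) / \<tau> n"
      using i1 i2 by simp
    finally show ?thesis by (simp add: weighted_integral_dilation algebra_simps)
  qed
  moreover have "(\<lambda>n. (exp (- (Q + s) * \<tau> n) - 1) / \<tau> n * ?J) \<longlonglongrightarrow> - (Q + s) * ?J"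
  proof -
    have "((\<lambda>t. exp (- (Q + s) * t)) has_real_derivative - (Q + s)) (at 0)"
      by (auto intro!: derivative_eq_intros)
    then have "((\<lambda>t. (exp (- (Q + s) * t) - 1) / t) \<longlongrightarrow> - (Q + s)) (at 0)"
      by (simp add: has_field_derivative_iff)
    from filterlim_compose[OF this \<tau>_at] show ?thesis by (intro tendsto_intros)
  qed
  ultimately show ?thesis using lim1 LIMSEQ_unique by simp
qed

section \<open>The weighted energy and its expansion\<close>

definition energy :: "real \<Rightarrow> (real^'n \<Rightarrow> complex) \<Rightarrow> real" where
  "energy s g = (LINT p|m. N p powr s * (cmod (g p))\<^sup>2)"

lemma integrable_energy:
  assumes "g \<in> test"
  shows "integrable m (\<lambda>p. N p powr s * (cmod (g p))\<^sup>2)"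
proof -
  obtain K where K: "smooth_on UNIV g" "compact K" "0 \<notin> K" "\<And>p. p \<notin> K \<Longrightarrow> g p = 0"
    using testE[OF assms] by blast
  have c: "continuous_on UNIV (\<lambda>p. (cmod (g p))\<^sup>2)"
    by (intro continuous_intros test_continuous assms)
  obtain C where C: "\<And>p. p \<in> K \<Longrightarrow> norm ((cmod (g p))\<^sup>2) \<le> C"
    using continuous_on_compact_bound[OF K(2) continuous_on_subset[OF c]] by blast
  have "\<bar>(cmod (g p))\<^sup>2\<bar> \<le> max C 0" for p
    using C[of p] K(4)[of p] by (cases "p \<in> K") (auto simp: le_max_iff_disj)
  then show ?thesis
    by (rule integrable_weighted[OF borel_measurable_continuous_onI[OF c] _ K(2,3)]) (simp add: K)
qed

lemma energy_nonneg: "energy s g \<ge> 0"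
  unfolding energy_def by (intro integral_nonneg_AE AE_I2) simp

lemma energy_dilation:
  assumes "g \<in> test"
  shows "energy s (\<lambda>p. g (D t p)) = exp (- (Q + s) * t) * energy s g"
proof -
  have "(\<lambda>p. (cmod (g p))\<^sup>2) \<in> borel_measurable borel"
    by (intro borel_measurable_continuous_onI continuous_intros test_continuous assms)
  then show ?thesis unfolding energy_def by (rule weighted_integral_dilation)
qed

lemma energy_eq_0:
  assumes g: "g \<in> test" and "energy s g = 0"
  shows "g = (\<lambda>p. 0)"
proof (rule ccontr)
  assume "\<not> ?thesis"
  then obtain p where p: "g p \<noteq> 0" by auto
  let ?U = "{p. g p \<noteq> 0}"
  have U: "open ?U"
    by (intro open_Collect_neq test_continuous g continuous_on_const)
  have "AE p in m. N p powr s * (cmod (g p))\<^sup>2 = 0"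
    using assms(2) integral_nonneg_eq_0_iff_AE[OF integrable_energy[OF g]] by (simp add: energy_def)
  then have "AE p in m. p \<notin> ?U"
    by eventually_elim (use test_0[OF g] in \<open>auto simp: N_eq_0\<close>)
  then have "emeasure m ?U = 0"
    using U by (subst (asm) AE_iff_null_sets[symmetric]) auto
  then show False using m_open[OF U] p by auto
qed

lemma cmod_add_power2: "(cmod (a + b))\<^sup>2 = (cmod a)\<^sup>2 + 2 * (a \<bullet> b) + (cmod b)\<^sup>2"
  by (simp add: power2_norm_eq_inner inner_add inner_commute)

text \<open>Integration by parts applied to \<open>|g|^2\<close> makes the left-hand side a
  quadratic polynomial in \<open>b\<close> with leading coefficient \<open>energy s g\<close> and
  vertex at \<open>b = c\<close>; the identity completes the square there.\<close>

lemma energy_euler: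
  assumes g: "g \<in> test" and c: "c = (Q + s) / 2"
  shows "energy s (\<lambda>p. euler g p + of_real b * g p) =
    (c - b)\<^sup>2 * energy s g + energy s (\<lambda>p. euler g p + of_real c * g p)"
proof -
  obtain K where K: "smooth_on UNIV g" "compact K" "0 \<notin> K" "\<And>p. p \<notin> K \<Longrightarrow> g p = 0"
    using testE[OF g] by blast
  have eg: "euler g \<in> test" using euler_test[OF g] .
  have cont: "continuous_on UNIV g" "continuous_on UNIV (euler g)"
    using g eg test_continuous by auto
  have ib: "(LINT p|m. N p powr s * (2 * (g p \<bullet> euler g p))) = - (Q + s) * (LINT p|m. N p powr s * (g p \<bullet> g p))"
  proof (rule integration_by_parts[OF _ _ _ K(2,3)])
    show "((\<lambda>t. g (D t p) \<bullet> g (D t p)) has_real_derivative 2 * (g (D t p) \<bullet> euler g (D t p))) (at t)" for t p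
      using bounded_bilinear.has_vector_derivative[OF bounded_bilinear_inner euler_derivative[OF K(1), of p t] euler_derivative[OF K(1), of p t]]
      by (simp add: has_real_derivative_iff_has_vector_derivative inner_commute)
  qed (use K cont in \<open>auto intro!: continuous_intros\<close>)
  have int2: "integrable m (\<lambda>p. N p powr s * (2 * (g p \<bullet> euler g p)))"
  proof -
    have "2 * (g p \<bullet> euler g p) = (cmod (1 * g p + 1 * euler g p))\<^sup>2 - (cmod (g p))\<^sup>2 - (cmod (euler g p))\<^sup>2" for p
      by (simp add: cmod_add_power2)
    then show ?thesis
      unfolding right_diff_distrib
      using integrable_energy[OF test_lincomb[OF g eg, of 1 1], of s] integrable_energy[OF g, of s] integrable_energy[OF eg, of s]
      by (simp add: right_diff_distrib)
  qed
  have *: "energy s (\<lambda>p. euler g p + of_real b * g p) = energy s (euler g) - 2 * b * c * energy s g + b\<^sup>2 * energy s g" for b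
  proof -
    have "energy s (\<lambda>p. euler g p + of_real b * g p) =
        (LINT p|m. N p powr s * (cmod (euler g p))\<^sup>2 + (b * (N p powr s * (2 * (g p \<bullet> euler g p))) + b\<^sup>2 * (N p powr s * (cmod (g p))\<^sup>2)))"
      unfolding energy_def
      by (intro Bochner_Integration.integral_cong refl)
        (simp add: cmod_add_power2 norm_mult power_mult_distrib inner_commute[of "euler g _"] algebra_simps
          flip: scaleR_conv_of_real)
    also have "\<dots> = energy s (euler g) + (b * (LINT p|m. N p powr s * (2 * (g p \<bullet> euler g p))) + b\<^sup>2 * energy s g)"
      unfolding energy_def
      using integrable_energy[OF g, of s] integrable_energy[OF eg, of s] int2 by simp
    also have "(LINT p|m. N p powr s * (2 * (g p \<bullet> euler g p))) = - 2 * c * energy s g"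
      unfolding ib energy_def by (simp add: c power2_norm_eq_inner)
    finally show ?thesis by simp
  qed
  show ?thesis unfolding *[of b] *[of c] by (simp add: power2_eq_square algebra_simps)
qed

lemma euler_eigenfunction_0:
  assumes g: "g \<in> test" and eq: "\<And>p. euler g p + of_real c * g p = 0"
  shows "g = (\<lambda>p. 0)"
proof
  fix p
  obtain K where K: "smooth_on UNIV g" "compact K" "0 \<notin> K" "\<And>p. p \<notin> K \<Longrightarrow> g p = 0"
    using testE[OF g] by blast
  show "g p = 0"
  proof (cases "p = 0")
    case False
    have "((\<lambda>t. exp (of_real (c * t)) * g (D t p)) has_vector_derivative 0) (at t)" for t
    proof -
      have "((\<lambda>t. exp (of_real (c * t)) :: complex) has_vector_derivative of_real c * exp (of_real (c * t))) (at t)"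
        unfolding exp_of_real of_real_mult[symmetric]
        by (rule has_vector_derivative_of_real)
          (auto intro!: derivative_eq_intros simp flip: has_real_derivative_iff_has_vector_derivative)
      from has_vector_derivative_mult[OF this euler_derivative[OF K(1), of p t]]
      have "((\<lambda>t. exp (of_real (c * t)) * g (D t p)) has_vector_derivative
        exp (of_real (c * t)) * (euler g (D t p) + of_real c * g (D t p))) (at t)"
        by (simp add: algebra_simps)
      then show ?thesis by (simp add: eq)
    qed
    then obtain k where k: "\<And>t. exp (of_real (c * t)) * g (D t p) = k"
      using has_vector_derivative_zero_constant[of UNIV "\<lambda>t. exp (of_real (c * t)) * g (D t p)"] by auto
    obtain B where B: "\<And>q. q \<in> K \<Longrightarrow> norm (N q) \<le> B"
      using continuous_on_compact_bound[OF K(2) continuous_on_subset[OF N_cont]] by blast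
    \<comment> \<open>The time at which the orbit of \<open>p\<close> has quasi-norm
      \<open>|B| + 1\<close>, beyond the bound valid on \<open>K\<close>.\<close>
    define t where "t = ln ((\<bar>B\<bar> + 1) / N p)"
    have "N (D t p) = \<bar>B\<bar> + 1" using N_pos[OF False] by (simp add: t_def)
    then have "D t p \<notin> K" using B[of "D t p"] by auto
    then show ?thesis using k[of t] k[of 0] K(4) by simp
  qed (use test_0[OF g] in simp)
qed

end

section \<open>Higher order identities\<close>

context dilation_space
begin

lemma energy_falling_step:
  assumes f: "f \<in> test" and c: "c = (Q + s) / 2"
  shows "energy s (falling (Suc j) f) = (c + real j)\<^sup>2 * energy s (falling j f)
    + energy s (\<lambda>p. euler (falling j f) p + of_real c * falling j f p)"
  using energy_euler[OF falling_test[OF f] c, where b = "- real j"] by simp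

text \<open>Factors are peeled off from the outermost one, \<open>E - (k - 1)\<close>, inwards.
  Since the weight exponent \<open>s\<close> never changes, \<open>c\<close> is the same at every
  step, and removing \<open>E - i\<close> contributes \<open>(c + i)^2\<close>.\<close>

lemma energy_falling:
  assumes f: "f \<in> test" and c: "c = (Q + s) / 2" and "n \<le> k"
  shows "energy s (falling k f) =
    (\<Prod>j<n. (c + real (k - 1 - j))\<^sup>2) * energy s (falling (k - n) f)
    + (\<Sum>l<n. (\<Prod>j<l. (c + real (k - 1 - j))\<^sup>2) *
        energy s (\<lambda>p. euler (falling (k - l - 1) f) p + of_real c * falling (k - l - 1) f p))"
  using \<open>n \<le> k\<close>
proof (induction n)
  case (Suc n)
  have "energy s (falling (k - n) f) = (c + real (k - 1 - n))\<^sup>2 * energy s (falling (k - Suc n) f)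
    + energy s (\<lambda>p. euler (falling (k - n - 1) f) p + of_real c * falling (k - n - 1) f p)"
    using energy_falling_step[OF f c, of "k - Suc n"] Suc.prems by (simp add: Suc_diff_Suc)
  then show ?case using Suc by (simp add: algebra_simps)
qed simp

definition hardy_factor :: "real \<Rightarrow> nat \<Rightarrow> real" where
  "hardy_factor \<alpha> j = (Q - 2) / 2 - (\<alpha> + real j)"

text \<open>The \<open>l\<close>-th defect of the telescoping, for the weight
  \<open>s = - 2 (\<alpha> + k)\<close> and its optimal shift
  \<open>c = (Q + s)/2 = Q/2 - \<alpha> - k\<close>.\<close>

definition hardy_remainder :: "real \<Rightarrow> nat \<Rightarrow> (real^'n \<Rightarrow> complex) \<Rightarrow> nat \<Rightarrow> real" where
  "hardy_remainder \<alpha> k f l = energy (2 * (- \<alpha> - real k)) (\<lambda>p. euler (falling (k - l - 1) f) p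
     + of_real (Q / 2 - \<alpha> - real k) * falling (k - l - 1) f p)"

lemma L2_norm_wrt_power2:
  assumes "\<And>p. cmod (F p) = N p powr e * cmod (g p)"
  shows "(L2_norm_wrt m F)\<^sup>2 = energy (2 * e) g"
proof -
  have "(N p powr e)\<^sup>2 = N p powr (2 * e)" for p
    by (simp add: power2_eq_square flip: powr_add)
  then have "(LINT p|m. (cmod (F p))\<^sup>2) = energy (2 * e) g"
    by (simp add: energy_def assms power_mult_distrib)
  then show ?thesis by (simp add: L2_norm_wrt_def energy_nonneg)
qed

lemma L2_norm_wrt_nonneg: "L2_norm_wrt m F \<ge> 0"
  by (simp add: L2_norm_wrt_def integral_nonneg_AE)

text \<open>Holds at the origin as well: \<open>0 powr a\<close> is 0 and division by 0 gives 0, so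
  both sides vanish.\<close>

lemma N_powr_cancel: "1 / N p powr a * N p powr - b = N p powr (- a - b)"
  by (simp add: powr_diff powr_minus_divide)

lemma L2_lhs:
  "(L2_norm_wrt m (\<lambda>p. f p / complex_of_real (N p powr (real k + \<alpha>))))\<^sup>2 = energy (2 * (- \<alpha> - real k)) f"
proof (rule L2_norm_wrt_power2)
  have "- \<alpha> - real k = - (real k + \<alpha>)" by simp
  then show "cmod (f p / complex_of_real (N p powr (real k + \<alpha>))) = N p powr (- \<alpha> - real k) * cmod (f p)" for p
    by (simp only: powr_minus_divide) (simp add: norm_divide)
qed

lemma L2_radial:
  assumes "f \<in> test"
  shows "(L2_norm_wrt m (\<lambda>p. 1 / complex_of_real (N p powr \<alpha>) * (radial ^^ k) f p))\<^sup>2 =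
    energy (2 * (- \<alpha> - real k)) (falling k f)"
proof (rule L2_norm_wrt_power2)
  show "cmod (1 / complex_of_real (N p powr \<alpha>) * (radial ^^ k) f p) =
      N p powr (- \<alpha> - real k) * cmod (falling k f p)" for p
    unfolding radial_power[OF assms(1)] N_powr_cancel[symmetric] by (simp add: norm_mult norm_divide)
qed

lemma L2_remainder:
  assumes f: "f \<in> test" and "l < k"
  shows "(L2_norm_wrt m (\<lambda>p. 1 / complex_of_real (N p powr (real l + \<alpha>)) * (radial ^^ (k - l)) f p
      + complex_of_real ((Q - 2 * (real l + 1 + \<alpha>)) / (2 * N p powr (real l + 1 + \<alpha>))) * (radial ^^ (k - l - 1)) f p))\<^sup>2 =
    hardy_remainder \<alpha> k f l"
  unfolding hardy_remainder_def
proof (rule L2_norm_wrt_power2)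
  fix p
  obtain j where j: "k = Suc (l + j)" using \<open>l < k\<close> less_imp_Suc_add by blast
  define w where "w = N p powr (- \<alpha> - real k)"
  have "- (real l + \<alpha>) - real (Suc j) = - \<alpha> - real k" "- (real l + 1 + \<alpha>) - real j = - \<alpha> - real k"
    by (simp_all add: j)
  then have w: "1 / N p powr (real l + \<alpha>) * N p powr - real (Suc j) = w"
    "1 / N p powr (real l + 1 + \<alpha>) * N p powr - real j = w"
    by (simp_all only: N_powr_cancel w_def)
  have kl: "k - l = Suc j" "k - l - 1 = j" using j by simp_all
  have "1 / complex_of_real (N p powr (real l + \<alpha>)) * (radial ^^ (k - l)) f p
      + complex_of_real ((Q - 2 * (real l + 1 + \<alpha>)) / (2 * N p powr (real l + 1 + \<alpha>))) * (radial ^^ (k - l - 1)) f p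
    = complex_of_real (1 / N p powr (real l + \<alpha>) * N p powr - real (Suc j)) * falling (Suc j) f p
      + complex_of_real ((Q - 2 * (real l + 1 + \<alpha>)) / 2) * (complex_of_real (1 / N p powr (real l + 1 + \<alpha>) * N p powr - real j) * falling j f p)"
    unfolding kl radial_power[OF f] by (simp del: falling.simps)
  \<comment> \<open>Unfolding \<open>falling (Suc j)\<close> subtracts \<open>j\<close> from
    \<open>Q/2 - (l + 1 + \<alpha>)\<close>, and \<open>k = l + j + 1\<close> turns the result into
    \<open>Q/2 - \<alpha> - k\<close>, the same for all \<open>l\<close>.\<close>
  also have "\<dots> = complex_of_real w * (euler (falling j f) p
      + of_real (Q / 2 - \<alpha> - real k) * falling j f p)"
    unfolding w by (simp add: j algebra_simps add_divide_distrib diff_divide_distrib)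
  finally show "cmod (1 / complex_of_real (N p powr (real l + \<alpha>)) * (radial ^^ (k - l)) f p
      + complex_of_real ((Q - 2 * (real l + 1 + \<alpha>)) / (2 * N p powr (real l + 1 + \<alpha>))) * (radial ^^ (k - l - 1)) f p) =
    N p powr (- \<alpha> - real k) * cmod (euler (falling (k - l - 1) f) p
      + of_real (Q / 2 - \<alpha> - real k) * falling (k - l - 1) f p)"
    using j by (simp add: norm_mult w_def)
qed

text \<open>The complete telescoping, \<open>n = k\<close>: for
  \<open>c = Q/2 - \<alpha> - k\<close> the factor \<open>c + (k - 1 - j)\<close> is
  \<open>(Q - 2)/2 - (\<alpha> + j)\<close>, so the order of peeling is the order of the
  product.\<close>

lemma energy_identity:
  assumes f: "f \<in> test"
  shows "energy (2 * (- \<alpha> - real k)) (falling k f) =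
    (\<Prod>j<k. (hardy_factor \<alpha> j)\<^sup>2) * energy (2 * (- \<alpha> - real k)) f
    + (\<Sum>l<k. (\<Prod>j<l. (hardy_factor \<alpha> j)\<^sup>2) * hardy_remainder \<alpha> k f l)"
proof -
  have c: "Q / 2 - \<alpha> - real k = (Q + 2 * (- \<alpha> - real k)) / 2" by simp
  have shift: "(\<Prod>j<l. (Q / 2 - \<alpha> - real k + real (k - 1 - j))\<^sup>2) = (\<Prod>j<l. (hardy_factor \<alpha> j)\<^sup>2)" if "l \<le> k" for l
  proof (intro prod.cong refl)
    fix j assume "j \<in> {..<l}"
    then have "real (k - 1 - j) = real k - 1 - real j" using that by (simp add: of_nat_diff)
    then show "(Q / 2 - \<alpha> - real k + real (k - 1 - j))\<^sup>2 = (hardy_factor \<alpha> j)\<^sup>2"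
      by (simp add: hardy_factor_def field_simps)
  qed
  have 1: "(\<Sum>l<k. (\<Prod>j<l. (Q / 2 - \<alpha> - real k + real (k - 1 - j))\<^sup>2) * hardy_remainder \<alpha> k f l) =
      (\<Sum>l<k. (\<Prod>j<l. (hardy_factor \<alpha> j)\<^sup>2) * hardy_remainder \<alpha> k f l)"
    by (intro sum.cong refl) (simp only: shift lessThan_iff less_imp_le)
  have "energy (2 * (- \<alpha> - real k)) (falling k f) =
      (\<Prod>j<k. (Q / 2 - \<alpha> - real k + real (k - 1 - j))\<^sup>2) * energy (2 * (- \<alpha> - real k)) (falling (k - k) f)
      + (\<Sum>l<k. (\<Prod>j<l. (Q / 2 - \<alpha> - real k + real (k - 1 - j))\<^sup>2) * hardy_remainder \<alpha> k f l)"
    using energy_falling[OF f c order_refl[of k]] unfolding hardy_remainder_def .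
  then show ?thesis unfolding shift[OF order_refl] 1 diff_self_eq_0 falling.simps .
qed

lemma atLeast0_pred: "k \<ge> 1 \<Longrightarrow> {0..k - 1} = {..<k}" for k :: nat
  by auto

theorem radial_identity:
  assumes f: "f \<in> test" and k: "k \<ge> 1"
  shows "(L2_norm_wrt m (\<lambda>x. 1 / complex_of_real (N x powr \<alpha>) * (radial ^^ k) f x))\<^sup>2 =
          (\<Prod>j=0..k-1. ((Q - 2) / 2 - (\<alpha> + real j))\<^sup>2) *
            (L2_norm_wrt m (\<lambda>x. f x / complex_of_real (N x powr (real k + \<alpha>))))\<^sup>2
          + (\<Sum>l=1..k-1. (\<Prod>j=0..l-1. ((Q - 2) / 2 - (\<alpha> + real j))\<^sup>2) *
              (L2_norm_wrt m (\<lambda>x.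
                 1 / complex_of_real (N x powr (real l + \<alpha>)) * (radial ^^ (k - l)) f x
                 + complex_of_real ((Q - 2 * (real l + 1 + \<alpha>)) / (2 * N x powr (real l + 1 + \<alpha>)))
                     * (radial ^^ (k - l - 1)) f x))\<^sup>2)
          + (L2_norm_wrt m (\<lambda>x.
               1 / complex_of_real (N x powr \<alpha>) * (radial ^^ k) f x
               + complex_of_real ((Q - 2 - 2 * \<alpha>) / (2 * N x powr (1 + \<alpha>)))
                   * (radial ^^ (k - 1)) f x))\<^sup>2"
proof -
  \<comment> \<open>The remainder with \<open>l = 0\<close> has an empty product in front and is the
    separate last summand of the identity.\<close>
  have "{..<k} = insert 0 {1..k-1}" using k by auto
  then have 1: "(\<Sum>l<k. (\<Prod>j<l. (hardy_factor \<alpha> j)\<^sup>2) * hardy_remainder \<alpha> k f l) =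
      hardy_remainder \<alpha> k f 0 + (\<Sum>l=1..k-1. (\<Prod>j<l. (hardy_factor \<alpha> j)\<^sup>2) * hardy_remainder \<alpha> k f l)"
    by simp
  have 2: "(\<Sum>l=1..k-1. (\<Prod>j=0..l-1. ((Q - 2) / 2 - (\<alpha> + real j))\<^sup>2) *
              (L2_norm_wrt m (\<lambda>x.
                 1 / complex_of_real (N x powr (real l + \<alpha>)) * (radial ^^ (k - l)) f x
                 + complex_of_real ((Q - 2 * (real l + 1 + \<alpha>)) / (2 * N x powr (real l + 1 + \<alpha>)))
                     * (radial ^^ (k - l - 1)) f x))\<^sup>2) =
      (\<Sum>l=1..k-1. (\<Prod>j<l. (hardy_factor \<alpha> j)\<^sup>2) * hardy_remainder \<alpha> k f l)"
  proof (intro sum.cong refl)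
    fix l assume "l \<in> {1..k-1}"
    then have l: "1 \<le> l" "l < k" using k by auto
    show "(\<Prod>j=0..l-1. ((Q - 2) / 2 - (\<alpha> + real j))\<^sup>2) *
              (L2_norm_wrt m (\<lambda>x.
                 1 / complex_of_real (N x powr (real l + \<alpha>)) * (radial ^^ (k - l)) f x
                 + complex_of_real ((Q - 2 * (real l + 1 + \<alpha>)) / (2 * N x powr (real l + 1 + \<alpha>)))
                     * (radial ^^ (k - l - 1)) f x))\<^sup>2 =
      (\<Prod>j<l. (hardy_factor \<alpha> j)\<^sup>2) * hardy_remainder \<alpha> k f l"
      unfolding L2_remainder[OF f l(2)] atLeast0_pred[OF l(1)] hardy_factor_def ..
  qed
  have "Q - 2 * (0 + 1 + \<alpha>) = Q - 2 - 2 * \<alpha>" by simp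
  then have 3: "(L2_norm_wrt m (\<lambda>x.
               1 / complex_of_real (N x powr \<alpha>) * (radial ^^ k) f x
               + complex_of_real ((Q - 2 - 2 * \<alpha>) / (2 * N x powr (1 + \<alpha>)))
                   * (radial ^^ (k - 1)) f x))\<^sup>2 = hardy_remainder \<alpha> k f 0"
    using L2_remainder[OF f, of 0 k \<alpha>] k by (simp only: of_nat_0 add_0 diff_zero)
  show ?thesis
    unfolding 2 3 L2_lhs L2_radial[OF f] energy_identity[OF f] 1 atLeast0_pred[OF k]
    by (simp add: hardy_factor_def)
qed

lemma hardy_inequality:
  assumes f: "f \<in> test" and k: "k \<ge> 1" and nz: "(\<Prod>j=0..k-1. \<bar>(Q - 2) / 2 - (\<alpha> + real j)\<bar>) \<noteq> 0"
  defines "c \<equiv> inverse (\<Prod>j=0..k-1. \<bar>(Q - 2) / 2 - (\<alpha> + real j)\<bar>)"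
    and "lhs \<equiv> L2_norm_wrt m (\<lambda>x. f x / complex_of_real (N x powr (real k + \<alpha>)))"
    and "rhs \<equiv> L2_norm_wrt m (\<lambda>x. 1 / complex_of_real (N x powr \<alpha>) * (radial ^^ k) f x)"
  shows "lhs \<le> c * rhs" and "lhs = c * rhs \<Longrightarrow> f = (\<lambda>x. 0)"
proof -
  define P where "P = (\<Prod>j<k. \<bar>hardy_factor \<alpha> j\<bar>)"
  define e where "e l = (\<Prod>j<l. (hardy_factor \<alpha> j)\<^sup>2)" for l
  have P_eq: "(\<Prod>j=0..k-1. \<bar>(Q - 2) / 2 - (\<alpha> + real j)\<bar>) = P"
    unfolding P_def hardy_factor_def atLeast0_pred[OF k] ..
  have P: "P > 0" using nz unfolding P_eq by (simp add: P_def prod_nonneg less_le)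
  have c: "c = 1 / P" unfolding c_def P_eq by (simp add: inverse_eq_divide)
  have P2: "e k = P\<^sup>2" by (simp add: e_def P_def prod_power_distrib)
  have id: "rhs\<^sup>2 = P\<^sup>2 * lhs\<^sup>2 + (\<Sum>l<k. e l * hardy_remainder \<alpha> k f l)"
    unfolding lhs_def rhs_def L2_lhs L2_radial[OF f] energy_identity[OF f] P2[symmetric] e_def ..
  have b0: "hardy_remainder \<alpha> k f l \<ge> 0" "e l \<ge> 0" for l
    by (simp_all add: hardy_remainder_def energy_nonneg e_def prod_nonneg)
  have rhs0: "rhs \<ge> 0" by (simp add: rhs_def L2_norm_wrt_nonneg)
  have "(P * lhs)\<^sup>2 \<le> rhs\<^sup>2"
    unfolding id power_mult_distrib using b0 by (simp add: sum_nonneg)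
  then have "P * lhs \<le> rhs" using rhs0 by (rule power2_le_imp_le)
  then show "lhs \<le> c * rhs" using P by (simp add: c field_simps)
  assume "lhs = c * rhs"
  then have "rhs = P * lhs" using P by (simp add: c)
  then have "(\<Sum>l<k. e l * hardy_remainder \<alpha> k f l) = 0" using id by (simp add: power_mult_distrib)
  then have "\<forall>l<k. e l * hardy_remainder \<alpha> k f l = 0"
    using b0 by (subst (asm) sum_nonneg_eq_0_iff) auto
  \<comment> \<open>The innermost remainder involves \<open>falling 0 f\<close>, that is
    \<open>f\<close> itself, so its vanishing is a first-order equation for
    \<open>f\<close>.\<close>
  then have "e (k - 1) * hardy_remainder \<alpha> k f (k - 1) = 0"
    using k by simp
  moreover have "e (k - 1) \<noteq> 0"
  proof -
    have "hardy_factor \<alpha> j \<noteq> 0" if "j < k" for j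
    proof
      assume "hardy_factor \<alpha> j = 0"
      then have "P = 0" using that by (auto simp: P_def)
      then show False using P by simp
    qed
    then show ?thesis by (simp add: e_def)
  qed
  ultimately have "hardy_remainder \<alpha> k f (k - 1) = 0" by simp
  then have "energy (2 * (- \<alpha> - real k)) (\<lambda>p. 1 * euler f p + of_real (Q / 2 - \<alpha> - real k) * f p) = 0"
    using k by (simp add: hardy_remainder_def)
  then have "(\<lambda>p. 1 * euler f p + of_real (Q / 2 - \<alpha> - real k) * f p) = (\<lambda>p. 0)"
    by (rule energy_eq_0[OF test_lincomb[OF euler_test[OF f] f]])
  then have "euler f p + of_real (Q / 2 - \<alpha> - real k) * f p = 0" for p
    by (metis mult_1)
  then show "f = (\<lambda>x. 0)" by (rule euler_eigenfunction_0[OF f])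
qed

end

section \<open>Sharpness\<close>

definition real_deriv :: "(real \<Rightarrow> real) \<Rightarrow> real \<Rightarrow> real" where
  "real_deriv \<psi> t = frechet_derivative \<psi> (at t) 1"

lemma has_real_derivative_real_deriv:
  assumes "smooth_on UNIV \<psi>"
  shows "(\<psi> has_real_derivative real_deriv \<psi> t) (at t)"
proof -
  have d: "(\<psi> has_derivative frechet_derivative \<psi> (at t)) (at t)"
    using smooth_on_has_derivative[OF assms] by simp
  have "frechet_derivative \<psi> (at t) = (*) (real_deriv \<psi> t)"
  proof
    show "frechet_derivative \<psi> (at t) v = real_deriv \<psi> t * v" for v
      using linear_scale[OF has_derivative_linear[OF d], of v 1] by (simp add: real_deriv_def)
  qed
  then show ?thesis using d by (simp add: has_field_derivative_def)
qed

lemma smooth_on_real_deriv: "smooth_on UNIV \<psi> \<Longrightarrow> smooth_on UNIV (real_deriv \<psi>)"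
  unfolding real_deriv_def[abs_def] by (rule smooth_on_frechet_derivative)

lemma real_deriv_locally_const:
  assumes "open S" "t \<in> S" "\<And>u. u \<in> S \<Longrightarrow> \<psi> u = c"
  shows "real_deriv \<psi> t = 0"
proof -
  have "(\<psi> has_derivative (\<lambda>v. 0)) (at t)"
    by (rule has_derivative_transform_within_open[OF has_derivative_const assms(1,2)]) (simp add: assms(3))
  then show ?thesis by (simp add: real_deriv_def flip: frechet_derivative_at)
qed

definition profile :: "(real \<Rightarrow> real) \<Rightarrow> bool" where
  "profile \<psi> \<longleftrightarrow> smooth_on UNIV \<psi> \<and> (\<exists>a. \<forall>t. \<bar>t\<bar> > a \<longrightarrow> \<psi> t = 0)"

lemma profile_lincomb:
  assumes "profile \<psi>" "profile \<phi>"
  shows "profile (\<lambda>t. a * \<psi> t + b * \<phi> t)"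
proof -
  obtain r r' where r: "\<And>t. \<bar>t\<bar> > r \<Longrightarrow> \<psi> t = 0" "\<And>t. \<bar>t\<bar> > r' \<Longrightarrow> \<phi> t = 0"
    using assms unfolding profile_def by blast
  have "\<forall>t. \<bar>t\<bar> > max r r' \<longrightarrow> a * \<psi> t + b * \<phi> t = 0" using r by simp
  moreover have "smooth_on UNIV (\<lambda>t. a * \<psi> t + b * \<phi> t)"
    using assms unfolding profile_def
    by (intro smooth_on_add smooth_on_bounded_linear[OF bounded_linear_mult_right]) auto
  ultimately show ?thesis unfolding profile_def by blast
qed

lemma smooth_on_shift:
  fixes \<psi> :: "real \<Rightarrow> real"
  assumes "smooth_on UNIV \<psi>"
  shows "smooth_on UNIV (\<lambda>t. \<psi> (t + a))"
  by (rule smooth_on_compose[OF open_UNIV open_UNIV assms])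
    (auto intro!: smooth_on_add smooth_on_const smooth_on_linear[OF bounded_linear_ident])

lemma profile_shift:
  assumes "profile \<psi>"
  shows "profile (\<lambda>t. \<psi> (t + a))"
proof -
  obtain r where r: "\<And>t. \<bar>t\<bar> > r \<Longrightarrow> \<psi> t = 0" using assms unfolding profile_def by blast
  have "\<forall>t. \<bar>t\<bar> > r + \<bar>a\<bar> \<longrightarrow> \<psi> (t + a) = 0" using r by (auto simp: abs_if split: if_splits)
  then show ?thesis using assms smooth_on_shift unfolding profile_def by blast
qed

lemma profile_real_deriv:
  assumes "profile \<psi>"
  shows "profile (real_deriv \<psi>)"
proof -
  obtain r where r: "\<And>t. \<bar>t\<bar> > r \<Longrightarrow> \<psi> t = 0" using assms unfolding profile_def by blast
  have "real_deriv \<psi> t = 0" if "\<bar>t\<bar> > r" for t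
    by (rule real_deriv_locally_const[of "{t. \<bar>t\<bar> > r}" _ _ 0])
      (use that r in \<open>auto intro!: open_Collect_less continuous_intros\<close>)
  then show ?thesis using assms smooth_on_real_deriv unfolding profile_def by blast
qed

lemma profile_0: "profile (\<lambda>t. 0)"
  by (simp add: profile_def smooth_on_const)

lemma profile_step_deriv: "profile (real_deriv smooth_step)"
proof -
  have "real_deriv smooth_step t = 0" if "\<bar>t\<bar> > 1" for t
  proof (cases "t < 0")
    case True
    show ?thesis
      by (rule real_deriv_locally_const[of "{..<0}" _ _ 0]) (use True in \<open>auto simp: smooth_step_eq_0\<close>)
  next
    case False
    show ?thesis
      by (rule real_deriv_locally_const[of "{1<..}" _ _ 1]) (use False that in \<open>auto simp: smooth_step_eq_1\<close>)
  qed
  then show ?thesis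
    using smooth_on_real_deriv[OF smooth_on_smooth_step] unfolding profile_def by blast
qed

text \<open>For \<open>n \<ge> 1\<close> it rises on \<open>[-n, 1 - n]\<close>, equals 1 on
  \<open>[1 - n, 0]\<close> and falls on \<open>[0, 1]\<close>. As a difference of two translates of
  one function, it has a derivative of the same kind, now built from a compactly supported
  function.\<close>

definition plateau :: "nat \<Rightarrow> real \<Rightarrow> real" where
  "plateau n t = smooth_step (t + real n) - smooth_step t"

lemma profile_plateau: "profile (plateau n)"
proof -
  have "\<forall>t. \<bar>t\<bar> > real n + 1 \<longrightarrow> plateau n t = 0"
    by (auto simp: plateau_def abs_if smooth_step_eq_0 smooth_step_eq_1 split: if_splits)
  moreover have "smooth_on UNIV (plateau n)"
    unfolding plateau_def[abs_def]
    by (intro smooth_on_diff smooth_on_shift smooth_on_smooth_step) simp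
  ultimately show ?thesis unfolding profile_def by blast
qed

lemma plateau_Suc: "plateau (Suc n) t = plateau n t + plateau 1 (t + real n)"
  by (simp add: plateau_def add_ac)

lemma plateau_nonneg: "plateau n t \<ge> 0"
  by (cases "t \<le> 0"; cases n)
    (auto simp: plateau_def smooth_step_eq_0 smooth_step_eq_1 smooth_step_nonneg smooth_step_le_1)

lemma weighted_square_sum: "(a + b)\<^sup>2 \<le> (1 + \<epsilon>) * a\<^sup>2 + (1 + 1 / \<epsilon>) * b\<^sup>2" if "\<epsilon> > 0" for a b \<epsilon> :: real
proof -
  have "0 \<le> (\<epsilon> * a - b)\<^sup>2 / \<epsilon>" using that by simp
  then show ?thesis using that by (simp add: power2_eq_square field_simps)
qed

context dilation_space
begin

text \<open>In the half space where the \<open>i\<close>-th coordinate is positive, \<open>exp height\<close> is a smooth function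
  that is homogeneous of degree one; the quasi-norm itself is only continuous.\<close>

definition height :: "'n \<Rightarrow> real^'n \<Rightarrow> real" where
  "height i p = ln (p $ i) / \<nu> i"

text \<open>The squared Euclidean norm of the point where the dilation orbit of \<open>p\<close>
  crosses the hyperplane \<open>p $ i = 1\<close>.\<close>

definition angular :: "'n \<Rightarrow> real^'n \<Rightarrow> real" where
  "angular i p = (\<Sum>j\<in>UNIV. (p $ j)\<^sup>2 * (p $ i) powr (- 2 * \<nu> j / \<nu> i))"

text \<open>Homogeneous of degree \<open>\<beta>\<close> and supported in the sector where
  \<open>angular\<close> is at most 3. The bound 3 leaves room around the positive
  \<open>i\<close>-th axis, where \<open>angular\<close> is 1 and the step has already reached
  1.\<close>

definition cutoff :: "'n \<Rightarrow> real \<Rightarrow> real^'n \<Rightarrow> real" where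
  "cutoff i \<beta> p = (if p $ i > 0 then (p $ i) powr (\<beta> / \<nu> i) * smooth_step (3 - angular i p) else 0)"

definition bump :: "'n \<Rightarrow> real \<Rightarrow> (real \<Rightarrow> real) \<Rightarrow> real^'n \<Rightarrow> complex" where
  "bump i \<beta> \<psi> p = complex_of_real (\<psi> (height i p) * cutoff i \<beta> p)"

lemma height_D: "p $ i > 0 \<Longrightarrow> height i (D t p) = height i p + t"
  using \<nu>_pos[of i] by (simp add: height_def ln_mult field_simps)

lemma angular_D:
  assumes "p $ i > 0"
  shows "angular i (D t p) = angular i p"
  unfolding angular_def
proof (intro sum.cong refl)
  fix j
  have "(exp (\<nu> j * t))\<^sup>2 * exp (\<nu> i * t) powr (- 2 * \<nu> j / \<nu> i) = 1"
    using \<nu>_pos[of i] by (simp add: powr_def power2_eq_square exp_add[symmetric])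
  then have "(exp (\<nu> j * t))\<^sup>2 * exp (\<nu> i * t) powr (- 2 * \<nu> j / \<nu> i) * ((p $ j)\<^sup>2 * (p $ i) powr (- 2 * \<nu> j / \<nu> i))
      = (p $ j)\<^sup>2 * (p $ i) powr (- 2 * \<nu> j / \<nu> i)"
    by (simp only: mult_1)
  then show "(D t p $ j)\<^sup>2 * (D t p $ i) powr (- 2 * \<nu> j / \<nu> i) = (p $ j)\<^sup>2 * (p $ i) powr (- 2 * \<nu> j / \<nu> i)"
    using assms by (simp add: powr_mult power_mult_distrib mult_ac)
qed

lemma cutoff_D: "cutoff i \<beta> (D t p) = exp (\<beta> * t) * cutoff i \<beta> p"
  using \<nu>_pos[of i] by (simp add: cutoff_def angular_D powr_mult zero_less_mult_iff) (simp add: powr_def)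

lemma cutoff_nonneg: "cutoff i \<beta> p \<ge> 0"
  by (simp add: cutoff_def smooth_step_nonneg)

lemma bump_D: "bump i \<beta> \<psi> (D t p) = complex_of_real (exp (\<beta> * t)) * bump i \<beta> (\<lambda>u. \<psi> (u + t)) p"
  by (cases "p $ i > 0") (simp_all add: bump_def cutoff_D height_D, simp_all add: cutoff_def)

text \<open>Smoothness is checked on two open sets: in the half space all ingredients are smooth,
  and outside the compact \<open>K\<close> the function is 0. As \<open>K\<close> lies inside the
  half space, these sets cover everything, including the boundary \<open>p $ i = 0\<close>.\<close>

lemma bump_test:
  assumes "profile \<psi>"
  shows "bump i \<beta> \<psi> \<in> test"
proof -
  obtain a where a: "\<And>t. \<bar>t\<bar> > a \<Longrightarrow> \<psi> t = 0" and \<psi>: "smooth_on UNIV \<psi>"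
    using assms unfolding profile_def by blast
  define H where "H = {p :: real^'n. p $ i > 0}"
  have H: "open H" unfolding H_def by (intro open_Collect_less continuous_intros)
  \<comment> \<open>A bounded slice of the hyperplane \<open>p $ i = 1\<close>. Sweeping it by
    \<open>D t\<close> with \<open>|t| \<le> a\<close> covers the support, because the orbit of
    \<open>p\<close> meets the hyperplane at \<open>D (- height i p) p\<close>.\<close>
  define K0 where "K0 = {p :: real^'n. p $ i = 1 \<and> (\<Sum>j\<in>UNIV. (p $ j)\<^sup>2) \<le> 3}"
  have "closed K0"
    unfolding K0_def by (intro closed_Collect_conj closed_Collect_eq closed_Collect_le continuous_intros)
  moreover have "bounded K0"
  proof (rule boundedI)
    fix p assume "p \<in> K0"
    then have "(norm p)\<^sup>2 \<le> 3" by (simp add: K0_def norm_vec_def L2_set_def sum_nonneg)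
    then show "norm p \<le> sqrt 3" by (simp add: real_le_rsqrt)
  qed
  ultimately have K0: "compact K0" by (simp add: compact_eq_bounded_closed)
  define K where "K = (\<lambda>(t, p). D t p) ` ({- a..a} \<times> K0)"
  have K: "compact K"
    unfolding K_def case_prod_unfold
    by (intro compact_continuous_image compact_Times K0 compact_Icc continuous_D continuous_intros)
  have KH: "K \<subseteq> H" by (auto simp: K_def K0_def H_def)
  have vanish: "bump i \<beta> \<psi> p = 0" if "p \<notin> K" for p
  proof (rule ccontr)
    assume nz: "bump i \<beta> \<psi> p \<noteq> 0"
    then have p: "p $ i > 0" "\<psi> (height i p) \<noteq> 0" "smooth_step (3 - angular i p) \<noteq> 0"
      by (auto simp: bump_def cutoff_def split: if_splits)
    let ?h = "height i p" and ?q = "D (- height i p) p"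
    have "\<bar>?h\<bar> \<le> a" using a[of ?h] p by force
    moreover have "angular i p \<le> 3" using p(3) smooth_step_eq_0[of "3 - angular i p"] by force
    moreover have "?q $ i = 1"
      using p(1) \<nu>_pos[of i] by (simp add: height_def exp_minus)
    moreover have "(\<Sum>j\<in>UNIV. (?q $ j)\<^sup>2) = angular i ?q"
      unfolding angular_def using \<open>?q $ i = 1\<close> by simp
    ultimately have "?q \<in> K0" "?h \<in> {- a..a}"
      using angular_D[OF p(1)] by (auto simp: K0_def)
    then have "p \<in> K" unfolding K_def by (intro image_eqI[of _ _ "(?h, ?q)"]) auto
    then show False using that by simp
  qed
  have lin: "smooth_on H (\<lambda>p. p $ j)" for j
    by (intro smooth_on_linear bounded_linear_vec_nth H)
  have pw: "smooth_on H (\<lambda>p. (p $ i) powr e)" for e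
    by (rule smooth_on_compose[OF H _ smooth_on_powr lin]) (auto simp: H_def)
  have "smooth_on H (angular i)"
    unfolding angular_def[abs_def] power2_eq_square
    by (intro smooth_on_sum smooth_on_mult H lin pw)
  then have "smooth_on H (\<lambda>p. smooth_step (3 - angular i p))"
    by (intro smooth_on_compose[OF H open_UNIV smooth_on_smooth_step] smooth_on_diff smooth_on_const H) auto
  then have c: "smooth_on H (\<lambda>p. (p $ i) powr (\<beta> / \<nu> i) * smooth_step (3 - angular i p))"
    by (intro smooth_on_mult H pw)
  have "smooth_on H (\<lambda>p. ln (p $ i))"
    by (rule smooth_on_compose[OF H _ smooth_on_ln lin]) (auto simp: H_def)
  then have "smooth_on H (\<lambda>p. height i p)"
    unfolding height_def by (rule smooth_on_bounded_linear[OF bounded_linear_divide _ H])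
  then have "smooth_on H (\<lambda>p. \<psi> (height i p))"
    by (rule smooth_on_compose[OF H open_UNIV \<psi>]) simp
  then have "smooth_on H (\<lambda>p. \<psi> (height i p) * ((p $ i) powr (\<beta> / \<nu> i) * smooth_step (3 - angular i p)))"
    by (intro smooth_on_mult H c)
  then have "smooth_on H (\<lambda>p. complex_of_real (\<psi> (height i p) * ((p $ i) powr (\<beta> / \<nu> i) * smooth_step (3 - angular i p))))"
    by (rule smooth_on_bounded_linear[OF bounded_linear_of_real _ H])
  then have sH: "smooth_on H (bump i \<beta> \<psi>)"
    by (rule smooth_on_cong[OF H, rotated]) (simp add: bump_def cutoff_def H_def)
  have sK: "smooth_on (- K) (bump i \<beta> \<psi>)"
    by (rule smooth_on_cong[OF _ _ smooth_on_const[of _ 0]]) (use K vanish compact_imp_closed in auto)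
  have "smooth_on UNIV (bump i \<beta> \<psi>)"
  proof (rule smooth_on_local)
    fix p
    show "\<exists>U. open U \<and> p \<in> U \<and> smooth_on U (bump i \<beta> \<psi>)"
    proof (cases "p \<in> K")
      case True
      then show ?thesis using H KH sH by blast
    next
      case False
      then show ?thesis using sK K compact_imp_closed by (intro exI[of _ "- K"]) auto
    qed
  qed
  moreover have "0 \<notin> K" using KH by (auto simp: H_def)
  ultimately show ?thesis using K vanish unfolding test_def by blast
qed

text \<open>On profiles the Euler operator is \<open>\<beta> + d/dt\<close>: a dilation multiplies
  by \<open>exp (\<beta> t)\<close> and translates the profile.\<close>

lemma euler_bump:
  assumes "profile \<psi>"
  shows "euler (bump i \<beta> \<psi>) = bump i \<beta> (\<lambda>t. \<beta> * \<psi> t + real_deriv \<psi> t)"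
proof
  fix p
  show "euler (bump i \<beta> \<psi>) p = bump i \<beta> (\<lambda>t. \<beta> * \<psi> t + real_deriv \<psi> t) p"
  proof (rule euler_eqI)
    show "smooth_on UNIV (bump i \<beta> \<psi>)" using bump_test[OF assms] by (simp add: test_def)
    have "((\<lambda>t. \<psi> (height i p + t)) has_real_derivative real_deriv \<psi> (height i p + 0)) (at 0)"
      using assms has_real_derivative_real_deriv[of \<psi> "0 + height i p"]
      unfolding profile_def DERIV_shift by (simp add: add.commute)
    then have "((\<lambda>t. exp (\<beta> * t) * (\<psi> (height i p + t) * cutoff i \<beta> p)) has_real_derivative
        (\<beta> * \<psi> (height i p) + real_deriv \<psi> (height i p)) * cutoff i \<beta> p) (at 0)"
      by (auto intro!: derivative_eq_intros simp: algebra_simps)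
    then have "((\<lambda>t. complex_of_real (exp (\<beta> * t) * (\<psi> (height i p + t) * cutoff i \<beta> p))) has_vector_derivative
        complex_of_real ((\<beta> * \<psi> (height i p) + real_deriv \<psi> (height i p)) * cutoff i \<beta> p)) (at 0)"
      by (intro has_vector_derivative_of_real) (simp add: has_real_derivative_iff_has_vector_derivative)
    then show "((\<lambda>t. bump i \<beta> \<psi> (D t p)) has_vector_derivative
        bump i \<beta> (\<lambda>t. \<beta> * \<psi> t + real_deriv \<psi> t) p) (at 0)"
      by (simp add: bump_D, simp add: bump_def)
  qed
qed

text \<open>The point is that \<open>\<xi>\<close> does not depend on \<open>n\<close>. On profiles
  \<open>E - k\<close> acts as \<open>(\<beta> - k) + d/dt\<close>; the derivative turns the plateau
  into a difference of translates of the compactly supported derivative of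
  \<open>smooth_step\<close>, which joins the error term.\<close>

lemma falling_plateau:
  "\<exists>\<xi>. profile \<xi> \<and> (\<forall>n. falling k (bump i \<beta> (plateau n)) =
     bump i \<beta> (\<lambda>t. (\<Prod>j<k. \<beta> - real j) * plateau n t + (\<xi> (t + real n) - \<xi> t)))"
proof (induction k)
  case 0
  show ?case by (intro exI[of _ "\<lambda>t. 0"]) (simp add: profile_0)
next
  case (Suc k)
  then obtain \<xi> where \<xi>: "profile \<xi>" and eq: "\<And>n. falling k (bump i \<beta> (plateau n)) =
     bump i \<beta> (\<lambda>t. (\<Prod>j<k. \<beta> - real j) * plateau n t + (\<xi> (t + real n) - \<xi> t))" by blast
  define P where "P = (\<Prod>j<k. \<beta> - real j)"
  define \<xi>' where "\<xi>' t = 1 * ((\<beta> - real k) * \<xi> t + 1 * real_deriv \<xi> t) + P * real_deriv smooth_step t" for t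
  have "profile \<xi>'"
    unfolding \<xi>'_def[abs_def]
    by (intro profile_lincomb[OF profile_lincomb[OF \<xi> profile_real_deriv[OF \<xi>]] profile_step_deriv])
  moreover have "falling (Suc k) (bump i \<beta> (plateau n)) =
     bump i \<beta> (\<lambda>t. (\<Prod>j<Suc k. \<beta> - real j) * plateau n t + (\<xi>' (t + real n) - \<xi>' t))" for n
  proof -
    let ?\<psi> = "\<lambda>t. P * plateau n t + (\<xi> (t + real n) - \<xi> t)"
    have \<psi>: "profile ?\<psi>"
      using profile_lincomb[OF profile_plateau[of n] profile_lincomb[OF profile_shift[OF \<xi>, of "real n"] \<xi>, of 1 "- 1"], of P 1]
      by simp
    have "real_deriv ?\<psi> t = P * (real_deriv smooth_step (t + real n) - real_deriv smooth_step t)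
        + (real_deriv \<xi> (t + real n) - real_deriv \<xi> t)" for t
    proof -
      have sh: "((\<lambda>t. \<phi> (t + real n)) has_real_derivative real_deriv \<phi> (t + real n)) (at t)"
        if "smooth_on UNIV \<phi>" for \<phi>
        using has_real_derivative_real_deriv[OF that, of "t + real n"] by (simp add: DERIV_shift)
      have "(?\<psi> has_real_derivative P * (real_deriv smooth_step (t + real n) - real_deriv smooth_step t)
        + (real_deriv \<xi> (t + real n) - real_deriv \<xi> t)) (at t)"
        unfolding plateau_def using \<xi>
        by (intro DERIV_add DERIV_diff DERIV_cmult sh has_real_derivative_real_deriv smooth_on_smooth_step)
          (auto simp: profile_def)
      then show ?thesis
        using DERIV_unique has_real_derivative_real_deriv \<psi> unfolding profile_def by blast
    qed
    then have eu: "euler (bump i \<beta> ?\<psi>) = bump i \<beta> (\<lambda>t. \<beta> * ?\<psi> t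
        + (P * (real_deriv smooth_step (t + real n) - real_deriv smooth_step t)
        + (real_deriv \<xi> (t + real n) - real_deriv \<xi> t)))"
      by (simp add: euler_bump[OF \<psi>])
    show ?thesis
      unfolding falling.simps eq P_def[symmetric] eu
      by (rule ext) (simp add: bump_def P_def[symmetric] \<xi>'_def mult.commute[of P "_ - _"] algebra_simps)
  qed
  ultimately show ?case by blast
qed

section \<open>Energies of the near-extremal functions\<close>

lemma energy_scale: "energy s (\<lambda>p. of_real c * g p) = c\<^sup>2 * energy s g"
proof -
  have "N p powr s * (cmod (of_real c * g p))\<^sup>2 = c\<^sup>2 * (N p powr s * (cmod (g p))\<^sup>2)" for p
    by (simp add: norm_mult power_mult_distrib)
  then show ?thesis unfolding energy_def by (simp only: Bochner_Integration.integral_mult_right_zero)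
qed

text \<open>This is the critical weight: the factor \<open>exp (- 2 \<beta> \<tau>)\<close> from the
  degree and \<open>exp (- (Q + s) \<tau>)\<close> from the weighted measure cancel, so translating
  a profile costs no energy.\<close>

lemma energy_bump_shift:
  assumes "profile \<psi>" "s = - 2 * \<beta> - Q"
  shows "energy s (bump i \<beta> (\<lambda>t. \<psi> (t + \<tau>))) = energy s (bump i \<beta> \<psi>)"
proof -
  have "bump i \<beta> (\<lambda>t. \<psi> (t + \<tau>)) p = of_real (exp (- \<beta> * \<tau>)) * bump i \<beta> \<psi> (D \<tau> p)" for p
    unfolding bump_D by (simp add: mult.assoc[symmetric] exp_minus)
  then have "energy s (bump i \<beta> (\<lambda>t. \<psi> (t + \<tau>))) = (exp (- \<beta> * \<tau>))\<^sup>2 * energy s (\<lambda>p. bump i \<beta> \<psi> (D \<tau> p))"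
    using energy_scale by presburger
  also have "\<dots> = (exp (- \<beta> * \<tau>))\<^sup>2 * (exp (- (Q + s) * \<tau>) * energy s (bump i \<beta> \<psi>))"
    by (simp add: energy_dilation[OF bump_test[OF assms(1)]])
  also have "(exp (- \<beta> * \<tau>))\<^sup>2 * exp (- (Q + s) * \<tau>) = 1"
    by (simp add: assms(2) power2_eq_square exp_add[symmetric])
  ultimately show ?thesis by (simp add: mult.assoc[symmetric])
qed

lemma energy_mono:
  assumes "g \<in> test" "h \<in> test" "h' \<in> test"
    "\<And>p. (cmod (g p))\<^sup>2 \<le> a * (cmod (h p))\<^sup>2 + b * (cmod (h' p))\<^sup>2"
  shows "energy s g \<le> a * energy s h + b * energy s h'"
proof -
  have "energy s g \<le> (LINT p|m. a * (N p powr s * (cmod (h p))\<^sup>2) + b * (N p powr s * (cmod (h' p))\<^sup>2))"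
    unfolding energy_def
  proof (rule integral_mono)
    fix p
    show "N p powr s * (cmod (g p))\<^sup>2 \<le> a * (N p powr s * (cmod (h p))\<^sup>2) + b * (N p powr s * (cmod (h' p))\<^sup>2)"
      using mult_left_mono[OF assms(4)[of p], of "N p powr s"] by (simp add: algebra_simps)
  qed (use integrable_energy assms in auto)
  then show ?thesis
    using integrable_energy[OF assms(2), of s] integrable_energy[OF assms(3), of s] by (simp add: energy_def)
qed

text \<open>A plateau of length \<open>n\<close> is a sum of \<open>n\<close> translates of the
  plateau of length 1, all of the same energy; the cross terms are nonnegative and may be
  dropped.\<close>

lemma energy_plateau_ge:
  assumes s: "s = - 2 * \<beta> - Q"
  shows "energy s (bump i \<beta> (plateau n)) \<ge> real n * energy s (bump i \<beta> (plateau 1))"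
proof (induction n)
  case (Suc n)
  let ?g = "bump i \<beta> (plateau n)" and ?h = "bump i \<beta> (\<lambda>t. plateau 1 (t + real n))"
  have t: "?g \<in> test" "?h \<in> test" "bump i \<beta> (plateau (Suc n)) \<in> test"
    by (intro bump_test profile_shift profile_plateau)+
  have "energy s ?g + energy s ?h \<le> energy s (bump i \<beta> (plateau (Suc n)))"
    unfolding energy_def
  proof (subst Bochner_Integration.integral_add[symmetric])
    show "(LINT p|m. N p powr s * (cmod (?g p))\<^sup>2 + N p powr s * (cmod (?h p))\<^sup>2)
        \<le> (LINT p|m. N p powr s * (cmod (bump i \<beta> (plateau (Suc n)) p))\<^sup>2)"
    proof (rule integral_mono)
      fix p
      define x y where "x = plateau n (height i p) * cutoff i \<beta> p"
        and "y = plateau 1 (height i p + real n) * cutoff i \<beta> p"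
      have "x \<ge> 0" "y \<ge> 0" by (simp_all add: x_def y_def plateau_nonneg cutoff_nonneg)
      then have "x\<^sup>2 + y\<^sup>2 \<le> (x + y)\<^sup>2" by (simp add: power2_sum)
      moreover have "(cmod (?g p))\<^sup>2 = x\<^sup>2" "(cmod (?h p))\<^sup>2 = y\<^sup>2"
        "(cmod (bump i \<beta> (plateau (Suc n)) p))\<^sup>2 = (x + y)\<^sup>2"
        unfolding bump_def plateau_Suc norm_of_real power2_abs by (simp_all add: x_def y_def algebra_simps)
      ultimately show "N p powr s * (cmod (?g p))\<^sup>2 + N p powr s * (cmod (?h p))\<^sup>2
          \<le> N p powr s * (cmod (bump i \<beta> (plateau (Suc n)) p))\<^sup>2"
        by (simp add: mult_left_mono flip: distrib_left)
    qed (use integrable_energy t in auto)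
  qed (use integrable_energy t in auto)
  moreover have "energy s ?h = energy s (bump i \<beta> (plateau 1))"
    by (rule energy_bump_shift[OF profile_plateau s])
  ultimately show ?case using Suc by (simp add: algebra_simps)
qed (simp add: energy_nonneg)

lemma energy_plateau_1_pos: "energy s (bump i \<beta> (plateau 1)) > 0"
proof -
  have t: "bump i \<beta> (plateau 1) \<in> test" by (intro bump_test profile_plateau)
  \<comment> \<open>At the \<open>i\<close>-th unit vector \<open>height\<close> is 0,
    \<open>angular\<close> is 1 and \<open>plateau 1 0\<close> is 1.\<close>
  have "angular i (axis i 1) = (\<Sum>j\<in>UNIV. if j = i then 1 else 0)"
    unfolding angular_def by (intro sum.cong) (auto simp: axis_def)
  then have "bump i \<beta> (plateau 1) (axis i 1) = 1"
    by (simp add: bump_def cutoff_def height_def plateau_def smooth_step_eq_0 smooth_step_eq_1)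
  then have "energy s (bump i \<beta> (plateau 1)) \<noteq> 0"
    using energy_eq_0[OF t] by (metis zero_neq_one)
  then show ?thesis using energy_nonneg less_le by metis
qed

text \<open>The weight \<open>1 + \<epsilon>\<close> puts nearly all of the square on the main term.
  The error comes from two translates of the profile \<open>\<xi>\<close>, whose energies do not
  depend on \<open>n\<close>; hence a bound \<open>M\<close> uniform in \<open>n\<close>.\<close>

lemma energy_falling_plateau_le:
  assumes s: "s = - 2 * \<beta> - Q" and \<epsilon>: "\<epsilon> > 0"
  shows "\<exists>M. \<forall>n. energy s (falling k (bump i \<beta> (plateau n))) \<le>
    (1 + \<epsilon>) * (\<Prod>j<k. \<beta> - real j)\<^sup>2 * energy s (bump i \<beta> (plateau n)) + M"
proof -
  define P where "P = (\<Prod>j<k. \<beta> - real j)"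
  obtain \<xi> where \<xi>: "profile \<xi>" and eq: "\<And>n. falling k (bump i \<beta> (plateau n)) =
     bump i \<beta> (\<lambda>t. P * plateau n t + (\<xi> (t + real n) - \<xi> t))"
    using falling_plateau unfolding P_def by blast
  have "energy s (falling k (bump i \<beta> (plateau n))) \<le>
    (1 + \<epsilon>) * P\<^sup>2 * energy s (bump i \<beta> (plateau n)) + (1 + 1 / \<epsilon>) * (4 * energy s (bump i \<beta> \<xi>))" for n
  proof -
    let ?d = "bump i \<beta> (\<lambda>t. 1 * \<xi> (t + real n) + (- 1) * \<xi> t)"
    have t: "bump i \<beta> (plateau n) \<in> test" "bump i \<beta> (\<lambda>t. \<xi> (t + real n)) \<in> test" "bump i \<beta> \<xi> \<in> test" "?d \<in> test"
      by (intro bump_test profile_shift profile_lincomb profile_plateau \<xi>)+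
    have "energy s ?d \<le> 2 * energy s (bump i \<beta> (\<lambda>t. \<xi> (t + real n))) + 2 * energy s (bump i \<beta> \<xi>)"
    proof (rule energy_mono[OF t(4,2,3)])
      fix p
      show "(cmod (?d p))\<^sup>2 \<le> 2 * (cmod (bump i \<beta> (\<lambda>t. \<xi> (t + real n)) p))\<^sup>2 + 2 * (cmod (bump i \<beta> \<xi> p))\<^sup>2"
        using weighted_square_sum[of 1 "\<xi> (height i p + real n) * cutoff i \<beta> p" "- \<xi> (height i p) * cutoff i \<beta> p"]
        unfolding bump_def norm_of_real power2_abs by (simp add: algebra_simps)
    qed
    then have d: "energy s ?d \<le> 4 * energy s (bump i \<beta> \<xi>)"
      using energy_bump_shift[OF \<xi> s] by simp
    have "energy s (falling k (bump i \<beta> (plateau n))) \<le>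
        ((1 + \<epsilon>) * P\<^sup>2) * energy s (bump i \<beta> (plateau n)) + (1 + 1 / \<epsilon>) * energy s ?d"
    proof (rule energy_mono[OF falling_test[OF t(1)] t(1,4)])
      fix p
      show "(cmod (falling k (bump i \<beta> (plateau n)) p))\<^sup>2 \<le>
          (1 + \<epsilon>) * P\<^sup>2 * (cmod (bump i \<beta> (plateau n) p))\<^sup>2 + (1 + 1 / \<epsilon>) * (cmod (?d p))\<^sup>2"
        using weighted_square_sum[OF \<epsilon>, of "P * (plateau n (height i p) * cutoff i \<beta> p)"
            "(1 * \<xi> (height i p + real n) + (- 1) * \<xi> (height i p)) * cutoff i \<beta> p"]
        unfolding eq bump_def norm_of_real power2_abs by (simp add: power_mult_distrib algebra_simps)
    qed
    moreover have "(1 + 1 / \<epsilon>) * energy s ?d \<le> (1 + 1 / \<epsilon>) * (4 * energy s (bump i \<beta> \<xi>))"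
      using d \<epsilon> by (intro mult_left_mono) auto
    ultimately show ?thesis by linarith
  qed
  then show ?thesis unfolding P_def by blast
qed

lemma hardy_sharp:
  assumes k: "k \<ge> 1" and nz: "(\<Prod>j=0..k-1. \<bar>(Q - 2) / 2 - (\<alpha> + real j)\<bar>) \<noteq> 0"
    and C: "\<And>f. f \<in> test \<Longrightarrow> L2_norm_wrt m (\<lambda>x. f x / complex_of_real (N x powr (real k + \<alpha>))) \<le>
      C * L2_norm_wrt m (\<lambda>x. 1 / complex_of_real (N x powr \<alpha>) * (radial ^^ k) f x)"
  shows "inverse (\<Prod>j=0..k-1. \<bar>(Q - 2) / 2 - (\<alpha> + real j)\<bar>) \<le> C"
proof -
  define s where "s = 2 * (- \<alpha> - real k)"
  define \<beta> where "\<beta> = \<alpha> + real k - Q / 2"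
  define i where "i = (undefined :: 'n)"
  define P where "P = (\<Prod>j<k. \<beta> - real j)"
  define a where "a n = energy s (bump i \<beta> (plateau n))" for n
  define b where "b n = energy s (falling k (bump i \<beta> (plateau n)))" for n
  have s: "s = - 2 * \<beta> - Q" by (simp add: s_def \<beta>_def)
  have P_abs: "\<bar>P\<bar> = (\<Prod>j=0..k-1. \<bar>(Q - 2) / 2 - (\<alpha> + real j)\<bar>)"
  proof -
    \<comment> \<open>Replacing \<open>j\<close> by \<open>k - 1 - j\<close> turns
      \<open>\<beta> - j\<close> into the negative of
      \<open>(Q - 2)/2 - (\<alpha> + j)\<close>.\<close>
    have "\<bar>P\<bar> = (\<Prod>j<k. \<bar>\<beta> - real (k - Suc j)\<bar>)"
      unfolding P_def abs_prod by (rule prod.nat_diff_reindex[symmetric])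
    also have "\<dots> = (\<Prod>j<k. \<bar>(Q - 2) / 2 - (\<alpha> + real j)\<bar>)"
    proof (intro prod.cong refl)
      fix j assume "j \<in> {..<k}"
      then have "real (k - Suc j) = real k - 1 - real j" by (simp add: of_nat_diff)
      then show "\<bar>\<beta> - real (k - Suc j)\<bar> = \<bar>(Q - 2) / 2 - (\<alpha> + real j)\<bar>"
        by (simp add: \<beta>_def abs_if field_simps)
    qed
    finally show ?thesis by (simp only: atLeast0_pred[OF k])
  qed
  have a_ge: "a n \<ge> real n * a 1" and a1: "a 1 > 0" for n
    using energy_plateau_ge[OF s] energy_plateau_1_pos by (simp_all add: a_def)
  have ab: "sqrt (a n) \<le> C * sqrt (b n)" for n
  proof -
    have t: "bump i \<beta> (plateau n) \<in> test" by (intro bump_test profile_plateau)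
    show ?thesis
      using C[OF t] L2_lhs[of "bump i \<beta> (plateau n)" k \<alpha>] L2_radial[OF t, of \<alpha> k]
      by (simp add: a_def b_def s_def real_sqrt_unique L2_norm_wrt_nonneg)
  qed
  have b0: "b n \<ge> 0" "a n \<ge> 0" for n by (simp_all add: b_def a_def energy_nonneg)
  \<comment> \<open>\<open>C\<close> is an arbitrary real; its sign must be settled before
    inequalities are squared.\<close>
  have C0: "C > 0"
  proof (rule ccontr)
    assume "\<not> C > 0"
    then have "C * sqrt (b 1) \<le> 0" using b0 by (simp add: mult_le_0_iff)
    moreover have "sqrt (a 1) > 0" using a1 by simp
    ultimately show False using ab[of 1] by linarith
  qed
  have ab2: "a n \<le> C\<^sup>2 * b n" for n
  proof -
    have "(sqrt (a n))\<^sup>2 \<le> (C * sqrt (b n))\<^sup>2" using ab[of n] b0 by (intro power_mono) auto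
    then show ?thesis using b0 by (simp add: power_mult_distrib)
  qed
  have "C * \<bar>P\<bar> \<ge> 1"
  proof (rule ccontr)
    assume "\<not> ?thesis"
    then have "(C * \<bar>P\<bar>)\<^sup>2 < 1" using C0 by (simp add: abs_square_less_1 abs_mult)
    then have CP: "C\<^sup>2 * P\<^sup>2 < 1" by (simp add: power_mult_distrib)
    define r where "r = C\<^sup>2 * P\<^sup>2"
    have r: "0 \<le> r" "r < 1" using CP by (simp_all add: r_def)
    \<comment> \<open>With this choice
      \<open>(1 + \<epsilon>) r \<le> r + \<epsilon> = (1 + r)/2 < 1\<close>, so the main term can
      be absorbed and \<open>a n\<close> stays bounded, against its linear growth.\<close>
    define \<epsilon> where "\<epsilon> = (1 - r) / 2"
    have \<epsilon>: "\<epsilon> > 0" using r by (simp add: \<epsilon>_def)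
    obtain M where M: "\<And>n. b n \<le> (1 + \<epsilon>) * P\<^sup>2 * a n + M"
      using energy_falling_plateau_le[OF s \<epsilon>] unfolding a_def b_def P_def by blast
    define \<delta> where "\<delta> = 1 - (1 + \<epsilon>) * r"
    have "(1 + \<epsilon>) * r = r + \<epsilon> * r" by (simp add: algebra_simps)
    also have "\<dots> \<le> r + \<epsilon> * 1" using r \<epsilon> by (intro add_left_mono mult_left_mono) auto
    also have "\<dots> < 1" using r by (simp add: \<epsilon>_def field_simps)
    finally have \<delta>: "\<delta> > 0" by (simp add: \<delta>_def)
    have bound: "real n * (a 1 * \<delta>) \<le> C\<^sup>2 * M" for n
    proof -
      have "a n \<le> C\<^sup>2 * ((1 + \<epsilon>) * P\<^sup>2 * a n + M)"
        using ab2[of n] mult_left_mono[OF M[of n], of "C\<^sup>2"] by simp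
      then have "a n * \<delta> \<le> C\<^sup>2 * M" by (simp add: \<delta>_def r_def algebra_simps)
      moreover have "real n * a 1 * \<delta> \<le> a n * \<delta>" using a_ge[of n] \<delta> by (intro mult_right_mono) auto
      ultimately show ?thesis by (simp add: mult.assoc)
    qed
    obtain n where "real n * (a 1 * \<delta>) > C\<^sup>2 * M"
      using ex_less_of_nat_mult[of "a 1 * \<delta>" "C\<^sup>2 * M"] a1 \<delta> by auto
    then show False using bound[of n] by simp
  qed
  moreover have "\<bar>P\<bar> > 0" using nz unfolding P_abs[symmetric] by simp
  ultimately show ?thesis
    unfolding P_abs[symmetric] by (simp add: field_simps)
qed

end

section \<open>Transfer to the group\<close>

text \<open>\<open>F\<close> is arbitrary. If its squared modulus is not measurable, both integrals
  are 0 by convention; the measurable inverse \<open>h'\<close> transfers this failure between the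
  two sides.\<close>

lemma L2_norm_wrt_distr:
  assumes h: "h \<in> borel_measurable m" and h': "h' \<in> borel_measurable borel"
    and inv: "\<And>x. h (h' x) = x" "\<And>p. h' (h p) = p" and m: "sets m = sets borel"
  shows "L2_norm_wrt (distr m borel h) F = L2_norm_wrt m (\<lambda>p. F (h p))"
proof -
  let ?G = "\<lambda>x. (cmod (F x))\<^sup>2"
  have "(LINT x|distr m borel h. ?G x) = (LINT p|m. ?G (h p))"
  proof (cases "?G \<in> borel_measurable borel")
    case True
    then show ?thesis using h by (intro integral_distr) auto
  next
    case False
    then have "\<not> integrable (distr m borel h) ?G"
      using borel_measurable_integrable by force
    moreover have "\<not> integrable m (\<lambda>p. ?G (h p))"
    proof
      assume "integrable m (\<lambda>p. ?G (h p))"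
      then have "(\<lambda>p. ?G (h p)) \<in> borel_measurable borel"
        using borel_measurable_integrable measurable_cong_sets[OF m refl] by blast
      from measurable_compose[OF h' this] show False using False by (simp add: inv)
    qed
    ultimately show ?thesis by (simp add: not_integrable_integral_eq)
  qed
  then show ?thesis by (simp add: L2_norm_wrt_def)
qed

context homogeneous_group_basis
begin

lemma ex_eq_0_iff: "ex p = 0 \<longleftrightarrow> p = 0"
  by (metis ex_0 lg_ex)

text \<open>Compactness of the closure amounts to vanishing outside some compact set, because
  \<open>ex\<close> maps compact sets to compact, hence closed, sets.\<close>

lemma test_functions_transfer:
  "f \<in> test_functions charts \<longleftrightarrow>
     smooth_on UNIV (\<lambda>p. f (ex p)) \<and> (\<exists>K. compact K \<and> 0 \<notin> K \<and> (\<forall>p. p \<notin> K \<longrightarrow> f (ex p) = 0))"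
proof -
  have sm: "smooth_fun charts f \<longleftrightarrow> smooth_on UNIV (\<lambda>p. f (ex p))"
  proof
    assume "smooth_fun charts f"
    then show "smooth_on UNIV (\<lambda>p. f (ex p))"
      unfolding ex_def smooth_fun_iff
      by (rule smooth_on_compose[OF open_UNIV open_UNIV _ smooth_on_linear[OF bounded_linear_comb]]) auto
  next
    assume "smooth_on UNIV (\<lambda>p. f (ex p))"
    then have "smooth_on UNIV (\<lambda>X. f (ex (coords X)))"
      by (rule smooth_on_compose[OF open_UNIV open_UNIV _ smooth_on_linear[OF bounded_linear_coords]]) auto
    then show "smooth_fun charts f" by (simp add: smooth_fun_iff ex_def)
  qed
  have supp: "compact (closure {x. f x \<noteq> 0}) \<and> 0 \<notin> closure {x. f x \<noteq> 0} \<longleftrightarrow>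
      (\<exists>K. compact K \<and> 0 \<notin> K \<and> (\<forall>p. p \<notin> K \<longrightarrow> f (ex p) = 0))"
  proof
    assume c: "compact (closure {x. f x \<noteq> 0}) \<and> 0 \<notin> closure {x. f x \<noteq> 0}"
    let ?K = "lg ` closure {x. f x \<noteq> 0}"
    have "compact ?K" using c continuous_lg by (blast intro: compact_continuous_image)
    moreover have "0 \<notin> ?K" using c by (metis ex_0 ex_lg imageE)
    moreover have "f (ex p) = 0" if "p \<notin> ?K" for p
      using that closure_subset[of "{x. f x \<noteq> 0}"] by (metis (mono_tags, lifting) image_eqI lg_ex mem_Collect_eq subsetD)
    ultimately show "\<exists>K. compact K \<and> 0 \<notin> K \<and> (\<forall>p. p \<notin> K \<longrightarrow> f (ex p) = 0)" by blast
  next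
    assume "\<exists>K. compact K \<and> 0 \<notin> K \<and> (\<forall>p. p \<notin> K \<longrightarrow> f (ex p) = 0)"
    then obtain K where K: "compact K" "0 \<notin> K" "\<And>p. p \<notin> K \<Longrightarrow> f (ex p) = 0" by blast
    have c: "compact (ex ` K)" using K(1) continuous_ex by (rule compact_continuous_image[rotated])
    have "{x. f x \<noteq> 0} \<subseteq> ex ` K"
      using K(3) by (metis (mono_tags, lifting) ex_lg image_eqI mem_Collect_eq subsetI)
    then have sub: "closure {x. f x \<noteq> 0} \<subseteq> ex ` K"
      using compact_imp_closed[OF c] by (rule closure_minimal)
    then have "compact (ex ` K \<inter> closure {x. f x \<noteq> 0})"
      using c by (intro compact_Int_closed) auto
    moreover have "ex ` K \<inter> closure {x. f x \<noteq> 0} = closure {x. f x \<noteq> 0}" using sub by blast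
    moreover have "0 \<notin> ex ` K" using K(2) by (metis ex_eq_0_iff imageE)
    ultimately show "compact (closure {x. f x \<noteq> 0}) \<and> 0 \<notin> closure {x. f x \<noteq> 0}" using sub by auto
  qed
  show ?thesis unfolding test_functions_def mem_Collect_eq sm supp ..
qed

text \<open>Local finiteness and full support are read off from \<open>\<mu>\<close>, which spares
  an analysis of the constant \<open>c\<close>; the scaling is inherited from
  \<open>haar_coords\<close>.\<close>

lemma dilation_space_coords:
  assumes N: "homogeneous_quasi_norm A expG N" and \<mu>: "haar_measure \<mu>"
    and m: "\<mu> = distr (density haar_coords (\<lambda>_. c)) borel ex"
  shows "dilation_space \<nu> (\<lambda>p. N (ex p)) (density haar_coords (\<lambda>_. c)) (trace_op A)"
proof
  let ?m = "density haar_coords (\<lambda>_. c)"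
  have [measurable]: "ex \<in> borel_measurable borel" "lg \<in> borel_measurable borel"
    by (auto intro!: borel_measurable_continuous_onI continuous_ex continuous_lg)
  have m_eq: "emeasure ?m S = emeasure \<mu> (lg -` S)" if S: "S \<in> sets borel" for S
  proof -
    have "lg -` S \<in> sets borel" using measurable_sets_borel[OF _ S, of lg] by simp
    then have "emeasure \<mu> (lg -` S) = emeasure ?m (ex -` lg -` S \<inter> space ?m)"
      unfolding m by (intro emeasure_distr) simp_all
    then show ?thesis
      using sets_eq_imp_space_eq[of ?m borel] by (simp add: vimage_def)
  qed
  show "sets ?m = sets borel" by simp
  show "\<nu> i > 0" for i by (rule eigenvalue_pos)
  show "continuous_on UNIV (\<lambda>p. N (ex p))"
    using N continuous_on_compose2[OF _ continuous_ex] by (auto simp: homogeneous_quasi_norm_def)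
  show "N (ex p) \<ge> 0" for p using N by (simp add: homogeneous_quasi_norm_def)
  show "N (ex (weighted_dilation \<nu> s p)) = s * N (ex p)" if "s > 0" for s p
    using N that by (simp add: homogeneous_quasi_norm_def dil_ex[symmetric])
  show "N (ex p) = 0 \<longleftrightarrow> p = 0" for p
    using N by (simp add: homogeneous_quasi_norm_def ex_eq_0_iff)
  show "distr ?m borel (weighted_dilation \<nu> s) = density ?m (\<lambda>_. ennreal (s powr - trace_op A))" if "s > 0" for s
  proof -
    have [measurable]: "weighted_dilation \<nu> s \<in> borel_measurable borel"
      by (intro borel_measurable_continuous_onI linear_continuous_on)
        (simp add: linear_weighted_dilation linear_conv_bounded_linear[symmetric])
    have "distr ?m borel (weighted_dilation \<nu> s) = density (distr haar_coords borel (weighted_dilation \<nu> s)) (\<lambda>_. c)"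
      by (subst density_distr) auto
    also have "\<dots> = density ?m (\<lambda>_. ennreal (s powr - trace_op A))"
      by (simp add: haar_coords_dilation[OF that] density_density_eq mult.commute)
    finally show ?thesis .
  qed
  show "emeasure ?m K < \<infinity>" if "compact K" for K
  proof -
    have "lg -` K = ex ` K" by (auto simp: image_iff intro!: bexI[of _ "lg _"])
    then show ?thesis
      using \<mu> compact_continuous_image[OF continuous_ex that] borel_compact[OF that]
      by (simp add: m_eq haar_measure_def)
  qed
  show "emeasure ?m U > 0" if U: "open U" "U \<noteq> {}" for U
  proof -
    obtain u where "u \<in> U" using U(2) by blast
    then have "ex u \<in> lg -` U" by simp
    then have "emeasure \<mu> (lg -` U) > 0"
      using \<mu> open_vimage[OF U(1) continuous_lg] unfolding haar_measure_def by blast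
    then show ?thesis using U by (simp add: m_eq)
  qed
qed

lemma hardy_rellich:
  fixes N :: "'g \<Rightarrow> real" and \<mu> :: "'g measure"
  assumes Q: "Q = trace_op A" and N: "homogeneous_quasi_norm A expG N" and \<mu>: "haar_measure \<mu>"
    and R: "R = radial_deriv A expG N"
  shows
    "(\<forall>(\<alpha>::real) (k::nat). k \<ge> 1 \<longrightarrow> (\<Prod>j=0..k-1. \<bar>(Q - 2) / 2 - (\<alpha> + real j)\<bar>) \<noteq> 0 \<longrightarrow>
       (let c = inverse (\<Prod>j=0..k-1. \<bar>(Q - 2) / 2 - (\<alpha> + real j)\<bar>);
            lhs = (\<lambda>f. L2_norm_wrt \<mu> (\<lambda>x. f x / complex_of_real (N x powr (real k + \<alpha>))));
            rhs = (\<lambda>f. L2_norm_wrt \<mu> (\<lambda>x. 1 / complex_of_real (N x powr \<alpha>) * (R ^^ k) f x))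
        in (\<forall>f\<in>test_functions charts. lhs f \<le> c * rhs f) \<and>
           (\<forall>C. (\<forall>f\<in>test_functions charts. lhs f \<le> C * rhs f) \<longrightarrow> c \<le> C) \<and>
           (\<forall>f\<in>test_functions charts. lhs f = c * rhs f \<longleftrightarrow> f = (\<lambda>x. 0))))
     \<and>
     (\<forall>(k::nat) (\<alpha>::real). k \<ge> 1 \<longrightarrow> (\<forall>f\<in>test_functions charts.
        (L2_norm_wrt \<mu> (\<lambda>x. 1 / complex_of_real (N x powr \<alpha>) * (R ^^ k) f x))\<^sup>2 =
          (\<Prod>j=0..k-1. ((Q - 2) / 2 - (\<alpha> + real j))\<^sup>2) *
            (L2_norm_wrt \<mu> (\<lambda>x. f x / complex_of_real (N x powr (real k + \<alpha>))))\<^sup>2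
          + (\<Sum>l=1..k-1. (\<Prod>j=0..l-1. ((Q - 2) / 2 - (\<alpha> + real j))\<^sup>2) *
              (L2_norm_wrt \<mu> (\<lambda>x.
                 1 / complex_of_real (N x powr (real l + \<alpha>)) * (R ^^ (k - l)) f x
                 + complex_of_real ((Q - 2 * (real l + 1 + \<alpha>)) / (2 * N x powr (real l + 1 + \<alpha>)))
                     * (R ^^ (k - l - 1)) f x))\<^sup>2)
          + (L2_norm_wrt \<mu> (\<lambda>x.
               1 / complex_of_real (N x powr \<alpha>) * (R ^^ k) f x
               + complex_of_real ((Q - 2 - 2 * \<alpha>) / (2 * N x powr (1 + \<alpha>)))
                   * (R ^^ (k - 1)) f x))\<^sup>2))"
proof -
  obtain c where m: "\<mu> = distr (density haar_coords (\<lambda>_. c)) borel ex"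
    using haar_measure_eq_coords[OF \<mu>] .
  define m where "m = density haar_coords (\<lambda>_. c)"
  define N' where "N' p = N (ex p)" for p
  interpret dilation_space \<nu> N' m Q
    unfolding N'_def[abs_def] m_def Q by (rule dilation_space_coords[OF N \<mu> m])
  have L2: "L2_norm_wrt \<mu> F = L2_norm_wrt m (\<lambda>p. F (ex p))" for F
    unfolding m m_def[symmetric]
    by (rule L2_norm_wrt_distr[of ex m lg])
      (auto simp: m_def measurable_cong_sets[OF sets_haar_coords refl]
        intro!: borel_measurable_continuous_onI continuous_ex continuous_lg)
  have R_ex: "R f (ex p) = radial (\<lambda>p. f (ex p)) p" for f p
  proof (cases "p = 0")
    case True
    then show ?thesis by (simp add: R radial_deriv_def radial_def)
  next
    case False
    then have \<rho>: "N' p > 0" by (rule N_pos)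
    \<comment> \<open>The dilation formula in coordinates holds for \<open>r > 0\<close>, which
      suffices near the positive point \<open>N' p\<close>.\<close>
    have "\<forall>\<^sub>F r in nhds (N' p). r > 0"
      by (rule eventually_nhds_in_open[of "{0<..}" "N' p", simplified]) (use \<rho> in auto)
    then have "\<forall>\<^sub>F r in nhds (N' p). r \<in> UNIV \<longrightarrow> f (dil A expG r (dil A expG (1 / N' p) (ex p))) =
        f (ex (weighted_dilation \<nu> r (weighted_dilation \<nu> (1 / N' p) p)))"
      by eventually_elim (use \<rho> in \<open>simp add: dil_ex\<close>)
    then have "vector_derivative (\<lambda>r. f (dil A expG r (dil A expG (1 / N' p) (ex p)))) (at (N' p)) =
        vector_derivative (\<lambda>r. f (ex (weighted_dilation \<nu> r (weighted_dilation \<nu> (1 / N' p) p)))) (at (N' p))"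
      by (rule vector_derivative_cong_eq) auto
    then show ?thesis
      using False by (simp add: R radial_deriv_def radial_def ex_eq_0_iff Let_def flip: N'_def)
  qed
  have Rk: "(\<lambda>p. (R ^^ k) f (ex p)) = (radial ^^ k) (\<lambda>p. f (ex p))" for k f
    by (induction k) (simp_all add: R_ex fun_eq_iff)
  have Rk': "(R ^^ k) f (ex p) = (radial ^^ k) (\<lambda>p. f (ex p)) p" for k f p
    using Rk by metis
  have test: "f \<in> test_functions charts \<longleftrightarrow> (\<lambda>p. f (ex p)) \<in> test" for f
    by (simp add: test_functions_transfer test_def)
  \<comment> \<open>For sharpness: the near-extremal functions are built in coordinates and must
    come from functions on the group.\<close>
  have surj: "\<exists>f\<in>test_functions charts. (\<lambda>p. f (ex p)) = g" if "g \<in> test" for g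
    using that by (intro bexI[of _ "\<lambda>x. g (lg x)"]) (simp_all add: test)
  have zero: "f = (\<lambda>x. 0) \<longleftrightarrow> (\<lambda>p. f (ex p)) = (\<lambda>p. 0)" for f :: "'g \<Rightarrow> complex"
    by (metis ex_lg)
  note transfer = L2 Rk' N'_def[symmetric]
  show ?thesis
    unfolding Let_def transfer
  proof (intro conjI allI impI ballI)
    fix \<alpha> :: real and k :: nat
    assume k: "k \<ge> 1" and nz: "(\<Prod>j=0..k-1. \<bar>(Q - 2) / 2 - (\<alpha> + real j)\<bar>) \<noteq> 0"
    let ?c = "inverse (\<Prod>j=0..k-1. \<bar>(Q - 2) / 2 - (\<alpha> + real j)\<bar>)"
    show "L2_norm_wrt m (\<lambda>p. f (ex p) / complex_of_real (N' p powr (real k + \<alpha>))) \<le>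
        ?c * L2_norm_wrt m (\<lambda>p. 1 / complex_of_real (N' p powr \<alpha>) * (radial ^^ k) (\<lambda>p. f (ex p)) p)"
      if "f \<in> test_functions charts" for f
      using that hardy_inequality(1)[OF _ k nz] by (simp only: test)
    show "?c \<le> C" if C: "\<forall>f\<in>test_functions charts.
        L2_norm_wrt m (\<lambda>p. f (ex p) / complex_of_real (N' p powr (real k + \<alpha>))) \<le>
        C * L2_norm_wrt m (\<lambda>p. 1 / complex_of_real (N' p powr \<alpha>) * (radial ^^ k) (\<lambda>p. f (ex p)) p)" for C
      by (rule hardy_sharp[OF k nz]) (use C surj in fastforce)
    show "L2_norm_wrt m (\<lambda>p. f (ex p) / complex_of_real (N' p powr (real k + \<alpha>))) =
        ?c * L2_norm_wrt m (\<lambda>p. 1 / complex_of_real (N' p powr \<alpha>) * (radial ^^ k) (\<lambda>p. f (ex p)) p)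
        \<longleftrightarrow> f = (\<lambda>x. 0)"
      if f: "f \<in> test_functions charts" for f
    proof
      assume "L2_norm_wrt m (\<lambda>p. f (ex p) / complex_of_real (N' p powr (real k + \<alpha>))) =
        ?c * L2_norm_wrt m (\<lambda>p. 1 / complex_of_real (N' p powr \<alpha>) * (radial ^^ k) (\<lambda>p. f (ex p)) p)"
      with f show "f = (\<lambda>x. 0)"
        unfolding zero test using hardy_inequality(2)[OF _ k nz] by blast
    next
      assume f0: "f = (\<lambda>x. 0)"
      then have g: "(\<lambda>p. f (ex p)) = (\<lambda>p. 0)" by simp
      have t: "(\<lambda>p. 0) \<in> test" using f unfolding test g .
      have "0 \<le> ?c" by (simp add: prod_nonneg)
      have "euler (\<lambda>p. 0) = (\<lambda>p. 0)"
        using euler_lincomb[OF t t, of 0 0] by (simp add: fun_eq_iff)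
      then have fall: "falling k (\<lambda>p. 0) = (\<lambda>p. 0)"
        by (induction k) simp_all
      show "L2_norm_wrt m (\<lambda>p. f (ex p) / complex_of_real (N' p powr (real k + \<alpha>))) =
        ?c * L2_norm_wrt m (\<lambda>p. 1 / complex_of_real (N' p powr \<alpha>) * (radial ^^ k) (\<lambda>p. f (ex p)) p)"
        unfolding g radial_power[OF t] fall by (simp add: L2_norm_wrt_def f0)
    qed
  next
    fix k :: nat and \<alpha> :: real and f
    assume k: "k \<ge> 1" and f: "f \<in> test_functions charts"
    show "(L2_norm_wrt m (\<lambda>p. 1 / complex_of_real (N' p powr \<alpha>) * (radial ^^ k) (\<lambda>p. f (ex p)) p))\<^sup>2 =
          (\<Prod>j=0..k-1. ((Q - 2) / 2 - (\<alpha> + real j))\<^sup>2) *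
            (L2_norm_wrt m (\<lambda>p. f (ex p) / complex_of_real (N' p powr (real k + \<alpha>))))\<^sup>2
          + (\<Sum>l=1..k-1. (\<Prod>j=0..l-1. ((Q - 2) / 2 - (\<alpha> + real j))\<^sup>2) *
              (L2_norm_wrt m (\<lambda>p.
                 1 / complex_of_real (N' p powr (real l + \<alpha>)) * (radial ^^ (k - l)) (\<lambda>p. f (ex p)) p
                 + complex_of_real ((Q - 2 * (real l + 1 + \<alpha>)) / (2 * N' p powr (real l + 1 + \<alpha>)))
                     * (radial ^^ (k - l - 1)) (\<lambda>p. f (ex p)) p))\<^sup>2)
          + (L2_norm_wrt m (\<lambda>p.
               1 / complex_of_real (N' p powr \<alpha>) * (radial ^^ k) (\<lambda>p. f (ex p)) p
               + complex_of_real ((Q - 2 - 2 * \<alpha>) / (2 * N' p powr (1 + \<alpha>)))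
                   * (radial ^^ (k - 1)) (\<lambda>p. f (ex p)) p))\<^sup>2"
      by (rule radial_identity[OF _ k]) (use f test in blast)
  qed
qed

end

text \<open>A basis of eigenvectors has \<open>DIM('a)\<close> elements, as many as
  \<open>basis_index\<close>, so it can be indexed by that well-ordered type.\<close>

lemma (in homogeneous_group) eigenbasis:
  obtains \<beta> :: "'a basis_index \<Rightarrow> 'a" and \<nu> where "homogeneous_group_basis charts vf expG A \<beta> \<nu>"
proof -
  obtain B where B: "independent B" "span B = UNIV" "\<forall>b\<in>B. \<exists>r. A b = r *\<^sub>R b"
    using diagonalisable unfolding diagonalisable_def by blast
  have "finite B" using B(1) by (rule independent_imp_finite)
  moreover have "card B = CARD('a basis_index)"
    using basis_card_eq_dim[of B UNIV] B by (simp add: card_basis_index)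
  ultimately obtain \<beta> :: "'a basis_index \<Rightarrow> 'a" where \<beta>: "bij_betw \<beta> UNIV B"
    using finite_same_card_bij[of "UNIV :: 'a basis_index set" B] by auto
  then have range: "range \<beta> = B" and inj: "inj \<beta>" by (auto simp: bij_betw_def)
  have "\<forall>i. \<exists>r. A (\<beta> i) = r *\<^sub>R \<beta> i" using B(3) range by blast
  then obtain \<nu> where "\<And>i. A (\<beta> i) = \<nu> i *\<^sub>R \<beta> i" by metis
  then have "homogeneous_group_basis charts vf expG A \<beta> \<nu>"
    using B range inj by unfold_locales auto
  then show ?thesis by (rule that)
qed

theorem theorem6p1:
  fixes charts ::
      "('g::{topological_group_add, t2_space, second_countable_topology}, 'a::euclidean_space) chart set"
    and vf :: "'a \<Rightarrow> ('g \<Rightarrow> real) \<Rightarrow> ('g \<Rightarrow> real)"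
    and expG :: "'a \<Rightarrow> 'g"
    and A :: "'a \<Rightarrow> 'a"
    and N :: "'g \<Rightarrow> real"
    and \<mu> :: "'g measure"
    and Q :: real
    and R :: "('g \<Rightarrow> complex) \<Rightarrow> ('g \<Rightarrow> complex)"
  assumes "homogeneous_group charts vf expG A"
    and "Q = trace_op A" and "Q \<ge> 3"
    and "homogeneous_quasi_norm A expG N"
    and "haar_measure \<mu>"
    and "R = radial_deriv A expG N"
  shows
    "(\<forall>(\<alpha>::real) (k::nat). k \<ge> 1 \<longrightarrow> (\<Prod>j=0..k-1. \<bar>(Q - 2) / 2 - (\<alpha> + real j)\<bar>) \<noteq> 0 \<longrightarrow>
       (let c = inverse (\<Prod>j=0..k-1. \<bar>(Q - 2) / 2 - (\<alpha> + real j)\<bar>);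
            lhs = (\<lambda>f. L2_norm_wrt \<mu> (\<lambda>x. f x / complex_of_real (N x powr (real k + \<alpha>))));
            rhs = (\<lambda>f. L2_norm_wrt \<mu> (\<lambda>x. 1 / complex_of_real (N x powr \<alpha>) * (R ^^ k) f x))
        in (\<forall>f\<in>test_functions charts. lhs f \<le> c * rhs f) \<and>
           (\<forall>C. (\<forall>f\<in>test_functions charts. lhs f \<le> C * rhs f) \<longrightarrow> c \<le> C) \<and>
           (\<forall>f\<in>test_functions charts. lhs f = c * rhs f \<longleftrightarrow> f = (\<lambda>x. 0))))
     \<and>
     (\<forall>(k::nat) (\<alpha>::real). k \<ge> 1 \<longrightarrow> (\<forall>f\<in>test_functions charts.
        (L2_norm_wrt \<mu> (\<lambda>x. 1 / complex_of_real (N x powr \<alpha>) * (R ^^ k) f x))\<^sup>2 =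
          (\<Prod>j=0..k-1. ((Q - 2) / 2 - (\<alpha> + real j))\<^sup>2) *
            (L2_norm_wrt \<mu> (\<lambda>x. f x / complex_of_real (N x powr (real k + \<alpha>))))\<^sup>2
          + (\<Sum>l=1..k-1. (\<Prod>j=0..l-1. ((Q - 2) / 2 - (\<alpha> + real j))\<^sup>2) *
              (L2_norm_wrt \<mu> (\<lambda>x.
                 1 / complex_of_real (N x powr (real l + \<alpha>)) * (R ^^ (k - l)) f x
                 + complex_of_real ((Q - 2 * (real l + 1 + \<alpha>)) / (2 * N x powr (real l + 1 + \<alpha>)))
                     * (R ^^ (k - l - 1)) f x))\<^sup>2)
          + (L2_norm_wrt \<mu> (\<lambda>x.
               1 / complex_of_real (N x powr \<alpha>) * (R ^^ k) f x
               + complex_of_real ((Q - 2 - 2 * \<alpha>) / (2 * N x powr (1 + \<alpha>)))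
                   * (R ^^ (k - 1)) f x))\<^sup>2))"
proof -
  interpret homogeneous_group charts vf expG A by fact
  obtain \<beta> :: "'a basis_index \<Rightarrow> 'a" and \<nu> where "homogeneous_group_basis charts vf expG A \<beta> \<nu>"
    by (rule eigenbasis)
  then interpret homogeneous_group_basis charts vf expG A \<beta> \<nu> .
  show ?thesis by (rule hardy_rellich) fact+
qed

end
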